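(* For each $m$-element subset $I\subset[1,mn]$ let $c_I=\sum_J\widetilde b_J\otimes\xi^J_I\in\widetilde{\mathcal B}\widetilde\otimes\mathscr{F}_R(M(mn))$, where $J$ runs over all $m$-element subsets of $[1,mn]$ and $\xi^J_I$ are the dynamical quantum minors of $\mathscr{F}_R(M(mn))$, and let $C=(c_I)$. Then in $\widetilde{\mathcal B}\widetilde\otimes\mathscr{F}_R(M(mn))$ $$\widetilde{\mathrm{Pf}}_m(C)=\widetilde{\mathrm{Pf}}_m(\widetilde B)\otimes\det(T).$$
   Context: Notation: $m,n$ are positive integers, $N=mn$, $[1,N]=\{1,\ldots,N\}$; $q\in\mathbb C^\times$ is generic; $\mathfrak h^*\cong\mathbb C^{N}$ with basis $e_1,\ldots,e_N$, $\omega(i)=e_i$; $M_{\mathfrak h^*}$ is the algebra of meromorphic functions $f(\underline\lambda)=f(\lambda_1,\ldots,\lambda_N)$ on $\mathfrak h^*$. Set $h(\lambda)=q\dfrac{q^{-2\lambda}-q^{-2}}{q^{-2\lambda}-1}$, $g(\lambda)=h(\lambda)h(-\lambda)$. $\mathscr{F}_R(M(N))$ is the associative algebra generated by $t_{ij}$ ($1\le i,j\le N$) and two copies of $M_{\mathfrak h^*}$ embedded as subalgebras, with elements $f(\underline\lambda)=\mu_l(f)$ and $f(\underline\mu)=\mu_r(f)$, subject to: $f_1(\underline\lambda)f_2(\underline\mu)=f_2(\underline\mu)f_1(\underline\lambda)$, $f(\underline\lambda)t_{ij}=t_{ij}f(\underline\lambda+\omega(i))$, $f(\underline\mu)t_{ij}=t_{ij}f(\underline\mu+\omega(j))$,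 and - $h(\mu_k-\mu_l)t_{ik}t_{il}=t_{il}t_{ik}$ for $k<l$; - $h(\lambda_j-\lambda_i)t_{jk}t_{ik}=t_{ik}t_{jk}$ for $i<j$; - $t_{ik}t_{jl}=t_{jl}t_{ik}+(h(\lambda_j-\lambda_i)-h(\mu_k-\mu_l))t_{jk}t_{il}$ for $i<j$, $k<l$; - $g(\mu_k-\mu_l)t_{ik}t_{jl}=g(\lambda_i-\lambda_j)t_{jl}t_{ik}+(h(\mu_l-\mu_k)-h(\lambda_i-\lambda_j))t_{il}t_{jk}$ for $i<j$, $k<l$. For $I=\{i_1<\cdots<i_r\}\subset[1,N]$ and $\sigma\in S_r$, set $S(\sigma,I)(\underline\lambda)=\prod_{k<l,\ \sigma(k)>\sigma(l)}(-h(\lambda_{i_{\sigma(k)}}-\lambda_{i_{\sigma(l)}}))$ and $\widetilde S(\sigma,I)(\underline\lambda)=\prod_{k<l,\ \sigma(k)>\sigma(l)}(-h(\lambda_{i_{\sigma(l)}}-\lambda_{i_{\sigma(k)}}))$. For $J=\{j_1<\cdots<j_r\}$ the dynamical quantum minor is $\xi^I_J=\mu_r(S(\rho,J)^{-1})\sum_{\sigma\in S_r}\mu_l(S(\sigma,I))\,t_{i_{\sigma(1)}j_{\rho(1)}}\cdots t_{i_{\sigma(r)}j_{\rho(r)}}$, which is independent of $\rho\in S_r$ (one may take $\rho=\mathrm{id}$). $\det(T)=\xi^{[1,N]}_{[1,N]}$, where $T=(t_{ij})$. $\widetilde{\mathcal B}$ is the algebra generated by $\widetilde b_{i_1\cdots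 i_m}$, $mn\ge i_1>\cdots>i_m\ge1$, and a copy of $M_{\mathfrak h^*}$ embedded as a subalgebra, its elements denoted by $f(\underline\lambda)$ (no further relations are specified). For $I=\{i_1<\cdots<i_m\}$ write $\widetilde b_I=\widetilde b_{i_m\cdots i_1}$. $\widetilde{\mathcal B}\widetilde\otimes\mathscr{F}_R(M(mn))$ denotes the usual tensor product (with factorwise products) modulo the relations $b\otimes\mu_l(f)t=fb\otimes t$ and $f(b\otimes t)=b\otimes\mu_r(f)t$ for $f\in M_{\mathfrak h^*}$; the second describes how $f$ acts on the left. For a family $X=(x_I)$ indexed by $m$-subsets $I=\{i_1<\cdots<i_m\}$ of $[1,mn]$, written $x_I=x_{i_m\cdots i_1}$ (decreasing indices; here $X=\widetilde B=(\widetilde b_I)$ or $X=C$), the dynamical quantum hyper-Pfaffian is $$\widetilde{\mathrm{Pf}}_m(X)=\sum_{\sigma}\widetilde S(\sigma,[1,mn])\,x_{\sigma(mn)\cdots\sigma(mn-m+1)}\,x_{\sigma(mn-m)\cdots\sigma(mn-2m+1)}\cdots x_{\sigma(m)\cdots\sigma(1)},$$ the sum over all $\sigma\in S_{mn}$ with $\sigma((k-1)m+1)<\cdots<\sigma(km)$ for $k=1,\ldots,n$ (the order of the blocks is not restricted).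
   Formalization: To the defining relations of F_R(M(N)) the relation t_il t_jk = g(λ_i−λ_j) t_jk t_il + (h(μ_k−μ_l) − h(λ_i−λ_j)) t_ik t_jl (i<j, k<l) is added; without it the identity fails for m=1, n=2, and ξ^I_J depends on ρ. *)

theory Defs
  imports
    "HOL-Analysis.Analysis"
    "HOL-Library.Poly_Mapping"
    "HOL-Combinatorics.Permutations"
    "HOL-Algebra.Generated_Groups"
    "HOL-Algebra.QuotRing"
    "HOL-Algebra.Module"
begin

section \<open>Meromorphic functions on $\mathbf{C}^N$\<close>

text \<open>
  The index set $[1,N]$ is a finite linearly ordered type \<^typ>\<open>'N\<close> with \<open>CARD('N) = N\<close>, and
  $\mathfrak{h}^*$ is \<^typ>\<open>complex^'N\<close> with $\omega(i) = e_i$ = \<open>axis i 1\<close>.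
\<close>

definition holo_on :: "(complex^'N) set \<Rightarrow> (complex^'N \<Rightarrow> complex) \<Rightarrow> bool" where
  "holo_on U f \<longleftrightarrow>
     (\<forall>x\<in>U. \<exists>D. (f has_derivative D) (at x) \<and> (\<forall>c v. D (c *s v) = c * D v))"

text \<open>
  Locally a quotient of holomorphic functions whose denominator vanishes identically on no
  nonempty open set.  The value of \<open>f\<close> where the denominator vanishes is irrelevant; this is
  removed by identifying functions that agree on a dense open set.
\<close>

definition mero_fun :: "(complex^'N \<Rightarrow> complex) \<Rightarrow> bool" where
  "mero_fun f \<longleftrightarrow>
     (\<forall>p. \<exists>U g d. open U \<and> p \<in> U \<and> holo_on U g \<and> holo_on U d \<and>
        (\<forall>V. open V \<longrightarrow> V \<subseteq> U \<longrightarrow> V \<noteq> {} \<longrightarrow> (\<exists>x\<in>V. d x \<noteq> 0)) \<and>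
        (\<forall>x\<in>U. d x \<noteq> 0 \<longrightarrow> f x = g x / d x))"

definition dense_open :: "'a::topological_space set \<Rightarrow> bool" where
  "dense_open W \<longleftrightarrow> open W \<and> closure W = UNIV"

definition mero_eq :: "(complex^'N \<Rightarrow> complex) \<Rightarrow> (complex^'N \<Rightarrow> complex) \<Rightarrow> bool" where
  "mero_eq f f' \<longleftrightarrow> mero_fun f \<and> mero_fun f' \<and> (\<exists>W. dense_open W \<and> (\<forall>x\<in>W. f x = f' x))"

lemma dense_open_Int:
  assumes "dense_open V" "dense_open W"
  shows "dense_open (V \<inter> W)"
  using assms unfolding dense_open_def
  by (metis closure_open_Int_superset inf_top.right_neutral inf.commute open_Int top_greatest)

lemma dense_open_UNIV: "dense_open UNIV"
  by (simp add: dense_open_def)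

lemma holo_on_const: "holo_on U (\<lambda>_. c)"
  unfolding holo_on_def by (intro ballI exI[of _ "\<lambda>_. 0"]) auto

lemma holo_on_add:
  assumes "holo_on U f" "holo_on U g"
  shows "holo_on U (\<lambda>x. f x + g x)"
  unfolding holo_on_def
proof
  fix x assume "x \<in> U"
  with assms obtain D E where
    "(f has_derivative D) (at x)" "\<forall>c v. D (c *s v) = c * D v"
    "(g has_derivative E) (at x)" "\<forall>c v. E (c *s v) = c * E v"
    unfolding holo_on_def by blast
  then show "\<exists>D. ((\<lambda>x. f x + g x) has_derivative D) (at x) \<and> (\<forall>c v. D (c *s v) = c * D v)"
    by (intro exI[of _ "\<lambda>v. D v + E v"]) (auto intro: has_derivative_add simp: algebra_simps)
qed

lemma holo_on_mult:
  assumes "holo_on U f" "holo_on U g"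
  shows "holo_on U (\<lambda>x. f x * g x)"
  unfolding holo_on_def
proof
  fix x assume "x \<in> U"
  with assms obtain D E where
    "(f has_derivative D) (at x)" "\<forall>c v. D (c *s v) = c * D v"
    "(g has_derivative E) (at x)" "\<forall>c v. E (c *s v) = c * E v"
    unfolding holo_on_def by blast
  then show "\<exists>D. ((\<lambda>x. f x * g x) has_derivative D) (at x) \<and> (\<forall>c v. D (c *s v) = c * D v)"
    by (intro exI[of _ "\<lambda>v. f x * E v + D v * g x"] conjI has_derivative_mult)
      (simp_all add: algebra_simps)
qed

lemma holo_on_subset: "holo_on U f \<Longrightarrow> V \<subseteq> U \<Longrightarrow> holo_on V f"
  unfolding holo_on_def by blast

lemma holo_on_shift:
  assumes "holo_on U f"
  shows "holo_on ((\<lambda>x. x - a) ` U) (\<lambda>x. f (x + a))"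
  unfolding holo_on_def
proof
  fix x assume "x \<in> (\<lambda>x. x - a) ` U"
  then have "x + a \<in> U" by auto
  with assms obtain D where D: "(f has_derivative D) (at (x + a))" "\<forall>c v. D (c *s v) = c * D v"
    unfolding holo_on_def by blast
  have "((\<lambda>x. x + a) has_derivative (\<lambda>v. v)) (at x)"
    by (auto intro!: derivative_eq_intros)
  from has_derivative_compose[OF this D(1)] D(2)
  show "\<exists>D. ((\<lambda>x. f (x + a)) has_derivative D) (at x) \<and> (\<forall>c v. D (c *s v) = c * D v)"
    by blast
qed

lemma holo_on_imp_continuous_on: "holo_on U f \<Longrightarrow> continuous_on U f"
  unfolding holo_on_def
  by (meson continuous_at_imp_continuous_on has_derivative_continuous)

lemma holo_on_nonzero_open:
  assumes "holo_on U d" "open V" "V \<subseteq> U"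
  shows "open {x\<in>V. d x \<noteq> 0}"
proof -
  have "continuous_on V d"
    using assms holo_on_imp_continuous_on holo_on_subset by blast
  then have "open (V \<inter> d -` (- {0}))"
    using continuous_open_preimage assms(2) by blast
  moreover have "V \<inter> d -` (- {0}) = {x\<in>V. d x \<noteq> 0}" by auto
  ultimately show ?thesis by simp
qed

lemma mero_fun_binop:
  fixes f f' :: "complex^'N \<Rightarrow> complex"
  assumes f: "mero_fun f" and f': "mero_fun f'"
    and holo: "\<And>(U :: (complex^'N) set) g d g' d'. holo_on U g \<Longrightarrow> holo_on U d \<Longrightarrow> holo_on U g' \<Longrightarrow> holo_on U d' \<Longrightarrow>
        holo_on U (\<lambda>x. num (g x) (d x) (g' x) (d' x))"
    and frac: "\<And>a b a' b'. b \<noteq> 0 \<Longrightarrow> b' \<noteq> 0 \<Longrightarrow> F (a / b) (a' / b') = num a b a' b' / (b * b')"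
  shows "mero_fun (\<lambda>x. F (f x) (f' x))"
  unfolding mero_fun_def
proof
  fix p
  obtain U g d where U: "open U" "p \<in> U" "holo_on U g" "holo_on U d"
      "\<And>V. open V \<Longrightarrow> V \<subseteq> U \<Longrightarrow> V \<noteq> {} \<Longrightarrow> \<exists>x\<in>V. d x \<noteq> 0"
      "\<And>x. x \<in> U \<Longrightarrow> d x \<noteq> 0 \<Longrightarrow> f x = g x / d x"
    using f unfolding mero_fun_def by metis
  obtain U' g' d' where U': "open U'" "p \<in> U'" "holo_on U' g'" "holo_on U' d'"
      "\<And>V. open V \<Longrightarrow> V \<subseteq> U' \<Longrightarrow> V \<noteq> {} \<Longrightarrow> \<exists>x\<in>V. d' x \<noteq> 0"
      "\<And>x. x \<in> U' \<Longrightarrow> d' x \<noteq> 0 \<Longrightarrow> f' x = g' x / d' x"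
    using f' unfolding mero_fun_def by metis
  let ?W = "U \<inter> U'"
  have h: "holo_on ?W g" "holo_on ?W d" "holo_on ?W g'" "holo_on ?W d'"
    using U U' holo_on_subset by (meson inf_le1 inf_le2)+
  have nz: "\<exists>x\<in>V. d x * d' x \<noteq> 0" if V: "open V" "V \<subseteq> ?W" "V \<noteq> {}" for V
  proof -
    let ?V = "{x\<in>V. d x \<noteq> 0}"
    have "open ?V" using V h(2) holo_on_nonzero_open by blast
    moreover have "?V \<noteq> {}" using U(5)[of V] V by blast
    moreover have "?V \<subseteq> U'" using V by blast
    ultimately obtain x where "x \<in> ?V" "d' x \<noteq> 0" using U'(5)[of ?V] by blast
    then show ?thesis by auto
  qed
  have eq: "F (f x) (f' x) = num (g x) (d x) (g' x) (d' x) / (d x * d' x)"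
    if "x \<in> ?W" "d x * d' x \<noteq> 0" for x
    using that U(6)[of x] U'(6)[of x] frac by auto
  show "\<exists>U G D. open U \<and> p \<in> U \<and> holo_on U G \<and> holo_on U D \<and>
        (\<forall>V. open V \<longrightarrow> V \<subseteq> U \<longrightarrow> V \<noteq> {} \<longrightarrow> (\<exists>x\<in>V. D x \<noteq> 0)) \<and>
        (\<forall>x\<in>U. D x \<noteq> 0 \<longrightarrow> F (f x) (f' x) = G x / D x)"
    by (rule exI[of _ ?W], rule exI[of _ "\<lambda>x. num (g x) (d x) (g' x) (d' x)"],
        rule exI[of _ "\<lambda>x. d x * d' x"])
      (use U(1,2) U'(1,2) holo[OF h] holo_on_mult[OF h(2,4)] nz eq in blast)
qed

lemma mero_fun_holo: "holo_on UNIV f \<Longrightarrow> mero_fun f"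
  unfolding mero_fun_def
  by (intro allI exI[of _ UNIV] exI[of _ f] exI[of _ "\<lambda>_. 1"]) (auto simp: holo_on_const)

lemma mero_fun_const: "mero_fun (\<lambda>_. c)"
  by (simp add: holo_on_const mero_fun_holo)

lemma mero_fun_add: "mero_fun f \<Longrightarrow> mero_fun f' \<Longrightarrow> mero_fun (\<lambda>x. f x + f' x)"
  by (rule mero_fun_binop[where num = "\<lambda>a b a' b'. a * b' + a' * b"])
    (auto intro!: holo_on_add holo_on_mult simp: field_simps)

lemma mero_fun_mult: "mero_fun f \<Longrightarrow> mero_fun f' \<Longrightarrow> mero_fun (\<lambda>x. f x * f' x)"
  by (rule mero_fun_binop[where num = "\<lambda>a b a' b'. a * a'"])
    (auto intro!: holo_on_mult simp: field_simps)

lemma mero_fun_uminus: "mero_fun f \<Longrightarrow> mero_fun (\<lambda>x. - f x)"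
  using mero_fun_mult[OF mero_fun_const[of "-1"]] by simp

lemma mero_fun_shift:
  assumes "mero_fun f"
  shows "mero_fun (\<lambda>x. f (x + a))"
  unfolding mero_fun_def
proof
  fix p
  obtain U g d where U: "open U" "p + a \<in> U" "holo_on U g" "holo_on U d"
      "\<And>V. open V \<Longrightarrow> V \<subseteq> U \<Longrightarrow> V \<noteq> {} \<Longrightarrow> \<exists>x\<in>V. d x \<noteq> 0"
      "\<And>x. x \<in> U \<Longrightarrow> d x \<noteq> 0 \<Longrightarrow> f x = g x / d x"
    using assms unfolding mero_fun_def by metis
  let ?U = "(\<lambda>x. x - a) ` U"
  have nz: "\<exists>x\<in>V. d (x + a) \<noteq> 0" if V: "open V" "V \<subseteq> ?U" "V \<noteq> {}" for V
  proof -
    have "open ((\<lambda>x. x + a) ` V)" using V(1) open_translation[of V a] by (simp add: add.commute)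
    moreover have "(\<lambda>x. x + a) ` V \<subseteq> U" using V(2) by auto
    ultimately show ?thesis using U(5)[of "(\<lambda>x. x + a) ` V"] V(3) by auto
  qed
  have "open ?U" using open_translation_subtract[OF U(1), of a] by simp
  moreover have "p \<in> ?U" using U(2) by force
  ultimately show "\<exists>U G D. open U \<and> p \<in> U \<and> holo_on U G \<and> holo_on U D \<and>
        (\<forall>V. open V \<longrightarrow> V \<subseteq> U \<longrightarrow> V \<noteq> {} \<longrightarrow> (\<exists>x\<in>V. D x \<noteq> 0)) \<and>
        (\<forall>x\<in>U. D x \<noteq> 0 \<longrightarrow> f (x + a) = G x / D x)"
    by (intro exI[of _ ?U] exI[of _ "\<lambda>x. g (x + a)"] exI[of _ "\<lambda>x. d (x + a)"])
      (use U holo_on_shift nz in auto)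
qed

lemma dense_open_shift:
  fixes W :: "'a::real_normed_vector set"
  assumes "dense_open W"
  shows "dense_open ((\<lambda>x. x - a) ` W)"
  using assms open_translation_subtract[of W a] closure_translation_subtract[of a W]
  unfolding dense_open_def by simp

lemma mero_eqI:
  assumes "mero_fun f" "\<And>x. f x = g x"
  shows "mero_eq f g"
proof -
  have "f = g" using assms(2) by blast
  then show ?thesis using assms(1) dense_open_UNIV unfolding mero_eq_def by blast
qed

quotient_type 'N mero = "complex^'N \<Rightarrow> complex" / partial: mero_eq
proof (rule part_equivpI)
  show "\<exists>x. mero_eq x x"
    using mero_fun_const dense_open_UNIV unfolding mero_eq_def by blast
  show "symp mero_eq"
    unfolding symp_def mero_eq_def by metis
  show "transp mero_eq"
    unfolding transp_def mero_eq_def using dense_open_Int by (metis IntD1 IntD2)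
qed

lift_definition mero_const :: "complex \<Rightarrow> 'N::finite mero" is "\<lambda>c _. c"
  unfolding mero_eq_def using mero_fun_const dense_open_UNIV by blast

instantiation mero :: (finite) comm_ring_1
begin

lift_definition zero_mero :: "'a mero" is "\<lambda>_. 0"
  unfolding mero_eq_def using mero_fun_const dense_open_UNIV by blast

lift_definition one_mero :: "'a mero" is "\<lambda>_. 1"
  unfolding mero_eq_def using mero_fun_const dense_open_UNIV by blast

lift_definition plus_mero :: "'a mero \<Rightarrow> 'a mero \<Rightarrow> 'a mero" is "\<lambda>f g x. f x + g x"
  unfolding mero_eq_def using mero_fun_add dense_open_Int by (metis (mono_tags, lifting) IntD1 IntD2)

lift_definition times_mero :: "'a mero \<Rightarrow> 'a mero \<Rightarrow> 'a mero" is "\<lambda>f g x. f x * g x"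
  unfolding mero_eq_def using mero_fun_mult dense_open_Int by (metis (mono_tags, lifting) IntD1 IntD2)

lift_definition uminus_mero :: "'a mero \<Rightarrow> 'a mero" is "\<lambda>f x. - f x"
  unfolding mero_eq_def using mero_fun_uminus by (metis (mono_tags, lifting))

definition minus_mero :: "'a mero \<Rightarrow> 'a mero \<Rightarrow> 'a mero" where
  "minus_mero f g = f + - g"

instance
proof
  fix a b c :: "'a mero"
  show "a * b * c = a * (b * c)"
    by transfer (rule mero_eqI; simp add: mero_eq_def mero_fun_mult mult.assoc)
  show "a * b = b * a"
    by transfer (rule mero_eqI; simp add: mero_eq_def mero_fun_mult mult.commute)
  show "1 * a = a"
    by transfer (rule mero_eqI; simp add: mero_eq_def)
  show "a + b + c = a + (b + c)"
    by transfer (rule mero_eqI; simp add: mero_eq_def mero_fun_add add.assoc)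
  show "a + b = b + a"
    by transfer (rule mero_eqI; simp add: mero_eq_def mero_fun_add add.commute)
  show "0 + a = a"
    by transfer (rule mero_eqI; simp add: mero_eq_def)
  show "- a + a = 0"
    by transfer (rule mero_eqI; simp add: mero_eq_def mero_fun_const)
  show "a - b = a + - b"
    by (simp add: minus_mero_def)
  show "(a + b) * c = a * c + b * c"
    by transfer (rule mero_eqI; simp add: mero_eq_def mero_fun_add mero_fun_mult distrib_right)
  show "(0::'a mero) \<noteq> 1"
    by transfer (auto simp: mero_eq_def dense_open_def)
qed

end

lift_definition mero_shift :: "'N::finite \<Rightarrow> 'N mero \<Rightarrow> 'N mero" is "\<lambda>i f x. f (x + axis i 1)"
proof -
  fix i :: 'N and f g :: "complex^'N \<Rightarrow> complex"
  assume "mero_eq f g"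
  then obtain W where W: "mero_fun f" "mero_fun g" "dense_open W" "\<forall>x\<in>W. f x = g x"
    unfolding mero_eq_def by blast
  have "dense_open ((\<lambda>x. x - axis i 1) ` W)" using W(3) dense_open_shift by blast
  then show "mero_eq (\<lambda>x. f (x + axis i 1)) (\<lambda>x. g (x + axis i 1))"
    unfolding mero_eq_def using W mero_fun_shift by fastforce
qed


section \<open>The dynamical coefficients\<close>

text \<open>$q^{-2\lambda}$ is formed with the principal logarithm of \<open>q\<close>.\<close>

definition hfun :: "complex \<Rightarrow> complex \<Rightarrow> complex" where
  "hfun q z = q * ((q powr (-2 * z) - q powr (-2)) / (q powr (-2 * z) - 1))"

lemma holo_on_exp_diff:
  fixes U :: "(complex^'N) set"
  shows "holo_on U (\<lambda>v. exp (a * (v $ i - v $ j)))"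
  unfolding holo_on_def
proof
  fix x :: "complex^'N"
  have 1: "((\<lambda>v. a * (v $ i - v $ j)) has_derivative (\<lambda>v. a * (v $ i - v $ j))) (at x)"
    by (intro bounded_linear_imp_has_derivative bounded_linear_const_mult bounded_linear_sub
        bounded_linear_vec_nth)
  have 2: "(exp has_derivative (*) (exp y)) (at y)" for y :: complex
    using DERIV_exp[of y] by (simp add: has_field_derivative_def)
  show "\<exists>D. ((\<lambda>v. exp (a * (v $ i - v $ j))) has_derivative D) (at x) \<and>
          (\<forall>c v. D (c *s v) = c * D v)"
    using has_derivative_compose[OF 1 2]
    by (rule_tac exI, rule_tac conjI) (assumption, simp add: algebra_simps)
qed

lemma exp_diff_not_locally_one:
  assumes "a \<noteq> 0" "i \<noteq> j" "open V" "V \<noteq> {}"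
  shows "\<exists>v\<in>V. exp (a * (v $ i - v $ j)) - 1 \<noteq> (0::complex)"
proof (rule ccontr)
  assume "\<not> ?thesis"
  then have one: "exp (a * (v $ i - v $ j)) = 1" if "v \<in> V" for v
    using that by auto
  obtain x e where x: "x \<in> V" and e: "e > 0" "ball x e \<subseteq> V"
    using assms(3,4) by (metis all_not_in_conv openE)
  define r where "r = min (e / 2) (1 / norm a)"
  have r: "r > 0" "r < e" "r * norm a \<le> 1"
    using e assms(1) by (auto simp: r_def min_def field_simps)
  let ?y = "x + r *\<^sub>R axis i 1"
  have "dist x ?y < e" using r by (simp add: dist_norm norm_axis_1)
  then have "?y \<in> V" using e by auto
  from one[OF this] one[OF x] have "exp (a * (?y $ i - ?y $ j) - a * (x $ i - x $ j)) = 1"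
    by (simp add: exp_diff)
  moreover have "a * (?y $ i - ?y $ j) - a * (x $ i - x $ j) = of_real r * a"
    using assms(2) by (simp add: axis_def algebra_simps scaleR_conv_of_real[where 'a = complex])
  ultimately have "exp (of_real r * a) = 1" by simp
  then obtain n :: int where n: "Re (of_real r * a) = 0" "Im (of_real r * a) = of_int (2 * n) * pi"
    unfolding exp_eq_1 by auto
  have "norm (of_real r * a) \<le> 1" using r by (simp add: norm_mult)
  then have "\<bar>of_int (2 * n) * pi\<bar> \<le> 1" using abs_Im_le_cmod[of "of_real r * a"] n by linarith
  then have "n = 0"
  proof (rule contrapos_pp)
    assume "n \<noteq> 0"
    then have "\<bar>real_of_int (2 * n)\<bar> \<ge> 2" by linarith
    then have "\<bar>real_of_int (2 * n)\<bar> * pi \<ge> 2 * pi" by (intro mult_right_mono) auto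
    moreover have "\<bar>real_of_int (2 * n) * pi\<bar> = \<bar>real_of_int (2 * n)\<bar> * pi" by (simp add: abs_mult)
    ultimately show "\<not> \<bar>real_of_int (2 * n) * pi\<bar> \<le> 1" using pi_gt3 by linarith
  qed
  then have "of_real r * a = 0" using n by (simp add: complex_eq_iff)
  then show False using r assms(1) by simp
qed

lemma mero_fun_hfun: "mero_fun (\<lambda>v. hfun q (v $ i - v $ j))"
proof (cases "q = 0 \<or> q = 1 \<or> i = j")
  case True
  then show ?thesis by (auto simp: hfun_def mero_fun_const)
next
  case False
  let ?a = "-2 * Ln q"
  have a: "?a \<noteq> 0" using False by (metis exp_Ln exp_zero mult_eq_0_iff neg_equal_0_iff_equal zero_neq_numeral)
  have p: "q powr (-2 * z) = exp (?a * z)" for z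
    using False by (simp add: powr_def mult_ac)
  define b where "b = - (q powr (-2))"
  show ?thesis
    unfolding mero_fun_def
  proof (intro allI exI conjI impI ballI)
    show "open (UNIV :: (complex^'a) set)" by simp
    show "holo_on UNIV (\<lambda>v. q * (exp (?a * (v $ i - v $ j)) + b))"
      by (intro holo_on_mult holo_on_add holo_on_const holo_on_exp_diff)
    show "holo_on UNIV (\<lambda>v. exp (?a * (v $ i - v $ j)) + - 1)"
      by (intro holo_on_mult holo_on_add holo_on_const holo_on_exp_diff)
    show "\<exists>v\<in>V. exp (?a * (v $ i - v $ j)) + - 1 \<noteq> 0" if "open V" "V \<noteq> {}" for V
      using exp_diff_not_locally_one[OF a _ that, of i j] False by simp
    show "hfun q (x $ i - x $ j) =
      q * (exp (?a * (x $ i - x $ j)) + b) / (exp (?a * (x $ i - x $ j)) + - 1)" for x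
      unfolding hfun_def p by (simp add: b_def)
  qed auto
qed

text \<open>\<open>dyn_h q i j\<close> and \<open>dyn_g q i j\<close> are the functions $h(\lambda_i-\lambda_j)$ and $g(\lambda_i-\lambda_j)$.\<close>

lift_definition dyn_h :: "complex \<Rightarrow> 'N::finite \<Rightarrow> 'N \<Rightarrow> 'N mero" is
  "\<lambda>q i j v. hfun q (v $ i - v $ j)"
  by (rule mero_eqI[OF mero_fun_hfun refl])

definition dyn_g :: "complex \<Rightarrow> 'N::finite \<Rightarrow> 'N \<Rightarrow> 'N mero" where
  "dyn_g q i j = dyn_h q i j * dyn_h q j i"

text \<open>The element $i_k$ of $I=\{i_1<i_2<\cdots\}$ (positions start at 1).\<close>

definition nth_elt :: "'N::linorder set \<Rightarrow> nat \<Rightarrow> 'N" where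
  "nth_elt I k = sorted_list_of_set I ! (k - 1)"

definition inversions :: "nat \<Rightarrow> (nat \<Rightarrow> nat) \<Rightarrow> (nat \<times> nat) set" where
  "inversions r \<sigma> = {(k, l). 1 \<le> k \<and> k < l \<and> l \<le> r \<and> \<sigma> k > \<sigma> l}"

definition S_coeff :: "complex \<Rightarrow> (nat \<Rightarrow> nat) \<Rightarrow> 'N::{finite,linorder} set \<Rightarrow> 'N mero" where
  "S_coeff q \<sigma> I = (\<Prod>(k, l)\<in>inversions (card I) \<sigma>. - dyn_h q (nth_elt I (\<sigma> k)) (nth_elt I (\<sigma> l)))"

definition S_tilde :: "complex \<Rightarrow> (nat \<Rightarrow> nat) \<Rightarrow> 'N::{finite,linorder} set \<Rightarrow> 'N mero" where
  "S_tilde q \<sigma> I = (\<Prod>(k, l)\<in>inversions (card I) \<sigma>. - dyn_h q (nth_elt I (\<sigma> l)) (nth_elt I (\<sigma> k)))"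

section \<open>Presented algebras and tensor products over $\mathbf{C}$\<close>

text \<open>
  The monoid algebra $\mathbf{C}[G]$.  A $\mathbf{C}$-algebra is a (not necessarily commutative)
  ring with scalar multiplication, packed in the record type \<^typ>\<open>(complex, 'a) module\<close>.
\<close>

definition monoid_algebra :: "('g, 'x) monoid_scheme \<Rightarrow> ('g \<Rightarrow>\<^sub>0 complex) ring" where
  "monoid_algebra G =
     \<lparr>carrier = {x. Poly_Mapping.keys x \<subseteq> carrier G},
      mult = (\<lambda>x y. \<Sum>a\<in>Poly_Mapping.keys x. \<Sum>b\<in>Poly_Mapping.keys y.
                Poly_Mapping.single (a \<otimes>\<^bsub>G\<^esub> b) (Poly_Mapping.lookup x a * Poly_Mapping.lookup y b)),
      one = Poly_Mapping.single \<one>\<^bsub>G\<^esub> 1,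
      zero = 0, add = (+)\<rparr>"

lemma monoid_algebra_sum:
  fixes x y :: "'g \<Rightarrow>\<^sub>0 complex"
  assumes "finite X" "Poly_Mapping.keys x \<subseteq> X" "finite Y" "Poly_Mapping.keys y \<subseteq> Y"
  shows "x \<otimes>\<^bsub>monoid_algebra G\<^esub> y =
    (\<Sum>a\<in>X. \<Sum>b\<in>Y. Poly_Mapping.single (a \<otimes>\<^bsub>G\<^esub> b) (Poly_Mapping.lookup x a * Poly_Mapping.lookup y b))"
proof -
  have "(\<Sum>b\<in>Poly_Mapping.keys y. Poly_Mapping.single (a \<otimes>\<^bsub>G\<^esub> b) (Poly_Mapping.lookup x a * Poly_Mapping.lookup y b))
      = (\<Sum>b\<in>Y. Poly_Mapping.single (a \<otimes>\<^bsub>G\<^esub> b) (Poly_Mapping.lookup x a * Poly_Mapping.lookup y b))" for a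
    using assms by (intro sum.mono_neutral_left) (auto simp: in_keys_iff)
  moreover have "(\<Sum>a\<in>Poly_Mapping.keys x. \<Sum>b\<in>Y. Poly_Mapping.single (a \<otimes>\<^bsub>G\<^esub> b) (Poly_Mapping.lookup x a * Poly_Mapping.lookup y b))
      = (\<Sum>a\<in>X. \<Sum>b\<in>Y. Poly_Mapping.single (a \<otimes>\<^bsub>G\<^esub> b) (Poly_Mapping.lookup x a * Poly_Mapping.lookup y b))"
    using assms by (intro sum.mono_neutral_left) (auto simp: in_keys_iff)
  ultimately show ?thesis by (simp add: monoid_algebra_def)
qed

lemma monoid_algebra_add_left:
  "(x + x') \<otimes>\<^bsub>monoid_algebra G\<^esub> y = x \<otimes>\<^bsub>monoid_algebra G\<^esub> y + x' \<otimes>\<^bsub>monoid_algebra G\<^esub> y"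
proof -
  let ?X = "Poly_Mapping.keys x \<union> Poly_Mapping.keys x'"
  have "Poly_Mapping.keys (x + x') \<subseteq> ?X" by (rule Poly_Mapping.keys_add)
  then show ?thesis
    by (simp add: monoid_algebra_sum[of ?X _ "Poly_Mapping.keys y"] lookup_add distrib_right
        single_add sum.distrib)
qed

lemma monoid_algebra_add_right:
  "y \<otimes>\<^bsub>monoid_algebra G\<^esub> (x + x') = y \<otimes>\<^bsub>monoid_algebra G\<^esub> x + y \<otimes>\<^bsub>monoid_algebra G\<^esub> x'"
proof -
  let ?X = "Poly_Mapping.keys x \<union> Poly_Mapping.keys x'"
  have "Poly_Mapping.keys (x + x') \<subseteq> ?X" by (rule Poly_Mapping.keys_add)
  then show ?thesis
    by (simp add: monoid_algebra_sum[of "Poly_Mapping.keys y" _ ?X] lookup_add distrib_left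
        single_add sum.distrib)
qed

lemma monoid_algebra_single:
  "Poly_Mapping.single a u \<otimes>\<^bsub>monoid_algebra G\<^esub> Poly_Mapping.single b v =
     Poly_Mapping.single (a \<otimes>\<^bsub>G\<^esub> b) (u * v)"
  by (subst monoid_algebra_sum[of "{a}" _ "{b}"]) auto

lemma monoid_algebra_zero:
  "0 \<otimes>\<^bsub>monoid_algebra G\<^esub> x = 0" "x \<otimes>\<^bsub>monoid_algebra G\<^esub> 0 = 0"
  by (simp_all add: monoid_algebra_def)

lemma monoid_algebra_induct [consumes 1, case_names zero add]:
  fixes x :: "'g \<Rightarrow>\<^sub>0 complex"
  assumes "Poly_Mapping.keys x \<subseteq> K" "P 0"
    "\<And>a u x. a \<in> K \<Longrightarrow> Poly_Mapping.keys x \<subseteq> K \<Longrightarrow> P x \<Longrightarrow> P (Poly_Mapping.single a u + x)"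
  shows "P x"
proof -
  have "finite F \<Longrightarrow> Poly_Mapping.keys x \<subseteq> K \<Longrightarrow> Poly_Mapping.keys x \<subseteq> F \<Longrightarrow> P x" for F x
  proof (induction F arbitrary: x rule: finite_induct)
    case empty
    then show ?case using assms(2) by simp
  next
    case (insert a F)
    let ?x = "x - Poly_Mapping.single a (Poly_Mapping.lookup x a)"
    have keys: "Poly_Mapping.keys ?x \<subseteq> Poly_Mapping.keys x - {a}"
      by (auto simp: in_keys_iff lookup_minus lookup_single when_def split: if_splits)
    then have "P ?x" using insert.IH[of ?x] insert.prems by blast
    show ?case
    proof (cases "a \<in> Poly_Mapping.keys x")
      case True
      then have "P (Poly_Mapping.single a (Poly_Mapping.lookup x a) + ?x)"
        using assms(3) \<open>P ?x\<close> keys insert.prems by blast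
      then show ?thesis by simp
    next
      case False
      then have "Poly_Mapping.keys x \<subseteq> F" using insert.prems(2) by blast
      then show ?thesis using insert.IH[of x] insert.prems(1) by simp
    qed
  qed
  from this[OF finite_keys assms(1) subset_refl] show ?thesis .
qed

lemma monoid_algebra_closed:
  assumes "Group.monoid G" "Poly_Mapping.keys x \<subseteq> carrier G" "Poly_Mapping.keys y \<subseteq> carrier G"
  shows "Poly_Mapping.keys (x \<otimes>\<^bsub>monoid_algebra G\<^esub> y) \<subseteq> carrier G"
proof -
  have "Poly_Mapping.keys (Poly_Mapping.single a u \<otimes>\<^bsub>monoid_algebra G\<^esub> y) \<subseteq> carrier G"
    if "a \<in> carrier G" for a u
    using assms(3)
  proof (induction y rule: monoid_algebra_induct)
    case zero
    then show ?case by (simp add: monoid_algebra_zero)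
  next
    case (add b v y)
    have "Poly_Mapping.keys (Poly_Mapping.single (a \<otimes>\<^bsub>G\<^esub> b) (u * v)) \<subseteq> carrier G"
      using that add.hyps assms(1) by (auto simp: monoid.m_closed)
    with add.IH show ?case
      unfolding monoid_algebra_add_right monoid_algebra_single
      by (intro subset_trans[OF Poly_Mapping.keys_add] Un_least)
  qed
  note single = this
  show ?thesis
    using assms(2)
  proof (induction x rule: monoid_algebra_induct)
    case zero
    then show ?case by (simp add: monoid_algebra_zero)
  next
    case (add a u x)
    then show ?case
      unfolding monoid_algebra_add_left
      by (intro subset_trans[OF Poly_Mapping.keys_add] Un_least single)
  qed
qed

lemma monoid_algebra_assoc:
  assumes "Group.monoid G" "Poly_Mapping.keys x \<subseteq> carrier G" "Poly_Mapping.keys y \<subseteq> carrier G"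
    "Poly_Mapping.keys z \<subseteq> carrier G"
  shows "(x \<otimes>\<^bsub>monoid_algebra G\<^esub> y) \<otimes>\<^bsub>monoid_algebra G\<^esub> z =
    x \<otimes>\<^bsub>monoid_algebra G\<^esub> (y \<otimes>\<^bsub>monoid_algebra G\<^esub> z)"
  using assms(2)
proof (induction x rule: monoid_algebra_induct)
  case zero
  then show ?case by (simp add: monoid_algebra_zero)
next
  case (add a u x)
  have "(Poly_Mapping.single a u \<otimes>\<^bsub>monoid_algebra G\<^esub> y) \<otimes>\<^bsub>monoid_algebra G\<^esub> z =
      Poly_Mapping.single a u \<otimes>\<^bsub>monoid_algebra G\<^esub> (y \<otimes>\<^bsub>monoid_algebra G\<^esub> z)"
    using assms(3)
  proof (induction y rule: monoid_algebra_induct)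
    case zero
    then show ?case by (simp add: monoid_algebra_zero)
  next
    case (add b v y)
    have "Poly_Mapping.single (a \<otimes>\<^bsub>G\<^esub> b) (u * v) \<otimes>\<^bsub>monoid_algebra G\<^esub> z =
        Poly_Mapping.single a u \<otimes>\<^bsub>monoid_algebra G\<^esub> (Poly_Mapping.single b v \<otimes>\<^bsub>monoid_algebra G\<^esub> z)"
      using assms(4)
    proof (induction z rule: monoid_algebra_induct)
      case zero
      then show ?case by (simp add: monoid_algebra_zero)
    next
      case (add c w z)
      then show ?case using \<open>a \<in> carrier G\<close> \<open>b \<in> carrier G\<close> assms(1)
        by (simp add: monoid_algebra_add_right monoid_algebra_single monoid.m_assoc mult.assoc)
    qed
    with add.IH show ?case
      by (simp add: monoid_algebra_add_left monoid_algebra_add_right monoid_algebra_single)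
  qed
  with add.IH show ?case by (simp add: monoid_algebra_add_left)
qed

lemma monoid_algebra_one:
  assumes "Group.monoid G" "Poly_Mapping.keys x \<subseteq> carrier G"
  shows "\<one>\<^bsub>monoid_algebra G\<^esub> \<otimes>\<^bsub>monoid_algebra G\<^esub> x = x" (is ?l)
    and "x \<otimes>\<^bsub>monoid_algebra G\<^esub> \<one>\<^bsub>monoid_algebra G\<^esub> = x" (is ?r)
proof -
  have one: "\<one>\<^bsub>monoid_algebra G\<^esub> = Poly_Mapping.single \<one>\<^bsub>G\<^esub> 1" by (simp add: monoid_algebra_def)
  show ?l using assms(2) unfolding one
    by (induction x rule: monoid_algebra_induct)
      (simp_all add: monoid_algebra_zero monoid_algebra_add_right monoid_algebra_single
        monoid.l_one[OF assms(1)])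
  show ?r using assms(2) unfolding one
    by (induction x rule: monoid_algebra_induct)
      (simp_all add: monoid_algebra_zero monoid_algebra_add_left monoid_algebra_single
        monoid.r_one[OF assms(1)])
qed

lemma ring_monoid_algebra:
  assumes "Group.monoid G"
  shows "Ring.ring (monoid_algebra G)"
proof -
  let ?A = "monoid_algebra G"
  have car: "x \<in> carrier ?A \<longleftrightarrow> Poly_Mapping.keys x \<subseteq> carrier G" for x
    by (simp add: monoid_algebra_def)
  have add: "x \<oplus>\<^bsub>?A\<^esub> y = x + y" and zero: "\<zero>\<^bsub>?A\<^esub> = 0" for x y
    by (simp_all add: monoid_algebra_def)
  have closed: "x + y \<in> carrier ?A" if "x \<in> carrier ?A" "y \<in> carrier ?A" for x y
    using that Poly_Mapping.keys_add[of x y] unfolding car by blast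
  have "abelian_group ?A"
  proof (rule abelian_groupI)
    fix x assume x: "x \<in> carrier ?A"
    then have "- x \<in> carrier ?A" by (simp add: car)
    then show "\<exists>y\<in>carrier ?A. y \<oplus>\<^bsub>?A\<^esub> x = \<zero>\<^bsub>?A\<^esub>"
      by (intro bexI[of _ "- x"]) (simp_all add: add zero)
  qed (simp_all add: add zero closed add_ac, simp add: car)
  moreover have "Group.monoid ?A"
  proof (rule monoidI)
    show "\<one>\<^bsub>?A\<^esub> \<in> carrier ?A"
      using monoid.one_closed[OF assms] by (simp add: monoid_algebra_def)
  qed (simp_all add: car monoid_algebra_closed[OF assms] monoid_algebra_assoc[OF assms]
      monoid_algebra_one[OF assms])
  ultimately show ?thesis
    by (rule Ring.ringI) (simp_all add: add monoid_algebra_add_left monoid_algebra_add_right)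
qed

text \<open>The quotient of $\mathbf{C}[G]$ by the two-sided ideal generated by \<open>R\<close>.\<close>

definition presented_algebra ::
  "('g, 'x) monoid_scheme \<Rightarrow> ('g \<Rightarrow>\<^sub>0 complex) set \<Rightarrow> (complex, ('g \<Rightarrow>\<^sub>0 complex) set) module" where
  "presented_algebra G R =
     (let A = monoid_algebra G; I = Idl\<^bsub>A\<^esub> R; Q = A Quot I in
      \<lparr>carrier = carrier Q, mult = mult Q, one = one Q, zero = zero Q, add = add Q,
       smult = (\<lambda>c X. (I +>\<^bsub>A\<^esub> Poly_Mapping.single \<one>\<^bsub>G\<^esub> c) \<otimes>\<^bsub>Q\<^esub> X)\<rparr>)"

lemma ring_presented_algebra:
  assumes "Group.monoid G" "R \<subseteq> carrier (monoid_algebra G)"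
  shows "Ring.ring (presented_algebra G R)"
proof -
  let ?A = "monoid_algebra G"
  let ?Q = "?A Quot (Idl\<^bsub>?A\<^esub> R)"
  interpret A: Ring.ring ?A using assms(1) by (rule ring_monoid_algebra)
  interpret Q: Ring.ring ?Q
    by (rule ideal.quotient_is_ring[OF A.genideal_ideal[OF assms(2)]])
  have [simp]: "carrier (presented_algebra G R) = carrier ?Q" "mult (presented_algebra G R) = mult ?Q"
    "one (presented_algebra G R) = one ?Q" "zero (presented_algebra G R) = zero ?Q"
    "add (presented_algebra G R) = add ?Q"
    by (simp_all add: presented_algebra_def Let_def)
  show ?thesis
    by (intro Ring.ringI abelian_groupI monoidI)
      (simp_all add: Q.a_ac Q.m_assoc Q.l_distr Q.r_distr Q.add.l_inv_ex)
qed

definition basis_class ::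
  "('g, 'x) monoid_scheme \<Rightarrow> ('g \<Rightarrow>\<^sub>0 complex) set \<Rightarrow> 'g \<Rightarrow> ('g \<Rightarrow>\<^sub>0 complex) set" where
  "basis_class G R x =
     (Idl\<^bsub>monoid_algebra G\<^esub> R) +>\<^bsub>monoid_algebra G\<^esub> Poly_Mapping.single x 1"

definition free_monoid :: "'g set \<Rightarrow> 'g list monoid" where
  "free_monoid X = \<lparr>carrier = lists X, mult = (@), one = []\<rparr>"

abbreviation word :: "'g list \<Rightarrow> ('g list \<Rightarrow>\<^sub>0 complex)" where
  "word w \<equiv> Poly_Mapping.single w 1"

text \<open>
  \<open>tensor A B\<close> is the vector space with basis \<open>carrier A \<times> carrier B\<close> modulo the bilinearity
  relations, with the factorwise product.  The span of the bilinearity relations is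
  already a two-sided ideal, so generating an ideal by them adds nothing.
\<close>

definition bilinear_rels ::
  "(complex, 'a) module \<Rightarrow> (complex, 'b) module \<Rightarrow> (('a \<times> 'b) \<Rightarrow>\<^sub>0 complex) set" where
  "bilinear_rels A B =
     {Poly_Mapping.single (x \<oplus>\<^bsub>A\<^esub> x', y) 1 - Poly_Mapping.single (x, y) 1 - Poly_Mapping.single (x', y) 1
        | x x' y. x \<in> carrier A \<and> x' \<in> carrier A \<and> y \<in> carrier B} \<union>
     {Poly_Mapping.single (x, y \<oplus>\<^bsub>B\<^esub> y') 1 - Poly_Mapping.single (x, y) 1 - Poly_Mapping.single (x, y') 1
        | x y y'. x \<in> carrier A \<and> y \<in> carrier B \<and> y' \<in> carrier B} \<union>
     {Poly_Mapping.single (c \<odot>\<^bsub>A\<^esub> x, y) 1 - Poly_Mapping.single (x, y) c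
        | c x y. x \<in> carrier A \<and> y \<in> carrier B} \<union>
     {Poly_Mapping.single (x, c \<odot>\<^bsub>B\<^esub> y) 1 - Poly_Mapping.single (x, y) c
        | c x y. x \<in> carrier A \<and> y \<in> carrier B}"

definition tensor ::
  "(complex, 'a) module \<Rightarrow> (complex, 'b) module \<Rightarrow> (complex, (('a \<times> 'b) \<Rightarrow>\<^sub>0 complex) set) module" where
  "tensor A B = presented_algebra (A \<times>\<times> B) (bilinear_rels A B)"

definition pure_tensor ::
  "(complex, 'a) module \<Rightarrow> (complex, 'b) module \<Rightarrow> 'a \<Rightarrow> 'b \<Rightarrow> (('a \<times> 'b) \<Rightarrow>\<^sub>0 complex) set" where
  "pure_tensor A B x y = basis_class (A \<times>\<times> B) (bilinear_rels A B) (x, y)"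

lemma ring_tensor:
  assumes "Ring.ring A" "Ring.ring B"
    "\<And>c x. x \<in> carrier A \<Longrightarrow> c \<odot>\<^bsub>A\<^esub> x \<in> carrier A"
    "\<And>c y. y \<in> carrier B \<Longrightarrow> c \<odot>\<^bsub>B\<^esub> y \<in> carrier B"
  shows "Ring.ring (tensor A B)"
proof -
  interpret A: Ring.ring A by fact
  interpret B: Ring.ring B by fact
  have "Group.monoid (A \<times>\<times> B)"
    using DirProd_monoid A.monoid_axioms B.monoid_axioms by blast
  moreover have diff: "x - y \<in> carrier (monoid_algebra (A \<times>\<times> B))"
    if "x \<in> carrier (monoid_algebra (A \<times>\<times> B))" "y \<in> carrier (monoid_algebra (A \<times>\<times> B))" for x y
    using that Poly_Mapping.keys_add[of x "- y"] by (auto simp: monoid_algebra_def)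
  have single: "Poly_Mapping.single (x, y) c \<in> carrier (monoid_algebra (A \<times>\<times> B))"
    if "x \<in> carrier A" "y \<in> carrier B" for x y c
    using that by (simp add: monoid_algebra_def)
  have "bilinear_rels A B \<subseteq> carrier (monoid_algebra (A \<times>\<times> B))"
    unfolding bilinear_rels_def using assms(3,4) by (auto intro!: diff single)
  ultimately show ?thesis
    unfolding tensor_def by (intro ring_presented_algebra)
qed

definition ordered_prod :: "('a, 'x) monoid_scheme \<Rightarrow> 'a list \<Rightarrow> 'a" where
  "ordered_prod A xs = foldr (mult A) xs \<one>\<^bsub>A\<^esub>"

text \<open>The relations making \<open>f \<mapsto> \<phi> f\<close> a unital $\mathbf{C}$-algebra homomorphism.\<close>

definition mero_hom_rels :: "('N::finite mero \<Rightarrow> 'g) \<Rightarrow> ('g list \<Rightarrow>\<^sub>0 complex) set" where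
  "mero_hom_rels \<phi> =
     {word [\<phi> (f1 + f2)] - word [\<phi> f1] - word [\<phi> f2] | f1 f2. True} \<union>
     {word [\<phi> (f1 * f2)] - word [\<phi> f1, \<phi> f2] | f1 f2. True} \<union>
     {word [\<phi> (mero_const c)] - Poly_Mapping.single [] c | c. True}"

section \<open>The algebra $\mathscr{F}_R(M(N))$ and its minors\<close>

datatype 'N F_gen = Tgen 'N 'N | Lgen "'N mero" | Rgen "'N mero"

text \<open>
  After the homomorphism relations for the two moment maps, their commutation and the weights,
  come the four quadratic families in the usual presentation of $\mathscr{F}_R(M(N))$, and finally
  the exchange relation
  \[ t_{il}t_{jk} = g(\lambda_i-\lambda_j)\,t_{jk}t_{il}
       + (h(\mu_k-\mu_l)-h(\lambda_i-\lambda_j))\,t_{ik}t_{jl} \qquad (i<j,\ k<l). \]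
  The latter is one of the $RLL$ relations.  Using the third family, the fourth is this
  relation multiplied on the left by $h(\lambda_j-\lambda_i)-h(\mu_k-\mu_l)$, which is not
  invertible when the coefficients are only sums of products $f_1(\lambda)f_2(\mu)$; and, modulo
  the third family, it is equivalent to the independence of the two-by-two minors
  $\xi^{\{i,j\}}_{\{k,l\}}$ of the choice of $\rho$ in their definition.
\<close>

definition F_rels :: "complex \<Rightarrow> ('N::{finite,linorder} F_gen list \<Rightarrow>\<^sub>0 complex) set" where
  "F_rels q =
     mero_hom_rels Lgen \<union> mero_hom_rels Rgen \<union>
     {word [Lgen f1, Rgen f2] - word [Rgen f2, Lgen f1] | f1 f2. True} \<union>
     {word [Lgen f, Tgen i j] - word [Tgen i j, Lgen (mero_shift i f)] | f i j. True} \<union>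
     {word [Rgen f, Tgen i j] - word [Tgen i j, Rgen (mero_shift j f)] | f i j. True} \<union>
     {word [Rgen (dyn_h q k l), Tgen i k, Tgen i l] - word [Tgen i l, Tgen i k] | i k l. k < l} \<union>
     {word [Lgen (dyn_h q j i), Tgen j k, Tgen i k] - word [Tgen i k, Tgen j k] | i j k. i < j} \<union>
     {word [Tgen i k, Tgen j l]
        - (word [Tgen j l, Tgen i k]
           + word [Lgen (dyn_h q j i), Tgen j k, Tgen i l] - word [Rgen (dyn_h q k l), Tgen j k, Tgen i l])
        | i j k l. i < j \<and> k < l} \<union>
     {word [Rgen (dyn_g q k l), Tgen i k, Tgen j l]
        - (word [Lgen (dyn_g q i j), Tgen j l, Tgen i k]
           + word [Rgen (dyn_h q l k), Tgen i l, Tgen j k] - word [Lgen (dyn_h q i j), Tgen i l, Tgen j k])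
        | i j k l. i < j \<and> k < l} \<union>
     {word [Tgen i l, Tgen j k]
        - (word [Lgen (dyn_g q i j), Tgen j k, Tgen i l]
           + word [Rgen (dyn_h q k l), Tgen i k, Tgen j l] - word [Lgen (dyn_h q i j), Tgen i k, Tgen j l])
        | i j k l. i < j \<and> k < l}"

type_synonym 'N F_elt = "('N F_gen list \<Rightarrow>\<^sub>0 complex) set"

definition F_alg :: "complex \<Rightarrow> (complex, 'N::{finite,linorder} F_elt) module" where
  "F_alg q = presented_algebra (free_monoid UNIV) (F_rels q)"

definition t_elt :: "complex \<Rightarrow> 'N::{finite,linorder} \<Rightarrow> 'N \<Rightarrow> 'N F_elt" where
  "t_elt q i j = basis_class (free_monoid UNIV) (F_rels q) [Tgen i j]"

definition mu_l :: "complex \<Rightarrow> 'N::{finite,linorder} mero \<Rightarrow> 'N F_elt" where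
  "mu_l q f = basis_class (free_monoid UNIV) (F_rels q) [Lgen f]"

definition mu_r :: "complex \<Rightarrow> 'N::{finite,linorder} mero \<Rightarrow> 'N F_elt" where
  "mu_r q f = basis_class (free_monoid UNIV) (F_rels q) [Rgen f]"

text \<open>
  The minor $\xi^I_J$, for \<open>card I = card J\<close>, in the form given by $\rho=\mathrm{id}$, for which
  $S(\rho,J)=1$.
\<close>

definition dyn_minor :: "complex \<Rightarrow> 'N::{finite,linorder} set \<Rightarrow> 'N set \<Rightarrow> 'N F_elt" where
  "dyn_minor q I J =
     (\<Oplus>\<^bsub>F_alg q\<^esub>\<sigma>\<in>{\<sigma>. \<sigma> permutes {1..card I}}.
        mu_l q (S_coeff q \<sigma> I) \<otimes>\<^bsub>F_alg q\<^esub>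
        ordered_prod (F_alg q) (map (\<lambda>k. t_elt q (nth_elt I (\<sigma> k)) (nth_elt J k)) [1..<Suc (card I)]))"

definition dyn_det :: "complex \<Rightarrow> 'N::{finite,linorder} F_elt" where
  "dyn_det q = dyn_minor q UNIV UNIV"

section \<open>The algebra $\widetilde{\mathcal B}$ and the tensor product\<close>

datatype 'N B_gen = Bgen "'N set" | Fgen "'N mero"

type_synonym 'N B_elt = "('N B_gen list \<Rightarrow>\<^sub>0 complex) set"

definition B_monoid :: "nat \<Rightarrow> 'N::finite B_gen list monoid" where
  "B_monoid m = free_monoid ({Bgen I | I. card I = m} \<union> range Fgen)"

definition B_alg :: "nat \<Rightarrow> (complex, 'N::finite B_elt) module" where
  "B_alg m = presented_algebra (B_monoid m) (mero_hom_rels Fgen)"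

definition b_elt :: "nat \<Rightarrow> 'N::finite set \<Rightarrow> 'N B_elt" where
  "b_elt m I = basis_class (B_monoid m) (mero_hom_rels Fgen) [Bgen I]"

definition B_fun :: "nat \<Rightarrow> 'N::finite mero \<Rightarrow> 'N B_elt" where
  "B_fun m f = basis_class (B_monoid m) (mero_hom_rels Fgen) [Fgen f]"

type_synonym 'N BF_elt = "(('N B_elt \<times> 'N F_elt) \<Rightarrow>\<^sub>0 complex) set"

text \<open>The usual tensor product, before the relations $b\otimes\mu_l(f)t = fb\otimes t$.\<close>

definition BF :: "complex \<Rightarrow> nat \<Rightarrow> (complex, 'N::{finite,linorder} BF_elt) module" where
  "BF q m = tensor (B_alg m) (F_alg q)"

definition tens :: "complex \<Rightarrow> nat \<Rightarrow> 'N::{finite,linorder} B_elt \<Rightarrow> 'N F_elt \<Rightarrow> 'N BF_elt" where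
  "tens q m x y = pure_tensor (B_alg m) (F_alg q) x y"

text \<open>
  $\widetilde{\mathcal B}\widetilde\otimes\mathscr{F}_R$ is the quotient of \<open>BF q m\<close> by the subspace (closed
  under scalars, since these can be absorbed in \<open>x\<close>) spanned by the relations.  It is a right
  ideal but not two-sided, so products are formed factorwise in \<open>BF q m\<close> and then projected.
  Dividing by the two-sided ideal instead would force $(f(\lambda)-f(\lambda+\omega(i)))\otimes t_{ij}=0$
  for all \<open>f\<close>, hence $1\otimes t_{ij}=0$.
\<close>

definition moment_rels :: "complex \<Rightarrow> nat \<Rightarrow> 'N::{finite,linorder} BF_elt set" where
  "moment_rels q m = generate (add_monoid (BF q m))
     {tens q m x (mu_l q f \<otimes>\<^bsub>F_alg q\<^esub> y) \<ominus>\<^bsub>BF q m\<^esub> tens q m (B_fun m f \<otimes>\<^bsub>B_alg m\<^esub> x) y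
        | x y f. x \<in> carrier (B_alg m) \<and> y \<in> carrier (F_alg q)}"

definition dyn_tensor :: "complex \<Rightarrow> nat \<Rightarrow> 'N::{finite,linorder} BF_elt set monoid" where
  "dyn_tensor q m = BF q m A_Mod moment_rels q m"

definition dyn_class :: "complex \<Rightarrow> nat \<Rightarrow> 'N::{finite,linorder} BF_elt \<Rightarrow> 'N BF_elt set" where
  "dyn_class q m z = moment_rels q m +>\<^bsub>BF q m\<^esub> z"

definition B_act :: "nat \<Rightarrow> 'N::finite mero \<Rightarrow> 'N B_elt \<Rightarrow> 'N B_elt" where
  "B_act m f x = B_fun m f \<otimes>\<^bsub>B_alg m\<^esub> x"

text \<open>The left action $f(b\otimes y)=b\otimes\mu_r(f)y$ is left multiplication by $1\otimes\mu_r(f)$.\<close>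

definition BF_act :: "complex \<Rightarrow> nat \<Rightarrow> 'N::{finite,linorder} mero \<Rightarrow> 'N BF_elt \<Rightarrow> 'N BF_elt" where
  "BF_act q m f z = tens q m \<one>\<^bsub>B_alg m\<^esub> (mu_r q f) \<otimes>\<^bsub>BF q m\<^esub> z"

lemma monoid_free_monoid: "Group.monoid (free_monoid X)"
  by (rule monoidI) (auto simp: free_monoid_def)

lemma smult_presented_algebra_closed:
  assumes "Group.monoid G" "R \<subseteq> carrier (monoid_algebra G)" "x \<in> carrier (presented_algebra G R)"
  shows "c \<odot>\<^bsub>presented_algebra G R\<^esub> x \<in> carrier (presented_algebra G R)"
proof -
  let ?A = "monoid_algebra G"
  interpret A: Ring.ring ?A using assms(1) by (rule ring_monoid_algebra)
  interpret Q: Ring.ring "?A Quot (Idl\<^bsub>?A\<^esub> R)"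
    by (rule ideal.quotient_is_ring[OF A.genideal_ideal[OF assms(2)]])
  have "Poly_Mapping.single \<one>\<^bsub>G\<^esub> c \<in> carrier ?A"
    using monoid.one_closed[OF assms(1)] by (simp add: monoid_algebra_def)
  then have "(Idl\<^bsub>?A\<^esub> R) +>\<^bsub>?A\<^esub> Poly_Mapping.single \<one>\<^bsub>G\<^esub> c \<in> carrier (?A Quot (Idl\<^bsub>?A\<^esub> R))"
    by (auto simp: FactRing_def A_RCOSETS_def')
  then show ?thesis
    using assms(3) Q.m_closed by (simp add: presented_algebra_def Let_def)
qed

lemma F_rels_carrier: "F_rels q \<subseteq> carrier (monoid_algebra (free_monoid UNIV))"
  by (simp add: monoid_algebra_def free_monoid_def)

lemma B_rels_carrier: "mero_hom_rels Fgen \<subseteq> carrier (monoid_algebra (B_monoid m))"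
proof -
  have diff: "x - y \<in> carrier (monoid_algebra (B_monoid m))"
    if "x \<in> carrier (monoid_algebra (B_monoid m))" "y \<in> carrier (monoid_algebra (B_monoid m))" for x y
    using that Poly_Mapping.keys_add[of x "- y"] by (auto simp: monoid_algebra_def)
  have single: "Poly_Mapping.single w c \<in> carrier (monoid_algebra (B_monoid m))"
    if "set w \<subseteq> range Fgen" for w c
    using that by (auto simp: monoid_algebra_def B_monoid_def free_monoid_def in_lists_conv_set)
  show ?thesis
    unfolding mero_hom_rels_def by (auto intro!: diff single)
qed

lemma ring_F_alg: "Ring.ring (F_alg q)"
  unfolding F_alg_def by (rule ring_presented_algebra[OF monoid_free_monoid F_rels_carrier])

lemma ring_B_alg: "Ring.ring (B_alg m)"
  unfolding B_alg_def
  by (rule ring_presented_algebra[OF _ B_rels_carrier]) (simp add: B_monoid_def monoid_free_monoid)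

lemma ring_BF: "Ring.ring (BF q m)"
  unfolding BF_def
proof (rule ring_tensor[OF ring_B_alg ring_F_alg])
  show "c \<odot>\<^bsub>B_alg m\<^esub> x \<in> carrier (B_alg m)" if "x \<in> carrier (B_alg m)" for c and x :: "'a B_elt"
    using that smult_presented_algebra_closed[OF _ B_rels_carrier]
    unfolding B_alg_def by (simp add: B_monoid_def monoid_free_monoid)
  show "c \<odot>\<^bsub>F_alg q\<^esub> y \<in> carrier (F_alg q)" if "y \<in> carrier (F_alg q)" for c and y :: "'a F_elt"
    using that smult_presented_algebra_closed[OF monoid_free_monoid F_rels_carrier]
    unfolding F_alg_def by blast
qed

lemma dyn_class_in_dyn_tensor:
  "z \<in> carrier (BF q m) \<Longrightarrow> dyn_class q m z \<in> carrier (dyn_tensor q m)"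
  by (auto simp: dyn_class_def dyn_tensor_def A_FactGroup_def' A_RCOSETS_def')

section \<open>The dynamical quantum hyper-Pfaffian\<close>

definition block_perms :: "nat \<Rightarrow> nat \<Rightarrow> (nat \<Rightarrow> nat) set" where
  "block_perms m n =
     {\<sigma>. \<sigma> permutes {1..m * n} \<and> (\<forall>k\<in>{1..n}. strict_mono_on {(k - 1) * m + 1..k * m} \<sigma>)}"

definition block_set :: "nat \<Rightarrow> (nat \<Rightarrow> nat) \<Rightarrow> nat \<Rightarrow> 'N::{finite,linorder} set" where
  "block_set m \<sigma> k = (\<lambda>p. nth_elt UNIV (\<sigma> p)) ` {(k - 1) * m + 1..k * m}"

text \<open>The factors appear in the order $k=n,\dots,1$ of the blocks.\<close>

definition hyper_Pf ::
  "(complex, 'a) module \<Rightarrow> ('N::{finite,linorder} mero \<Rightarrow> 'a \<Rightarrow> 'a) \<Rightarrow> complex \<Rightarrow> nat \<Rightarrow> nat \<Rightarrow>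
     ('N set \<Rightarrow> 'a) \<Rightarrow> 'a" where
  "hyper_Pf A act q m n X =
     (\<Oplus>\<^bsub>A\<^esub>\<sigma>\<in>block_perms m n.
        act (S_tilde q \<sigma> UNIV) (ordered_prod A (map (\<lambda>k. X (block_set m \<sigma> k)) (rev [1..<Suc n]))))"

definition c_elt :: "complex \<Rightarrow> nat \<Rightarrow> 'N::{finite,linorder} set \<Rightarrow> 'N BF_elt" where
  "c_elt q m I = (\<Oplus>\<^bsub>BF q m\<^esub>J\<in>{J. card J = m}. tens q m (b_elt m J) (dyn_minor q J I))"

end

theory Submission
  imports Defs "HOL-Combinatorics.Multiset_Permutations"
begin

text \<open>
  In $\mathscr{F}_R$ a sum over permutations of the row indices with coefficients $S$ is
  antisymmetric in its column indices up to $\mu_r$, and a sum over permutations of the column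
  indices with coefficients $\widetilde S$ is antisymmetric in its row indices up to $\mu_l$;
  both reduce to a relation between two neighbouring generators.  Evaluating the double sum over
  rows and columns in both orders, the two sums agree up to the factor
  $\sum_\sigma \prod_{k<l} (-h(\lambda_{\sigma(k)}-\lambda_{\sigma(l)}))$, which by Lagrange
  interpolation is a constant, non-zero because $q$ is not a root of unity.  So every minor is also
  an alternating sum over columns.  In that form the hyper-Pfaffian of $C$ regroups, for fixed row
  blocks $J_n,\dots,J_1$, into a single sum over all permutations of the columns; it vanishes
  unless the blocks are disjoint, and otherwise equals
  $\mu_l(\widetilde S)\det(T)$, whose $\mu_l$-coefficient the tensor relations move to
  $\widetilde{\mathcal B}$.
\<close>

section \<open>Sums of products of the functions $h$\<close>

text \<open>The coefficients of the Pfaffian of C lie on the \<open>mu_r\<close> side and belong to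
  column indices, whereas a minor is defined as a sum over rows. Summing over blocks of columns
  reaches every ordering of the columns only if each minor contributes a sum over the orderings of
  its own columns; this is why the column form is needed. The relations alone offer no basis in
  which the two forms could be compared term by term. The double sum avoids such a comparison: it
  uses relations between two neighbouring generators only, and what remains is a scalar that can be
  cancelled, up to sign the quantum factorial [r]_q! for minors of size r.

  Coefficients travel past generators because h(\<lambda>_a - \<lambda>_b) is unchanged by the shift
  \<omega>(p) when p is neither a nor b. For sequences with repeated indices the coefficient may
  turn into another function on its way. Rearranging such a sequence still gives some left factor,
  and that is all the vanishing for overlapping blocks asks for.\<close>

lemma coeff_lagrange:
  fixes Q :: "'a::field poly"
  assumes "finite S" "degree Q < card S"
  shows "coeff Q (card S - 1) = (\<Sum>x\<in>S. poly Q x / (\<Prod>y\<in>S - {x}. x - y))"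
proof -
  define P where "P x = (\<Prod>y\<in>S - {x}. [:- y, 1:])" for x
  \<comment> \<open>The Lagrange interpolant of Q at the nodes S. Each \<open>P x\<close> is monic
    of degree \<open>card S - 1\<close>, so the top coefficient of L is the sum of the scalars in
    front of them.\<close>
  define L where "L = (\<Sum>x\<in>S. Polynomial.smult (poly Q x / (\<Prod>y\<in>S - {x}. x - y)) (P x))"
  have deg: "degree (P x) = card S - 1" if "x \<in> S" for x
    using that assms(1) by (simp add: P_def degree_prod_eq_sum_degree card_Diff_singleton)
  have lc: "coeff (P x) (card S - 1) = 1" if "x \<in> S" for x
    using lead_coeff_prod[of "\<lambda>y. [:- y, 1:]" "S - {x}"] deg[OF that] by (simp add: P_def)
  have poly_P: "poly (P x) z = (\<Prod>y\<in>S - {x}. z - y)" for x z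
    by (simp add: P_def poly_prod)
  have "poly L z = poly Q z" if "z \<in> S" for z
  proof -
    have "poly L z = (\<Sum>x\<in>S. if x = z then poly Q z else 0)"
      unfolding L_def poly_sum
    proof (rule sum.cong[OF refl])
      fix x assume "x \<in> S"
      show "poly (Polynomial.smult (poly Q x / (\<Prod>y\<in>S - {x}. x - y)) (P x)) z = (if x = z then poly Q z else 0)"
        using assms(1) that by (auto simp: poly_P prod_zero_iff)
    qed
    then show ?thesis using that assms(1) by simp
  qed
  moreover have "degree L < card S"
  proof -
    have "degree L \<le> card S - 1"
      unfolding L_def using deg by (intro degree_sum_le[OF assms(1)]) (metis degree_smult_le)
    then show ?thesis using assms(2) by linarith
  qed
  ultimately have "L = Q" using assms(2) by (intro poly_eqI_degree[of S])
  have "coeff L (card S - 1) = (\<Sum>x\<in>S. poly Q x / (\<Prod>y\<in>S - {x}. x - y) * coeff (P x) (card S - 1))"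
    by (simp add: L_def coeff_sum)
  also have "\<dots> = (\<Sum>x\<in>S. poly Q x / (\<Prod>y\<in>S - {x}. x - y))"
    by (intro sum.cong) (simp_all add: lc[unfolded One_nat_def])
  finally show ?thesis using \<open>L = Q\<close> by simp
qed

text \<open>Lagrange interpolation of the monic polynomial with roots \<open>t * z b\<close>. Its
  degree is \<open>card K\<close>, so one node more than the points \<open>z a\<close> is required;
  the extra node 0 contributes the term \<open>t ^ card K\<close>.\<close>

lemma sum_prod_ratio:
  fixes z :: "'i \<Rightarrow> 'a::field"
  assumes "finite K" "inj_on z K" "\<And>a. a \<in> K \<Longrightarrow> z a \<noteq> 0"
  shows "(1 - t) * (\<Sum>a\<in>K. \<Prod>b\<in>K - {a}. (z a - t * z b) / (z a - z b)) = 1 - t ^ card K"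
proof -
  define Q where "Q = (\<Prod>b\<in>K. [:- (t * z b), 1:])"
  let ?S = "insert 0 (z ` K)"
  have 0: "0 \<notin> z ` K" using assms(3) by auto
  have card: "card ?S = Suc (card K)"
    using assms(1,2) 0 by (simp add: card_image)
  have deg: "degree Q = card K" by (simp add: Q_def degree_prod_eq_sum_degree)
  have poly_Q: "poly Q x = (\<Prod>b\<in>K. x - t * z b)" for x by (simp add: Q_def poly_prod)
  have "coeff Q (card K) = 1"
    using lead_coeff_prod[of "\<lambda>b. [:- (t * z b), 1:]" K] deg by (simp add: Q_def)
  then have "1 = (\<Sum>x\<in>?S. poly Q x / (\<Prod>y\<in>?S - {x}. x - y))"
    using coeff_lagrange[of ?S Q] assms(1) deg card by simp
  also have "\<dots> = poly Q 0 / (\<Prod>y\<in>z ` K. - y) + (\<Sum>a\<in>K. poly Q (z a) / (\<Prod>y\<in>?S - {z a}. z a - y))"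
    using assms(1,2) 0 by (simp add: sum.reindex insert_Diff_if)
  also have "poly Q 0 / (\<Prod>y\<in>z ` K. - y) = t ^ card K"
  proof -
    have "poly Q 0 = (\<Prod>b\<in>K. t * (- z b))" by (simp add: poly_Q)
    also have "\<dots> = t ^ card K * (\<Prod>b\<in>K. - z b)" by (simp only: prod.distrib prod_constant)
    finally show ?thesis using assms by (simp add: prod.reindex)
  qed
  \<comment> \<open>The factor of Q at \<open>z a\<close> with b = a is
    \<open>(1 - t) * z a\<close>, and the node 0 puts another \<open>z a\<close> into the
    denominator, so that \<open>z a\<close> cancels.\<close>
  also have "(\<Sum>a\<in>K. poly Q (z a) / (\<Prod>y\<in>?S - {z a}. z a - y)) =
      (\<Sum>a\<in>K. (1 - t) * (\<Prod>b\<in>K - {a}. (z a - t * z b) / (z a - z b)))"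
  proof (rule sum.cong[OF refl])
    fix a assume a: "a \<in> K"
    have "?S - {z a} = insert 0 (z ` (K - {a}))"
      using assms(2,3) a by (auto simp: inj_on_def)
    moreover have "0 \<notin> z ` (K - {a})" using 0 by auto
    moreover have "inj_on z (K - {a})" using assms(2) by (auto simp: inj_on_def)
    ultimately have "(\<Prod>y\<in>?S - {z a}. z a - y) = z a * (\<Prod>b\<in>K - {a}. z a - z b)"
      using assms(1) by (simp add: prod.reindex)
    moreover have "poly Q (z a) = (1 - t) * z a * (\<Prod>b\<in>K - {a}. z a - t * z b)"
      unfolding poly_Q using prod.remove[OF assms(1) a, of "\<lambda>b. z a - t * z b"]
      by (simp add: algebra_simps)
    ultimately show "poly Q (z a) / (\<Prod>y\<in>?S - {z a}. z a - y) =
        (1 - t) * (\<Prod>b\<in>K - {a}. (z a - t * z b) / (z a - z b))"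
      using assms(3)[OF a] by (simp add: prod_dividef)
  qed
  finally show ?thesis by (simp add: sum_distrib_left algebra_simps)
qed

section \<open>Identities between classes of meromorphic functions\<close>

lemma mero_eq_refl_iff: "mero_eq F F \<longleftrightarrow> mero_fun F"
  using dense_open_UNIV by (auto simp: mero_eq_def)

lemma abs_mero_eqI: "mero_eq F G \<Longrightarrow> abs_mero F = abs_mero G"
  using Quotient3_rel[OF Quotient3_mero, of F G] by (simp add: mero_eq_refl_iff mero_eq_def)

lemma mero_exhaust:
  fixes f :: "'N::finite mero"
  obtains F where "mero_fun F" "f = abs_mero F"
  using mero.abs_induct[of "\<lambda>f. \<exists>F. mero_fun F \<and> f = abs_mero F" f] mero_eq_refl_iff by blast

lemma abs_mero_sum:
  fixes F :: "'i \<Rightarrow> complex^'N::finite \<Rightarrow> complex"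
  assumes "finite A" "\<And>a. a \<in> A \<Longrightarrow> mero_fun (F a)"
  shows "mero_fun (\<lambda>x. \<Sum>a\<in>A. F a x) \<and> (\<Sum>a\<in>A. abs_mero (F a)) = abs_mero (\<lambda>x. \<Sum>a\<in>A. F a x)"
  using assms
proof (induction A rule: finite_induct)
  case empty
  then show ?case by (simp add: mero_fun_const zero_mero_def)
next
  case (insert a A)
  then show ?case
    using plus_mero.abs_eq[of "F a" "\<lambda>x. \<Sum>a\<in>A. F a x"] by (simp add: mero_eq_refl_iff mero_fun_add)
qed

lemma abs_mero_prod:
  fixes F :: "'i \<Rightarrow> complex^'N::finite \<Rightarrow> complex"
  assumes "finite A" "\<And>a. a \<in> A \<Longrightarrow> mero_fun (F a)"
  shows "mero_fun (\<lambda>x. \<Prod>a\<in>A. F a x) \<and> (\<Prod>a\<in>A. abs_mero (F a)) = abs_mero (\<lambda>x. \<Prod>a\<in>A. F a x)"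
  using assms
proof (induction A rule: finite_induct)
  case empty
  then show ?case by (simp add: mero_fun_const one_mero_def)
next
  case (insert a A)
  then show ?case
    using times_mero.abs_eq[of "F a" "\<lambda>x. \<Prod>a\<in>A. F a x"] by (simp add: mero_eq_refl_iff mero_fun_mult)
qed

lemma dyn_h_abs: "dyn_h q i j = abs_mero (\<lambda>v. hfun q (v $ i - v $ j))"
  by (rule dyn_h.abs_eq)

text \<open>With \<open>a = -2 * Ln q\<close> the excluded set is where the denominator of
  h(\<lambda>_i - \<lambda>_j) vanishes. An identity checked off finitely many such sets is an
  identity in \<open>mero\<close>.\<close>

lemma dense_open_exp_diff:
  assumes "a \<noteq> 0" "i \<noteq> j"
  shows "dense_open {v :: complex^'N. exp (a * (v $ i - v $ j)) - 1 \<noteq> 0}"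
proof -
  have "holo_on UNIV (\<lambda>v :: complex^'N. exp (a * (v $ i - v $ j)) + - 1)"
    by (intro holo_on_add holo_on_const holo_on_exp_diff)
  then have "open {v :: complex^'N. exp (a * (v $ i - v $ j)) - 1 \<noteq> 0}" (is "open ?W")
    using holo_on_nonzero_open[of UNIV _ UNIV] by fastforce
  moreover have "x \<in> closure ?W" for x
    unfolding closure_iff_nhds_not_empty
    using exp_diff_not_locally_one[OF assms] by (fastforce simp: disjoint_iff)
  ultimately show ?thesis unfolding dense_open_def by blast
qed

lemma dense_open_INT:
  "finite A \<Longrightarrow> (\<And>a. a \<in> A \<Longrightarrow> dense_open (W a)) \<Longrightarrow> dense_open (\<Inter>a\<in>A. W a)"
  by (induction A rule: finite_induct) (auto simp: dense_open_UNIV dense_open_Int)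

text \<open>The quantum integer [r]_q = (q^r - q^(-r)) / (q - q^(-1)), in the form in which it comes
  out of \<open>sum_prod_ratio\<close> with t = q^(-2).\<close>

definition h_sum_const :: "complex \<Rightarrow> nat \<Rightarrow> complex" where
  "h_sum_const q r = q ^ (r - 1) * ((1 - (q powr (-2)) ^ r) / (1 - q powr (-2)))"

lemma h_sum_const_nonzero:
  assumes "q \<noteq> 0" "\<And>k. k \<ge> 1 \<Longrightarrow> q ^ k \<noteq> 1" "r \<ge> 1"
  shows "h_sum_const q r \<noteq> 0"
proof -
  have p: "q powr (-2) = inverse (q ^ 2)"
    using assms(1) by (simp add: powr_minus powr_numeral)
  have "(q powr (-2)) ^ k \<noteq> 1" if "k \<ge> 1" for k
    using assms(2)[of "2 * k"] that by (simp add: p power_inverse power_mult)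
  from this[of 1] this[of r] show ?thesis using assms(1,3) by (simp add: h_sum_const_def)
qed

text \<open>The exponential coordinates q^(-2 \<lambda>_a) turn h(\<lambda>_a - \<lambda>_b) into q
  times a ratio of the shape in \<open>sum_prod_ratio\<close>.\<close>

lemma hfun_ratio:
  assumes "q \<noteq> 0" "q \<noteq> 1" "exp (-2 * Ln q * (x - y)) \<noteq> 1"
  shows "hfun q (x - y) = q * ((exp (-2 * Ln q * x) - q powr (-2) * exp (-2 * Ln q * y)) /
           (exp (-2 * Ln q * x) - exp (-2 * Ln q * y)))"
proof -
  have p: "q powr (-2 * z) = exp (-2 * Ln q * z)" for z
    using assms(1) by (simp add: powr_def mult_ac)
  have e: "exp (-2 * Ln q * (x - y)) = exp (-2 * Ln q * x) / exp (-2 * Ln q * y)"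
    by (simp only: right_diff_distrib exp_diff)
  show ?thesis
    using assms(3) unfolding hfun_def p e by (simp add: divide_simps) 
qed

text \<open>In exponential coordinates the factors q collect to q^(|K| - 1), and the remaining sum
  of products of ratios is evaluated by \<open>sum_prod_ratio\<close> with t = q^(-2).\<close>

theorem sum_prod_dyn_h:
  fixes K :: "'N::finite set"
  assumes "q \<noteq> 0" "\<And>k. k \<ge> 1 \<Longrightarrow> q ^ k \<noteq> 1"
  shows "(\<Sum>a\<in>K. \<Prod>b\<in>K - {a}. dyn_h q a b) = mero_const (h_sum_const q (card K))"
proof -
  define F where "F = (\<lambda>x :: complex^'N. \<Sum>a\<in>K. \<Prod>b\<in>K - {a}. hfun q (x $ a - x $ b))"
  have q1: "q \<noteq> 1" using assms(2)[of 1] by simp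
  have a: "-2 * Ln q \<noteq> 0"
    using assms(1) q1 by (metis exp_Ln exp_zero mult_eq_0_iff neg_equal_0_iff_equal zero_neq_numeral)
  let ?t = "q powr (-2)"
  have t: "?t \<noteq> 1"
    using assms(2)[of 2] assms(1) by (simp add: powr_minus powr_numeral)
  have 1: "mero_fun (\<lambda>x. \<Prod>b\<in>K - {a}. hfun q (x $ a - x $ b))" for a
    using abs_mero_prod[of "K - {a}" "\<lambda>b x. hfun q (x $ a - x $ b)"] mero_fun_hfun by auto
  have 2: "(\<Prod>b\<in>K - {a}. dyn_h q a b) = abs_mero (\<lambda>x. \<Prod>b\<in>K - {a}. hfun q (x $ a - x $ b))" for a
    using abs_mero_prod[of "K - {a}" "\<lambda>b x. hfun q (x $ a - x $ b)"] mero_fun_hfun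
    by (auto simp: dyn_h_abs)
  have 3: "mero_fun F \<and> (\<Sum>a\<in>K. \<Prod>b\<in>K - {a}. dyn_h q a b) = abs_mero F"
    unfolding 2 F_def using abs_mero_sum[of K "\<lambda>a x. \<Prod>b\<in>K - {a}. hfun q (x $ a - x $ b)"] 1 by auto
  \<comment> \<open>The points at which no denominator in the finite sum vanishes; there the
    identity holds pointwise.\<close>
  let ?W = "\<Inter>(a, b)\<in>{(a, b) \<in> K \<times> K. a \<noteq> b}. {v :: complex^'N. exp (-2 * Ln q * (v $ a - v $ b)) - 1 \<noteq> 0}"
  have "dense_open ?W"
    using dense_open_exp_diff[OF a] by (intro dense_open_INT) auto
  moreover have "F x = h_sum_const q (card K)" if "x \<in> ?W" for x
  proof -
    define z where "z a = exp (-2 * Ln q * x $ a)" for a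
    have ne: "exp (-2 * Ln q * (x $ a - x $ b)) \<noteq> 1" if "a \<in> K" "b \<in> K" "a \<noteq> b" for a b
      using \<open>x \<in> ?W\<close> that by force
    have "inj_on z K"
    proof (rule inj_onI, rule ccontr)
      fix a b assume "a \<in> K" "b \<in> K" "z a = z b" "a \<noteq> b"
      then show False using ne[of a b] by (simp only: z_def right_diff_distrib exp_diff) simp
    qed
    have "F x = (\<Sum>a\<in>K. \<Prod>b\<in>K - {a}. q * ((z a - ?t * z b) / (z a - z b)))"
      unfolding F_def z_def
      by (intro sum.cong prod.cong refl hfun_ratio assms q1 ne) auto
    also have "\<dots> = q ^ (card K - 1) * (\<Sum>a\<in>K. \<Prod>b\<in>K - {a}. (z a - ?t * z b) / (z a - z b))"
      unfolding sum_distrib_left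
      by (intro sum.cong refl) (simp only: prod.distrib prod_constant card_Diff_singleton)
    also have "(\<Sum>a\<in>K. \<Prod>b\<in>K - {a}. (z a - ?t * z b) / (z a - z b)) = (1 - ?t ^ card K) / (1 - ?t)"
      using sum_prod_ratio[OF _ \<open>inj_on z K\<close>, of ?t] t
      by (simp add: z_def field_simps)
    finally show ?thesis by (simp add: h_sum_const_def)
  qed
  ultimately have "mero_eq F (\<lambda>_. h_sum_const q (card K))"
    using 3 mero_fun_const unfolding mero_eq_def by blast
  then show ?thesis using 3 abs_mero_eqI by (metis mero_const.abs_eq)
qed

text \<open>The case of two indices: h(\<lambda>) + h(-\<lambda>) = [2]_q = q + q^(-1) for every
  \<lambda>. Being constant, the sum is the same on the \<lambda> side and on the \<mu> side, which
  the exchange of two columns in a row sum relies on.\<close>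

lemma dyn_h_add_swap:
  assumes "q \<noteq> 0" "\<And>k. k \<ge> 1 \<Longrightarrow> q ^ k \<noteq> 1" "i \<noteq> j"
  shows "dyn_h q i j + dyn_h q j i = mero_const (h_sum_const q 2)"
  using sum_prod_dyn_h[OF assms(1,2), of "{i, j}"] assms(3) by (simp add: insert_Diff_if numeral_2_eq_2)

lemma mero_const_mult: "mero_const c * mero_const d = mero_const (c * d)"
  using times_mero.abs_eq[of "\<lambda>_. c" "\<lambda>_. d"] by (simp add: mero_eq_refl_iff mero_fun_const mero_const.abs_eq)

lemma mero_const_uminus: "- mero_const c = mero_const (- c)"
  using uminus_mero.abs_eq[of "\<lambda>_. c"] by (simp add: mero_eq_refl_iff mero_fun_const mero_const.abs_eq)

lemma mero_const_1: "mero_const 1 = 1"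
  by (simp add: mero_const.abs_eq one_mero.abs_eq)

lemma mero_shift_dyn_h:
  "p \<noteq> i \<Longrightarrow> p \<noteq> j \<Longrightarrow> mero_shift p (dyn_h q i j) = dyn_h q i j"
  unfolding dyn_h_abs by (subst mero_shift.abs_eq) (simp_all add: mero_eq_refl_iff mero_fun_hfun axis_def)

lemma mero_shift_uminus: "mero_shift p (- f) = - mero_shift p f"
proof -
  obtain F where F: "mero_fun F" "f = abs_mero F" by (rule mero_exhaust)
  have "mero_fun (\<lambda>x. F (x + axis p 1))" "mero_fun (\<lambda>x. - F x)"
    using F mero_fun_shift mero_fun_uminus by auto
  then show ?thesis using F
    by (simp add: uminus_mero.abs_eq mero_shift.abs_eq mero_eq_refl_iff)
qed

lemma mero_shift_const: "mero_shift p (mero_const c) = mero_const c"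
  by (simp add: mero_const.abs_eq mero_shift.abs_eq mero_eq_refl_iff mero_fun_const)

text \<open>The inverse is the shift by -\<omega>(p). Hence a function to the right of a generator
  can be moved to its left.\<close>

lemma mero_shift_surj: "\<exists>g. mero_shift p g = f"
proof -
  obtain F where F: "mero_fun F" "f = abs_mero F" by (rule mero_exhaust)
  have "mero_fun (\<lambda>x. F (x + - axis p 1))" using F mero_fun_shift by blast
  then have "mero_shift p (abs_mero (\<lambda>x. F (x + - axis p 1))) = f"
    using F by (simp add: mero_shift.abs_eq mero_eq_refl_iff)
  then show ?thesis ..
qed

section \<open>Antisymmetrized products in a ring\<close>

definition cross :: "('i \<Rightarrow> 'j \<Rightarrow> 'f::comm_monoid_mult) \<Rightarrow> 'i list \<Rightarrow> 'j list \<Rightarrow> 'f" where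
  "cross c xs ys = (\<Prod>x\<leftarrow>xs. \<Prod>y\<leftarrow>ys. c x y)"

text \<open>The product over all pairs of entries in the order of the list. Weights that equal 1 on
  pairs in one of the two orders give S and its companion; since inversions need not be singled out,
  the product splits whenever the list is split.\<close>

primrec invprod :: "('i \<Rightarrow> 'i \<Rightarrow> 'f::comm_monoid_mult) \<Rightarrow> 'i list \<Rightarrow> 'f" where
  "invprod c [] = 1"
| "invprod c (x # xs) = cross c [x] xs * invprod c xs"

lemma cross_simps [simp]:
  "cross c [] ys = 1" "cross c (x # xs) ys = (\<Prod>y\<leftarrow>ys. c x y) * cross c xs ys" "cross c xs [] = 1"
  by (simp_all add: cross_def) (induction xs; simp)

lemma cross_append2: "cross c xs (ys @ ys') = cross c xs ys * cross c xs ys'"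
  by (induction xs) (simp_all add: mult_ac)

lemma cross_Cons2: "cross c xs (y # ys) = cross c xs [y] * cross c xs ys"
  using cross_append2[of c xs "[y]" ys] by simp

text \<open>Coefficients commute, so the factor between two parts of a list depends only on which
  entries each part contains. Rearrangements inside a part leave it alone.\<close>

lemma cross_mset:
  assumes "mset xs = mset xs'" "mset ys = mset ys'"
  shows "cross c xs ys = cross c xs' ys'"
proof -
  have "(\<Prod>y\<leftarrow>ys. c x y) = (\<Prod>y\<leftarrow>ys'. c x y)" for x
    by (metis assms(2) mset_map prod_mset_prod_list)
  then show ?thesis
    unfolding cross_def by (simp) (metis assms(1) mset_map prod_mset_prod_list)
qed

lemma invprod_append: "invprod c (xs @ ys) = invprod c xs * cross c xs ys * invprod c ys"
  by (induction xs) (simp_all add: cross_append2 mult_ac)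

lemma cross_flip: "cross c xs ys = cross (\<lambda>b a. c a b) ys xs"
proof (induction xs)
  case (Cons x xs)
  have "cross (\<lambda>b a. c a b) ys (x # xs) = cross (\<lambda>b a. c a b) ys [x] * cross (\<lambda>b a. c a b) ys xs"
    by (rule cross_Cons2)
  then show ?case using Cons by (simp add: cross_def)
qed simp

lemma invprod_rev: "invprod c (rev xs) = invprod (\<lambda>a b. c b a) xs"
proof (induction xs)
  case (Cons x xs)
  have "cross c (rev xs) [x] = cross (\<lambda>a b. c b a) [x] xs"
    using cross_flip[of c "rev xs" "[x]"] cross_mset[of "[x]" "[x]" "rev xs" xs] by simp
  with Cons show ?case by (simp add: invprod_append mult_ac)
qed simp

lemma cross_1: "(\<And>x y. x \<in> set xs \<Longrightarrow> y \<in> set ys \<Longrightarrow> c x y = 1) \<Longrightarrow> cross c xs ys = 1"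
proof -
  have "(\<And>y. y \<in> set ys \<Longrightarrow> c x y = 1) \<Longrightarrow> (\<Prod>y\<leftarrow>ys. c x y) = 1" for x
    by (induction ys) auto
  then show "(\<And>x y. x \<in> set xs \<Longrightarrow> y \<in> set ys \<Longrightarrow> c x y = 1) \<Longrightarrow> cross c xs ys = 1"
    by (induction xs) auto
qed

lemma invprod_mult:
  "invprod (\<lambda>a b. c a b * d a b) xs = invprod c xs * invprod d xs"
proof (induction xs)
  case (Cons x xs)
  have "(\<Prod>y\<leftarrow>xs. c x y * d x y) = (\<Prod>y\<leftarrow>xs. c x y) * (\<Prod>y\<leftarrow>xs. d x y)" for x
    by (induction xs) (auto simp: mult_ac)
  with Cons show ?case by (simp add: mult_ac)
qed simp

lemma invprod_cong:
  "distinct xs \<Longrightarrow> (\<And>a b. a \<in> set xs \<Longrightarrow> b \<in> set xs \<Longrightarrow> a \<noteq> b \<Longrightarrow> c a b = d a b) \<Longrightarrow> invprod c xs = invprod d xs"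
proof (induction xs)
  case (Cons x xs)
  have "map (c x) xs = map (d x) xs" using Cons.prems by (intro map_cong) auto
  then have "cross c [x] xs = cross d [x] xs" by (simp del: map_eq_conv)
  with Cons show ?case by simp
qed simp

lemma invprod_sorted:
  assumes "sorted xs" "distinct xs" "\<And>a b. a < b \<Longrightarrow> c a b = 1"
  shows "invprod c xs = 1"
  using assms(1,2)
proof (induction xs)
  case (Cons x xs)
  have "cross c [x] xs = 1" using Cons.prems assms(3) by (intro cross_1) (auto simp: less_le)
  with Cons show ?case by simp
qed simp

text \<open>The link to products over pairs of positions, the form in which \<open>S_coeff\<close>
  and \<open>S_tilde\<close> are defined.\<close>

lemma invprod_nth:
  "invprod c xs = (\<Prod>(k, l)\<in>{(k, l). k < l \<and> l < length xs}. c (xs ! k) (xs ! l))"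
proof (induction xs)
  case (Cons x xs)
  let ?A = "{(k, l). k < l \<and> l < length (x # xs)}"
  let ?B = "{(k, l). k < l \<and> l < length xs}"
  have fin: "finite ?B" by (rule finite_subset[of _ "{..<length xs} \<times> {..<length xs}"]) auto
  have A: "?A = (\<lambda>l. (0, Suc l)) ` {..<length xs} \<union> (\<lambda>(k, l). (Suc k, Suc l)) ` ?B"
  proof (rule Set.set_eqI)
    fix p :: "nat \<times> nat"
    show "p \<in> ?A \<longleftrightarrow> p \<in> (\<lambda>l. (0, Suc l)) ` {..<length xs} \<union> (\<lambda>(k, l). (Suc k, Suc l)) ` ?B"
      by (cases p; cases "fst p"; cases "snd p") (auto simp: image_iff)
  qed
  have "(\<Prod>(k, l)\<in>?A. c ((x # xs) ! k) ((x # xs) ! l)) =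
      (\<Prod>l<length xs. c x (xs ! l)) * (\<Prod>(k, l)\<in>?B. c (xs ! k) (xs ! l))"
    unfolding A using fin
    by (subst prod.union_disjoint) (auto simp: prod.reindex inj_on_def case_prod_beta)
  also have "(\<Prod>l<length xs. c x (xs ! l)) = cross c [x] xs"
    by (simp add: prod.list_conv_set_nth atLeast0LessThan)
  finally show ?case using Cons by simp
qed simp

section \<open>Finite sums and ordered products in rings\<close>

context abelian_monoid
begin

lemma finsum_swap:
  assumes "finite A" "finite B" "\<And>a b. a \<in> A \<Longrightarrow> b \<in> B \<Longrightarrow> f a b \<in> carrier G"
  shows "(\<Oplus>a\<in>A. \<Oplus>b\<in>B. f a b) = (\<Oplus>b\<in>B. \<Oplus>a\<in>A. f a b)"
  using assms(1,3)
proof (induction A rule: finite_induct)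
  case empty
  then show ?case by simp
next
  case (insert a A)
  then have "(\<Oplus>b\<in>B. \<Oplus>a\<in>insert a A. f a b) = (\<Oplus>b\<in>B. f a b \<oplus> (\<Oplus>a\<in>A. f a b))"
    by (intro finsum_cong') (auto intro!: finsum_insert finsum_closed)
  also have "\<dots> = (\<Oplus>b\<in>B. f a b) \<oplus> (\<Oplus>b\<in>B. \<Oplus>a\<in>A. f a b)"
    using insert by (intro finsum_addf) (auto intro!: finsum_closed)
  finally show ?case using insert by (subst finsum_insert) (auto intro!: finsum_closed)
qed

lemma finsum_Sigma:
  assumes "finite A" "\<And>a. a \<in> A \<Longrightarrow> finite (B a)" "\<And>a b. a \<in> A \<Longrightarrow> b \<in> B a \<Longrightarrow> f a b \<in> carrier G"
  shows "(\<Oplus>a\<in>A. \<Oplus>b\<in>B a. f a b) = (finsum G (\<lambda>(a, b). f a b) (Sigma A B))"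
  using assms
proof (induction A rule: finite_induct)
  case empty
  then show ?case by simp
next
  case (insert a A)
  have S: "Sigma (insert a A) B = Pair a ` B a \<union> Sigma A B" by auto
  have 1: "(finsum G (\<lambda>(a, b). f a b) (Pair a ` B a)) = (\<Oplus>b\<in>B a. f a b)"
    using insert.prems by (subst finsum_reindex) (auto simp: inj_on_def)
  have "(finsum G (\<lambda>(a, b). f a b) (Sigma (insert a A) B)) =
      (finsum G (\<lambda>(a, b). f a b) (Pair a ` B a)) \<oplus> (finsum G (\<lambda>(a, b). f a b) (Sigma A B))"
    unfolding S using insert by (intro finsum_Un_disjoint) auto
  then show ?case unfolding 1
    using insert by (subst finsum_insert) (auto intro!: finsum_closed)
qed

lemma finsum_reindex_bij:
  assumes "bij_betw h A B" "\<And>b. b \<in> B \<Longrightarrow> f b \<in> carrier G"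
  shows "(\<Oplus>b\<in>B. f b) = (\<Oplus>a\<in>A. f (h a))"
  using assms finsum_reindex[of f h A] by (auto simp: bij_betw_def)

end

context monoid
begin

lemma ordered_prod_Nil [simp]: "ordered_prod G [] = \<one>"
  and ordered_prod_Cons [simp]: "ordered_prod G (x # xs) = x \<otimes> ordered_prod G xs"
  by (simp_all add: ordered_prod_def)

lemma ordered_prod_closed [intro, simp]: "set xs \<subseteq> carrier G \<Longrightarrow> ordered_prod G xs \<in> carrier G"
  by (induction xs) auto

lemma ordered_prod_append:
  "set xs \<subseteq> carrier G \<Longrightarrow> set ys \<subseteq> carrier G \<Longrightarrow>
     ordered_prod G (xs @ ys) = ordered_prod G xs \<otimes> ordered_prod G ys"
  by (induction xs) (auto simp: m_assoc)

lemma ordered_prod_commute: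
  assumes "a \<in> carrier G" "set xs \<subseteq> carrier G" "\<And>x. x \<in> set xs \<Longrightarrow> a \<otimes> x = x \<otimes> a"
  shows "a \<otimes> ordered_prod G xs = ordered_prod G xs \<otimes> a"
  using assms(2,3)
proof (induction xs)
  case (Cons x xs)
  have "a \<otimes> (x \<otimes> ordered_prod G xs) = (x \<otimes> a) \<otimes> ordered_prod G xs"
    using Cons.prems assms(1) by (simp flip: m_assoc)
  also have "\<dots> = x \<otimes> (ordered_prod G xs \<otimes> a)"
    using Cons assms(1) by (simp add: m_assoc)
  finally show ?case using Cons.prems assms(1) by (simp add: m_assoc)
qed (use assms(1) in simp)

end

lemma finite_listset: "(\<And>A. A \<in> set As \<Longrightarrow> finite A) \<Longrightarrow> finite (listset As)"
  by (induction As) (auto simp: set_Cons_def intro!: finite_image_set2)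

lemma in_listset: "xs \<in> listset As \<longleftrightarrow> list_all2 (\<in>) xs As"
  by (induction As arbitrary: xs) (auto simp: set_Cons_def list_all2_Cons2)

text \<open>Multiplying out keeps the order of the factors, so the choices of one summand per factor
  are indexed by lists.\<close>

lemma (in Ring.ring) ordered_prod_finsum:
  assumes "\<And>z. z \<in> set zs \<Longrightarrow> finite (S z)" "\<And>z p. z \<in> set zs \<Longrightarrow> p \<in> S z \<Longrightarrow> f z p \<in> carrier R"
  shows "ordered_prod R (map (\<lambda>z. \<Oplus>p\<in>S z. f z p) zs) =
     (\<Oplus>ps\<in>listset (map S zs). ordered_prod R (map2 f zs ps))"
  using assms
proof (induction zs)
  case Nil
  then show ?case by (simp add: finsum_insert[of "{}", simplified])
next
  case (Cons z zs)
  have fin: "finite (listset (map S zs))" using Cons.prems(1) by (intro finite_listset) auto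
  have cl: "ordered_prod R (map2 f zs ps) \<in> carrier R" if "ps \<in> listset (map S zs)" for ps
    using that Cons.prems(2)
    by (fastforce simp: in_listset list_all2_conv_all_nth set_zip intro!: ordered_prod_closed)
  have "ordered_prod R (map (\<lambda>z. \<Oplus>p\<in>S z. f z p) (z # zs)) =
      (\<Oplus>p\<in>S z. f z p) \<otimes> (\<Oplus>ps\<in>listset (map S zs). ordered_prod R (map2 f zs ps))"
    using Cons by simp
  also have "\<dots> = (\<Oplus>p\<in>S z. f z p \<otimes> (\<Oplus>ps\<in>listset (map S zs). ordered_prod R (map2 f zs ps)))"
    using Cons.prems cl by (intro finsum_ldistr) (auto intro!: finsum_closed)
  also have "\<dots> = (\<Oplus>p\<in>S z. \<Oplus>ps\<in>listset (map S zs). f z p \<otimes> ordered_prod R (map2 f zs ps))"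
    using Cons.prems cl fin by (intro finsum_cong' finsum_rdistr) (auto intro!: finsum_closed)
  also have "\<dots> = (finsum R (\<lambda>(p, ps). f z p \<otimes> ordered_prod R (map2 f zs ps)) (S z \<times> listset (map S zs)))"
    using Cons.prems cl fin by (intro finsum_Sigma) auto
  also have "\<dots> = (finsum R (\<lambda>(p, ps). ordered_prod R (map2 f (z # zs) (p # ps))) (S z \<times> listset (map S zs)))"
    using Cons.prems cl fin by (intro finsum_cong') auto
  also have "\<dots> = (\<Oplus>a\<in>S z \<times> listset (map S zs). ordered_prod R (map2 f (z # zs) (case a of (p, ps) \<Rightarrow> p # ps)))"
    using Cons.prems cl fin by (intro finsum_cong') auto
  also have "\<dots> = (\<Oplus>ps\<in>listset (map S (z # zs)). ordered_prod R (map2 f (z # zs) ps))"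
  proof (rule finsum_reindex_bij[symmetric])
    show "bij_betw (\<lambda>a. case a of (p, ps) \<Rightarrow> p # ps) (S z \<times> listset (map S zs)) (listset (map S (z # zs)))"
      by (auto simp: bij_betw_def inj_on_def set_Cons_def image_iff)
    show "ordered_prod R (map2 f (z # zs) b) \<in> carrier R" if "b \<in> listset (map S (z # zs))" for b
      using that Cons.prems(2) cl by (auto simp: set_Cons_def)
  qed
  finally show ?case .
qed

text \<open>Both antisymmetrizations are instances: rows permuted with coefficients in \<lambda>,
  columns permuted with coefficients in \<mu>. The last assumption speaks only of the weights
  \<open>c a b\<close> and of indices other than a and b, because in general a coefficient is
  shifted by a generator.\<close>

locale antisymmetrizer = Ring.ring R for R (structure) +
  fixes \<phi> :: "'f::comm_ring_1 \<Rightarrow> 'a" and c :: "'i::linorder \<Rightarrow> 'i \<Rightarrow> 'f" and u :: "'i \<Rightarrow> 'j \<Rightarrow> 'a"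
  assumes phi_closed [simp]: "\<phi> f \<in> carrier R"
    and phi_mult: "\<phi> (f * g) = \<phi> f \<otimes> \<phi> g"
    and phi_one: "\<phi> 1 = \<one>"
    and u_closed [simp]: "u p x \<in> carrier R"
    and phi_u: "p \<noteq> a \<Longrightarrow> p \<noteq> b \<Longrightarrow> \<phi> (c a b) \<otimes> u p x = u p x \<otimes> \<phi> (c a b)"
begin

definition W :: "'i list \<Rightarrow> 'j list \<Rightarrow> 'a" where
  "W ps xs = ordered_prod R (map2 u ps xs)"

text \<open>Only the first indices are permuted. The list of second indices stays arbitrary,
  possibly with repetitions, so that it can be rearranged and can come from overlapping
  blocks.\<close>

definition altsum :: "'i set \<Rightarrow> 'j list \<Rightarrow> 'a" where
  "altsum K xs = (\<Oplus>p\<in>permutations_of_set K. \<phi> (invprod c p) \<otimes> W p xs)"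

lemma W_closed [simp]: "W ps xs \<in> carrier R"
  unfolding W_def by (intro ordered_prod_closed) auto

lemma altsum_closed [simp]: "altsum K xs \<in> carrier R"
  unfolding altsum_def by (intro finsum_closed) auto

lemma W_append: "length ps = length xs \<Longrightarrow> W (ps @ qs) (xs @ ys) = W ps xs \<otimes> W qs ys"
  unfolding W_def by (simp, subst ordered_prod_append) auto

lemma W_Cons: "W (p # ps) (x # xs) = u p x \<otimes> W ps xs"
  by (simp add: W_def)

lemma phi_W:
  assumes "a \<notin> set ps" "b \<notin> set ps"
  shows "\<phi> (c a b) \<otimes> W ps xs = W ps xs \<otimes> \<phi> (c a b)"
  unfolding W_def using assms
  by (intro ordered_prod_commute) (auto dest: set_zip_leftD intro!: phi_u)

lemma phi_prod_commute:
  assumes "x \<in> carrier R" "\<And>y. y \<in> set ys \<Longrightarrow> \<phi> (f y) \<otimes> x = x \<otimes> \<phi> (f y)"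
  shows "\<phi> (\<Prod>y\<leftarrow>ys. f y) \<otimes> x = x \<otimes> \<phi> (\<Prod>y\<leftarrow>ys. f y)"
  using assms(2)
proof (induction ys)
  case Nil
  then show ?case using assms(1) by (simp add: phi_one)
next
  case (Cons y ys)
  let ?P = "\<phi> (\<Prod>y\<leftarrow>ys. f y)"
  have "?P \<otimes> x = x \<otimes> ?P" using Cons by simp
  then have "\<phi> (\<Prod>y\<leftarrow>y # ys. f y) \<otimes> x = (\<phi> (f y) \<otimes> x) \<otimes> ?P"
    using assms(1) by (simp add: phi_mult m_assoc)
  also have "\<phi> (f y) \<otimes> x = x \<otimes> \<phi> (f y)" using Cons.prems by simp
  also have "x \<otimes> \<phi> (f y) \<otimes> ?P = x \<otimes> \<phi> (\<Prod>y\<leftarrow>y # ys. f y)"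
    using assms(1) by (simp add: phi_mult m_assoc)
  finally show ?case .
qed

lemma phi_invprod_W:
  assumes "set qs \<inter> set ps = {}"
  shows "\<phi> (invprod c qs) \<otimes> W ps xs = W ps xs \<otimes> \<phi> (invprod c qs)"
  using assms
proof (induction qs)
  case Nil
  then show ?case by (simp add: phi_one)
next
  case (Cons q qs)
  let ?c = "\<phi> (cross c [q] qs)" and ?i = "\<phi> (invprod c qs)"
  have "\<phi> (invprod c (q # qs)) \<otimes> W ps xs = ?c \<otimes> (?i \<otimes> W ps xs)"
    by (simp add: phi_mult m_assoc)
  also have "\<dots> = (?c \<otimes> W ps xs) \<otimes> ?i" using Cons by (simp add: m_assoc)
  also have "?c \<otimes> W ps xs = W ps xs \<otimes> ?c"
    using Cons.prems by (simp, intro phi_prod_commute phi_W) auto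
  finally show ?case by (simp add: phi_mult m_assoc)
qed

text \<open>The permutations of K are paired by exchanging the entries a and b at the positions of x
  and y. Both weights contain the same factor, as the remaining products do not see the order of a
  and b, besides \<open>c a b\<close> or \<open>c b a\<close>. This last weight passes
  \<open>W ps us\<close>, since neither a nor b occurs in ps, and so reaches the two generators it
  belongs to.\<close>

lemma altsum_pairs:
  assumes "finite K" "length us + 2 + length vs = card K"
  defines "G \<equiv> {(ps, a, b, qs). length ps = length us \<and> a < b \<and> ps @ a # b # qs \<in> permutations_of_set K}"
  shows "altsum K (us @ x # y # vs) =
    (finsum R (\<lambda>(ps, a, b, qs). \<phi> (invprod c ps * cross c ps (a # b # qs) * cross c [a, b] qs * invprod c qs) \<otimes> (W ps us
        \<otimes> ((\<phi> (c a b) \<otimes> (u a x \<otimes> u b y) \<oplus> \<phi> (c b a) \<otimes> (u b x \<otimes> u a y)) \<otimes> W qs vs))) G)"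
    (is "_ = ?rhs")
proof -
  define f :: "'i list \<times> 'i \<times> 'i \<times> 'i list \<Rightarrow> 'i list" where "f = (\<lambda>(ps, a, b, qs). ps @ a # b # qs)"
  define f' :: "'i list \<times> 'i \<times> 'i \<times> 'i list \<Rightarrow> 'i list" where "f' = (\<lambda>(ps, a, b, qs). ps @ b # a # qs)"
  define T where "T p = \<phi> (invprod c p) \<otimes> W p (us @ x # y # vs)" for p
  have Tc: "T p \<in> carrier R" for p by (simp add: T_def)
  have inj: "inj_on f G" "inj_on f' G" by (auto simp: inj_on_def f_def f'_def G_def)
  have un: "permutations_of_set K = f ` G \<union> f' ` G"
  proof
    show "f ` G \<union> f' ` G \<subseteq> permutations_of_set K"
      by (auto simp: G_def f_def f'_def permutations_of_set_def)
    show "permutations_of_set K \<subseteq> f ` G \<union> f' ` G"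
    proof
      fix p assume p: "p \<in> permutations_of_set K"
      let ?k = "length us"
      define ps a b qs where "ps = take ?k p" "a = p ! ?k" "b = p ! Suc ?k" "qs = drop (Suc (Suc ?k)) p"
      have "length p = card K" using p by (auto simp: permutations_of_set_def distinct_card)
      then have len: "Suc ?k < length p" using assms(2) by simp
      then have eq: "p = ps @ a # b # qs"
        unfolding ps_a_b_qs_def by (simp add: id_take_nth_drop Cons_nth_drop_Suc)
      then have "a \<noteq> b" using p by (auto simp: permutations_of_set_def)
      moreover have "length ps = ?k" using len by (simp add: ps_a_b_qs_def)
      ultimately have "(ps, a, b, qs) \<in> G \<or> (ps, b, a, qs) \<in> G"
        using p unfolding eq by (auto simp: G_def permutations_of_set_def)
      then show "p \<in> f ` G \<union> f' ` G"
        unfolding eq by (force simp: f_def f'_def)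
    qed
  qed
  have disj: "f ` G \<inter> f' ` G = {}" by (auto simp: f_def f'_def G_def)
  have fin: "finite (f ` G)" "finite (f' ` G)"
    using un by (metis finite_Un finite_permutations_of_set)+
  have "altsum K (us @ x # y # vs) = finsum R T (f ` G \<union> f' ` G)"
    unfolding altsum_def T_def un[symmetric] ..
  also have "\<dots> = finsum R T (f ` G) \<oplus> finsum R T (f' ` G)"
    using fin disj Tc by (intro finsum_Un_disjoint) auto
  also have "\<dots> = (\<Oplus>g\<in>G. T (f g) \<oplus> T (f' g))"
    using Tc inj by (simp add: finsum_reindex finsum_addf)
  also have "\<dots> = ?rhs"
  proof (rule finsum_cong'[OF refl])
    fix g assume "g \<in> G"
    then obtain ps a b qs where g: "g = (ps, a, b, qs)" and len: "length ps = length us"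
      and per: "ps @ a # b # qs \<in> permutations_of_set K"
      by (auto simp: G_def)
    have ab: "a \<notin> set ps" "b \<notin> set ps" using per by (auto simp: permutations_of_set_def)
    let ?c0 = "invprod c ps * cross c ps (a # b # qs) * cross c [a, b] qs * invprod c qs"
    have i1: "invprod c (ps @ a # b # qs) = ?c0 * c a b"
      by (simp add: invprod_append mult_ac)
    have "cross c ps (b # a # qs) = cross c ps (a # b # qs)"
      by (rule cross_mset) auto
    then have i2: "invprod c (ps @ b # a # qs) = ?c0 * c b a"
      by (simp add: invprod_append mult_ac)
    have t: "\<phi> (?c0 * c a' b') \<otimes> (W ps us \<otimes> (u a' x \<otimes> (u b' y \<otimes> W qs vs))) =
        \<phi> ?c0 \<otimes> (W ps us \<otimes> ((\<phi> (c a' b') \<otimes> (u a' x \<otimes> u b' y)) \<otimes> W qs vs))"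
      if "a' \<notin> set ps" "b' \<notin> set ps" for a' b'
    proof -
      have "\<phi> (c a' b') \<otimes> (W ps us \<otimes> z) = W ps us \<otimes> (\<phi> (c a' b') \<otimes> z)" if "z \<in> carrier R" for z
        using phi_W[OF \<open>a' \<notin> set ps\<close> \<open>b' \<notin> set ps\<close>, of us] that by (simp flip: m_assoc)
      then show ?thesis by (simp add: phi_mult m_assoc)
    qed
    have w: "W (ps @ a' # b' # qs) (us @ x # y # vs) = W ps us \<otimes> (u a' x \<otimes> (u b' y \<otimes> W qs vs))" for a' b'
      using len by (simp add: W_append W_Cons)
    show "T (f g) \<oplus> T (f' g) = (case g of (ps, a, b, qs) \<Rightarrow>
        \<phi> (invprod c ps * cross c ps (a # b # qs) * cross c [a, b] qs * invprod c qs) \<otimes> (W ps us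
        \<otimes> ((\<phi> (c a b) \<otimes> (u a x \<otimes> u b y) \<oplus> \<phi> (c b a) \<otimes> (u b x \<otimes> u a y)) \<otimes> W qs vs)))"
      unfolding g T_def f_def f'_def prod.case w i1 i2 t[OF ab] t[OF ab(2,1)]
      by (simp add: r_distr l_distr)
  qed auto
  finally show ?thesis .
qed

text \<open>With \<open>\<Psi> = \<zero>\<close> this is the vanishing for equal neighbours.\<close>

lemma altsum_swap:
  assumes "finite K" "length us + 2 + length vs = card K"
    and cl: "\<Psi> \<in> carrier R" "\<Psi>' \<in> carrier R"
    and loc: "\<And>a b. a < b \<Longrightarrow>
      \<phi> (c a b) \<otimes> (u a x \<otimes> u b y) \<oplus> \<phi> (c b a) \<otimes> (u b x \<otimes> u a y) =
      \<Psi> \<otimes> (\<phi> (c a b) \<otimes> (u a y \<otimes> u b x) \<oplus> \<phi> (c b a) \<otimes> (u b y \<otimes> u a x))"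
    and W: "\<And>ps. length ps = length us \<Longrightarrow> W ps us \<otimes> \<Psi> = \<Psi>' \<otimes> W ps us"
    and comm: "\<And>f. \<phi> f \<otimes> \<Psi>' = \<Psi>' \<otimes> \<phi> f"
  shows "altsum K (us @ x # y # vs) = \<Psi>' \<otimes> altsum K (us @ y # x # vs)"
proof -
  let ?G = "{(ps, a, b, qs). length ps = length us \<and> a < b \<and> ps @ a # b # qs \<in> permutations_of_set K}"
  let ?c0 = "\<lambda>ps a b qs. \<phi> (invprod c ps * cross c ps (a # b # qs) * cross c [a, b] qs * invprod c qs)"
  let ?p = "\<lambda>a b x y. \<phi> (c a b) \<otimes> (u a x \<otimes> u b y) \<oplus> \<phi> (c b a) \<otimes> (u b x \<otimes> u a y)"
  have fin: "finite ?G"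
  proof (rule inj_on_finite[of "\<lambda>(ps, a, b, qs). ps @ a # b # qs"])
    show "inj_on (\<lambda>(ps, a, b, qs). ps @ a # b # qs) ?G" by (auto simp: inj_on_def)
  qed auto
  have "altsum K (us @ x # y # vs) = (finsum R (\<lambda>(ps, a, b, qs). ?c0 ps a b qs \<otimes> (W ps us \<otimes> (?p a b x y \<otimes> W qs vs))) ?G)"
    by (rule altsum_pairs[OF assms(1,2)])
  also have "\<dots> = (\<Oplus>g\<in>?G. \<Psi>' \<otimes> (case g of (ps, a, b, qs) \<Rightarrow> ?c0 ps a b qs \<otimes> (W ps us \<otimes> (?p a b y x \<otimes> W qs vs))))"
  proof (rule finsum_cong'[OF refl])
    fix g assume "g \<in> ?G"
    then obtain ps a b qs where g: "g = (ps, a, b, qs)" and len: "length ps = length us" and ab: "a < b"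
      by auto
    let ?t = "?p a b y x \<otimes> W qs vs"
    have t: "?t \<in> carrier R" by simp
    have "?c0 ps a b qs \<otimes> (W ps us \<otimes> (?p a b x y \<otimes> W qs vs)) =
        ?c0 ps a b qs \<otimes> ((W ps us \<otimes> \<Psi>) \<otimes> ?t)"
      unfolding loc[OF ab] using cl by (simp add: m_assoc)
    also have "\<dots> = (?c0 ps a b qs \<otimes> \<Psi>') \<otimes> (W ps us \<otimes> ?t)"
      unfolding W[OF len] using cl by (simp add: m_assoc)
    also have "\<dots> = \<Psi>' \<otimes> (?c0 ps a b qs \<otimes> (W ps us \<otimes> ?t))"
      unfolding comm using cl by (simp add: m_assoc)
    finally show "(case g of (ps, a, b, qs) \<Rightarrow> ?c0 ps a b qs \<otimes> (W ps us \<otimes> (?p a b x y \<otimes> W qs vs))) =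
        \<Psi>' \<otimes> (case g of (ps, a, b, qs) \<Rightarrow> ?c0 ps a b qs \<otimes> (W ps us \<otimes> (?p a b y x \<otimes> W qs vs)))"
      unfolding g prod.case .
  qed (use cl in auto)
  also have "\<dots> = \<Psi>' \<otimes> altsum K (us @ y # x # vs)"
    unfolding altsum_pairs[OF assms(1,2)]
    using fin cl by (intro finsum_rdistr[symmetric]) auto
  finally show ?thesis .
qed

end

text \<open>Insertion sort between a fixed prefix us and a fixed suffix vs: each exchange of
  neighbours contributes its weight d, and pairs already in order have weight 1, so the exchanges
  multiply up to \<open>invprod d xs\<close>. In the presence of repetitions the factor is merely
  claimed to exist; a left multiple of zero is zero all the same.\<close>

lemma (in Ring.ring) sort_coefficient:
  fixes E :: "'j::linorder list \<Rightarrow> 'a" and \<psi> :: "'f::comm_monoid_mult \<Rightarrow> 'a"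
  assumes E_closed: "\<And>xs. E xs \<in> carrier R"
    and psi: "\<And>f. \<psi> f \<in> carrier R" "\<And>f g. \<psi> (f * g) = \<psi> f \<otimes> \<psi> g" "\<psi> 1 = \<one>"
    and d: "\<And>x y. x < y \<Longrightarrow> d x y = 1"
    and swap: "\<And>us x y vs. y < x \<Longrightarrow> length us + 2 + length vs = N \<Longrightarrow>
        \<exists>f\<in>carrier R. E (us @ x # y # vs) = f \<otimes> E (us @ y # x # vs) \<and>
          (distinct (us @ x # y # vs) \<longrightarrow> f = \<psi> (d x y))"
    and len: "length us + length xs + length vs = N"
  shows "\<exists>f\<in>carrier R. E (us @ xs @ vs) = f \<otimes> E (us @ sort xs @ vs) \<and>
          (distinct (us @ xs @ vs) \<longrightarrow> f = \<psi> (invprod d xs))"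
proof -
  have ins: "\<exists>f\<in>carrier R. E (us @ x # ys @ vs) = f \<otimes> E (us @ insort x ys @ vs) \<and>
      (distinct (us @ x # ys @ vs) \<longrightarrow> f = \<psi> (cross d [x] ys))"
    if "sorted ys" "length us + Suc (length ys) + length vs = N" for us x ys
    using that
  proof (induction ys arbitrary: us)
    case Nil
    then show ?case using E_closed psi by (intro bexI[of _ \<one>]) auto
  next
    case (Cons y ys)
    show ?case
    proof (cases "x \<le> y")
      case True
      have "cross d [x] (y # ys) = 1" if "distinct (us @ x # (y # ys) @ vs)"
        using that True Cons.prems(1) by (intro cross_1 d) (auto simp: less_le)
      then show ?thesis
        using True E_closed psi by (intro bexI[of _ \<one>]) auto
    next
      case False
      then have yx: "y < x" by (rule not_le_imp_less)
      obtain f where f: "f \<in> carrier R" "E (us @ x # y # ys @ vs) = f \<otimes> E (us @ y # x # ys @ vs)"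
        "distinct (us @ x # y # ys @ vs) \<longrightarrow> f = \<psi> (d x y)"
        using swap[OF yx, of us "ys @ vs"] Cons.prems by auto
      obtain g where g: "g \<in> carrier R"
        "E ((us @ [y]) @ x # ys @ vs) = g \<otimes> E ((us @ [y]) @ insort x ys @ vs)"
        "distinct ((us @ [y]) @ x # ys @ vs) \<longrightarrow> g = \<psi> (cross d [x] ys)"
        using Cons.IH[of "us @ [y]"] Cons.prems by auto
      show ?thesis
      proof (intro bexI[of _ "f \<otimes> g"] conjI impI)
        show "E (us @ x # (y # ys) @ vs) = f \<otimes> g \<otimes> E (us @ insort x (y # ys) @ vs)"
          using f(1,2) g(1,2) False E_closed by (simp add: m_assoc)
        show "f \<otimes> g = \<psi> (cross d [x] (y # ys))" if "distinct (us @ x # (y # ys) @ vs)"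
        proof -
          have "distinct (us @ x # y # ys @ vs)" "distinct ((us @ [y]) @ x # ys @ vs)"
            using that by auto
          then show ?thesis using f(3) g(3) psi by simp
        qed
      qed (use f g in simp)
    qed
  qed
  show ?thesis using len
  proof (induction xs arbitrary: us)
    case Nil
    then show ?case using E_closed psi by (intro bexI[of _ \<one>]) auto
  next
    case (Cons x xs)
    obtain f where f: "f \<in> carrier R" "E ((us @ [x]) @ xs @ vs) = f \<otimes> E ((us @ [x]) @ sort xs @ vs)"
        "distinct ((us @ [x]) @ xs @ vs) \<longrightarrow> f = \<psi> (invprod d xs)"
      using Cons.IH[of "us @ [x]"] Cons.prems by auto
    obtain g where g: "g \<in> carrier R" "E (us @ x # sort xs @ vs) = g \<otimes> E (us @ insort x (sort xs) @ vs)"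
        "distinct (us @ x # sort xs @ vs) \<longrightarrow> g = \<psi> (cross d [x] (sort xs))"
      using ins[of "sort xs" us x] Cons.prems by auto
    show ?case
    proof (intro bexI[of _ "f \<otimes> g"] conjI impI)
      show "E (us @ (x # xs) @ vs) = f \<otimes> g \<otimes> E (us @ sort (x # xs) @ vs)"
        using f(1,2) g(1,2) E_closed by (simp add: m_assoc)
      show "f \<otimes> g = \<psi> (invprod d (x # xs))" if dis: "distinct (us @ (x # xs) @ vs)"
      proof -
        have "f = \<psi> (invprod d xs)" "g = \<psi> (cross d [x] (sort xs))"
          using dis f(3) g(3) by auto
        moreover have "cross d [x] (sort xs) = cross d [x] xs" by (rule cross_mset) auto
        ultimately show ?thesis
          using psi by (metis invprod.simps(2) mult.commute)
      qed
    qed (use f g in simp)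
  qed
qed

text \<open>For row sums, whose exchange relation is established for distinct indices only: there
  the coefficient passes the preceding generators unchanged.\<close>

lemma (in Ring.ring) sort_coefficient_distinct:
  fixes E :: "'j::linorder list \<Rightarrow> 'a" and \<psi> :: "'f::comm_monoid_mult \<Rightarrow> 'a"
  assumes E_closed: "\<And>xs. E xs \<in> carrier R"
    and psi: "\<And>f. \<psi> f \<in> carrier R" "\<And>f g. \<psi> (f * g) = \<psi> f \<otimes> \<psi> g" "\<psi> 1 = \<one>"
    and d: "\<And>x y. x < y \<Longrightarrow> d x y = 1"
    and swap: "\<And>us x y vs. y < x \<Longrightarrow> length us + 2 + length vs = length xs \<Longrightarrow>
        distinct (us @ x # y # vs) \<Longrightarrow> E (us @ x # y # vs) = \<psi> (d x y) \<otimes> E (us @ y # x # vs)"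
    and "distinct xs"
  shows "E xs = \<psi> (invprod d xs) \<otimes> E (sort xs)"
proof -
  text \<open>Off the distinct lists the values of \<open>E\<close> play no role.\<close>
  define E' where "E' ys = (if distinct ys then E ys else \<zero>)" for ys
  have "\<exists>f\<in>carrier R. E' ([] @ xs @ []) = f \<otimes> E' ([] @ sort xs @ []) \<and>
          (distinct ([] @ xs @ []) \<longrightarrow> f = \<psi> (invprod d xs))"
  proof (rule sort_coefficient[where N = "length xs"])
    fix us vs :: "'j list" and x y :: 'j assume *: "y < x" "length us + 2 + length vs = length xs"
    show "\<exists>f\<in>carrier R. E' (us @ x # y # vs) = f \<otimes> E' (us @ y # x # vs) \<and>
          (distinct (us @ x # y # vs) \<longrightarrow> f = \<psi> (d x y))"
      using swap[OF *] psi by (intro bexI[of _ "\<psi> (d x y)"]) (auto simp: E'_def)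
  qed (simp_all add: E'_def E_closed psi d)
  then show ?thesis using \<open>distinct xs\<close> by (auto simp: E'_def)
qed

section \<open>Minors as alternating sums over rows and over columns\<close>

text \<open>
  On lists of indices $p$, $S$ is the product of \<open>inv_weight\<close> over $p$ and $\widetilde S$ is the
  product of \<open>asc_weight\<close> over the reversed list, the order in which the blocks occur in
  the hyper-Pfaffian.
\<close>

definition inv_weight :: "complex \<Rightarrow> 'N::{finite,linorder} \<Rightarrow> 'N \<Rightarrow> 'N mero" where
  "inv_weight q a b = (if b < a then - dyn_h q a b else 1)"

definition asc_weight :: "complex \<Rightarrow> 'N::{finite,linorder} \<Rightarrow> 'N \<Rightarrow> 'N mero" where
  "asc_weight q a b = (if a < b then - dyn_h q a b else 1)"

text \<open>Equal to (-1)^(r(r-1)/2) [r]_q!, a signed quantum factorial.\<close>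

definition h_perm_const :: "complex \<Rightarrow> nat \<Rightarrow> complex" where
  "h_perm_const q r = (\<Prod>i<r. (- 1) ^ i * h_sum_const q (Suc i))"

text \<open>Split by the first entry a. Its weights against the other entries do not depend on their
  order, and by induction the sum over these orders is a scalar independent of a; the remaining sum
  over a is \<open>sum_prod_dyn_h\<close>.\<close>

lemma sum_permutations_dyn_h:
  fixes K :: "'N::{finite,linorder} set"
  assumes "q \<noteq> 0" "\<And>k. k \<ge> 1 \<Longrightarrow> q ^ k \<noteq> 1"
  shows "(\<Sum>w\<in>permutations_of_set K. invprod (\<lambda>a b. - dyn_h q a b) w) = mero_const (h_perm_const q (card K))"
proof (induction "card K" arbitrary: K)
  case 0
  then have "K = {}" by simp
  then show ?case by (simp add: h_perm_const_def mero_const_1)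
next
  case (Suc r)
  let ?c = "\<lambda>a b. - dyn_h q a b"
  have ne: "K \<noteq> {}" using Suc(2) by auto
  have "(\<Sum>w\<in>permutations_of_set K. invprod ?c w) =
      (\<Sum>a\<in>K. \<Sum>w\<in>(#) a ` permutations_of_set (K - {a}). invprod ?c w)"
    unfolding permutations_of_set_nonempty[OF ne] by (rule sum.UNION_disjoint) auto
  also have "\<dots> = (\<Sum>a\<in>K. \<Sum>w\<in>permutations_of_set (K - {a}). invprod ?c (a # w))"
    by (simp add: sum.reindex)
  also have "\<dots> = (\<Sum>a\<in>K. (\<Prod>b\<in>K - {a}. ?c a b) * mero_const (h_perm_const q r))"
  proof (rule sum.cong[OF refl])
    fix a assume "a \<in> K"
    then have card: "card (K - {a}) = r" using Suc(2) by simp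
    have "cross ?c [a] w = (\<Prod>b\<in>K - {a}. ?c a b)" if "w \<in> permutations_of_set (K - {a})" for w
      using that prod.distinct_set_conv_list[of w "?c a"] by (simp add: permutations_of_set_def)
    then have "(\<Sum>w\<in>permutations_of_set (K - {a}). invprod ?c (a # w)) =
        (\<Sum>w\<in>permutations_of_set (K - {a}). (\<Prod>b\<in>K - {a}. ?c a b) * invprod ?c w)"
      by (intro sum.cong) auto
    then show "(\<Sum>w\<in>permutations_of_set (K - {a}). invprod ?c (a # w)) =
        (\<Prod>b\<in>K - {a}. ?c a b) * mero_const (h_perm_const q r)"
      using Suc(1)[of "K - {a}"] card by (simp flip: sum_distrib_left)
  qed
  also have "\<dots> = (\<Sum>a\<in>K. (- 1) ^ r * (\<Prod>b\<in>K - {a}. dyn_h q a b)) * mero_const (h_perm_const q r)"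
  proof -
    have "(\<Prod>b\<in>K - {a}. ?c a b) = (- 1) ^ r * (\<Prod>b\<in>K - {a}. dyn_h q a b)" if "a \<in> K" for a
    proof -
      have "card (K - {a}) = r" using Suc(2) that by simp
      then show ?thesis by (simp add: prod_uminus)
    qed
    then show ?thesis by (simp add: sum_distrib_right)
  qed
  also have "\<dots> = (- 1) ^ r * mero_const (h_sum_const q (Suc r)) * mero_const (h_perm_const q r)"
    using sum_prod_dyn_h[OF assms, of K] Suc(2) by (simp flip: sum_distrib_left)
  also have "(- 1) ^ r = mero_const ((- 1) ^ r)"
    by (induction r) (simp_all add: mero_const_1 mero_const_uminus)
  finally show ?case
    using Suc(2)[symmetric] by (simp add: mero_const_mult h_perm_const_def mult_ac)
qed

lemma h_perm_const_nonzero: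
  assumes "q \<noteq> 0" "\<And>k. k \<ge> 1 \<Longrightarrow> q ^ k \<noteq> 1"
  shows "h_perm_const q r \<noteq> 0"
  using h_sum_const_nonzero[OF assms] by (simp add: h_perm_const_def)

abbreviation asc_list :: "'a::linorder set \<Rightarrow> 'a list" where "asc_list \<equiv> sorted_list_of_set"
abbreviation desc_list :: "'a::linorder set \<Rightarrow> 'a list" where "desc_list I \<equiv> rev (sorted_list_of_set I)"

lemma sort_permutation: "w \<in> permutations_of_set K \<Longrightarrow> sort w = asc_list K"
  by (auto simp: permutations_of_set_def sorted_list_of_set_sort_remdups distinct_remdups_id)

text \<open>The relations from which the argument is drawn, in an abstract ring.
  \<open>const\<close> identifies the scalars of the two copies of the function algebra, so that a
  constant found on the \<lambda> side can be compared with one found on the \<mu> side.\<close>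

locale dyn_matrix_algebra = Ring.ring R for R (structure) +
  fixes q :: complex and l r :: "'N::{finite,linorder} mero \<Rightarrow> 'a" and t :: "'N \<Rightarrow> 'N \<Rightarrow> 'a"
  assumes q_generic: "q \<noteq> 0" "\<And>k. k \<ge> 1 \<Longrightarrow> q ^ k \<noteq> 1"
    and closed [simp]: "l f \<in> carrier R" "r f \<in> carrier R" "t i j \<in> carrier R"
    and l_add: "l (f + g) = l f \<oplus> l g" and r_add: "r (f + g) = r f \<oplus> r g"
    and l_mult: "l (f * g) = l f \<otimes> l g" and r_mult: "r (f * g) = r f \<otimes> r g"
    and l_one: "l 1 = \<one>" and const: "l (mero_const z) = r (mero_const z)"
    and l_r: "l f \<otimes> r g = r g \<otimes> l f"
    and l_t: "l f \<otimes> t i j = t i j \<otimes> l (mero_shift i f)"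
    and r_t: "r f \<otimes> t i j = t i j \<otimes> r (mero_shift j f)"
    and same_row: "k < k' \<Longrightarrow> r (dyn_h q k k') \<otimes> (t i k \<otimes> t i k') = t i k' \<otimes> t i k"
    and cross_rel: "i < j \<Longrightarrow> k < k' \<Longrightarrow> t i k \<otimes> t j k' =
      t j k' \<otimes> t i k \<oplus> (l (dyn_h q j i) \<otimes> (t j k \<otimes> t i k') \<ominus> r (dyn_h q k k') \<otimes> (t j k \<otimes> t i k'))"
    and exch_rel: "i < j \<Longrightarrow> k < k' \<Longrightarrow> t i k' \<otimes> t j k =
      l (dyn_g q i j) \<otimes> (t j k \<otimes> t i k') \<oplus>
        (r (dyn_h q k k') \<otimes> (t i k \<otimes> t j k') \<ominus> l (dyn_h q i j) \<otimes> (t i k \<otimes> t j k'))"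
begin

lemma r_one: "r 1 = \<one>"
  using const[of 1] l_one by (simp add: mero_const_1)

lemma l_zero: "l 0 = \<zero>" and r_zero: "r 0 = \<zero>"
  using l_add[of 0 0] r_add[of 0 0] by (simp_all add: add.l_cancel_one')

lemma l_uminus: "l (- f) = \<ominus> l f" and r_uminus: "r (- f) = \<ominus> r f"
  using l_add[of "- f" f] r_add[of "- f" f] l_zero r_zero by (simp_all add: minus_equality)

lemma l_sum: "finite S \<Longrightarrow> l (sum f S) = (\<Oplus>x\<in>S. l (f x))"
  by (induction S rule: finite_induct) (simp_all add: l_zero l_add Pi_def)

lemma r_sum: "finite S \<Longrightarrow> r (sum f S) = (\<Oplus>x\<in>S. r (f x))"
  by (induction S rule: finite_induct) (simp_all add: r_zero r_add Pi_def)

lemma h_add_swap: "i \<noteq> j \<Longrightarrow> k \<noteq> k' \<Longrightarrow>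
    l (dyn_h q i j) \<oplus> l (dyn_h q j i) = r (dyn_h q k k') \<oplus> r (dyn_h q k' k)"
  using dyn_h_add_swap[OF q_generic] const by (metis l_add r_add)

text \<open>The ring identity behind \<open>rows_local\<close>. Here p, p' stand for h(\<lambda>_i -
  \<lambda>_j), h(\<lambda>_j - \<lambda>_i); s, s' for h(\<mu>_k - \<mu>_k'), h(\<mu>_k' -
  \<mu>_k); and A, B, C, D for t_ik t_jk', t_jk t_ik', t_jk' t_ik, t_ik' t_jk. Once C and D are
  eliminated, A has coefficient s - p - p' = -s' and p' B has coefficient p + p' - s = s'.\<close>

lemma scalar_rows:
  assumes "p \<in> carrier R" "p' \<in> carrier R" "s \<in> carrier R" "s' \<in> carrier R"
    "A \<in> carrier R" "B \<in> carrier R" "C \<in> carrier R" "D \<in> carrier R"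
    and s: "p \<oplus> p' = s \<oplus> s'" and comm: "s \<otimes> p' = p' \<otimes> s"
    and A: "A = C \<oplus> (p' \<otimes> B \<ominus> s \<otimes> B)" and D: "D = p \<otimes> p' \<otimes> B \<oplus> (s \<otimes> A \<ominus> p \<otimes> A)"
  shows "D \<oplus> (\<ominus> p') \<otimes> C = (\<ominus> s') \<otimes> (A \<oplus> (\<ominus> p') \<otimes> B)"
proof -
  note [simp] = assms(1-8)
  have s': "s' = p \<oplus> p' \<ominus> s"
    unfolding s by (simp add: minus_eq a_assoc a_comm[of s s'] r_neg)
  have C: "C = A \<ominus> (p' \<otimes> B \<ominus> s \<otimes> B)"
    unfolding A by (simp add: minus_eq a_assoc r_neg)
  \<comment> \<open>Naming the products leaves a purely additive identity between atoms.\<close>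
  define x1 x2 x3 x4 x5 x6 where x: "x1 = p \<otimes> (p' \<otimes> B)" "x2 = s \<otimes> A" "x3 = p \<otimes> A" "x4 = p' \<otimes> A"
    "x5 = p' \<otimes> (p' \<otimes> B)" "x6 = p' \<otimes> (s \<otimes> B)"
  have [simp]: "x1 \<in> carrier R" "x2 \<in> carrier R" "x3 \<in> carrier R" "x4 \<in> carrier R"
    "x5 \<in> carrier R" "x6 \<in> carrier R"
    by (simp_all add: x)
  have x6: "s \<otimes> (p' \<otimes> B) = x6" unfolding x using comm by (simp flip: m_assoc)
  have "D \<oplus> (\<ominus> p') \<otimes> C = (x1 \<oplus> (x2 \<ominus> x3)) \<oplus> (\<ominus> (x4 \<ominus> (x5 \<ominus> x6)))"
    unfolding C D by (simp add: x m_assoc l_minus r_minus minus_eq r_distr minus_add)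
  also have "\<dots> = \<ominus> (x3 \<oplus> x4 \<ominus> x2) \<oplus> (x1 \<oplus> x5 \<ominus> x6)"
    by (simp add: minus_eq minus_add a_ac)
  also have "\<dots> = (\<ominus> s') \<otimes> (A \<oplus> (\<ominus> p') \<otimes> B)"
    unfolding s' using x6 by (simp add: x(1-5) m_assoc l_minus r_minus minus_eq r_distr l_distr minus_add a_ac)
  finally show ?thesis .
qed

text \<open>With the letters of \<open>scalar_rows\<close>: inserting D removes the term s A, and
  inserting A into p A removes p p' B. What remains on both sides is p s B - p C.\<close>

lemma scalar_cols:
  assumes "p \<in> carrier R" "p' \<in> carrier R" "s \<in> carrier R"
    "A \<in> carrier R" "B \<in> carrier R" "C \<in> carrier R" "D \<in> carrier R"
    and A: "A = C \<oplus> (p' \<otimes> B \<ominus> s \<otimes> B)" and D: "D = p \<otimes> p' \<otimes> B \<oplus> (s \<otimes> A \<ominus> p \<otimes> A)"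
  shows "(\<ominus> s) \<otimes> A \<oplus> D = (\<ominus> p) \<otimes> ((\<ominus> s) \<otimes> B \<oplus> C)"
proof -
  note [simp] = assms(1-7)
  define x1 x2 x3 x4 where x: "x1 = p \<otimes> (p' \<otimes> B)" "x2 = s \<otimes> A" "x3 = p \<otimes> C" "x4 = p \<otimes> (s \<otimes> B)"
  have [simp]: "x1 \<in> carrier R" "x2 \<in> carrier R" "x3 \<in> carrier R" "x4 \<in> carrier R"
    by (simp_all add: x)
  have pA: "p \<otimes> A = x3 \<oplus> (x1 \<ominus> x4)"
    unfolding A by (simp add: x m_assoc l_minus r_minus minus_eq r_distr minus_add)
  have "(\<ominus> s) \<otimes> A \<oplus> D = (\<ominus> x2) \<oplus> (x1 \<oplus> (x2 \<ominus> (x3 \<oplus> (x1 \<ominus> x4))))"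
    unfolding D pA by (simp add: x(1,2) m_assoc l_minus)
  also have "\<dots> = (\<ominus> x2 \<oplus> x2) \<oplus> ((x1 \<oplus> \<ominus> x1) \<oplus> (\<ominus> x3 \<oplus> x4))"
    by (simp only: minus_eq minus_add minus_minus a_ac a_closed a_inv_closed \<open>x1 \<in> carrier R\<close>
        \<open>x2 \<in> carrier R\<close> \<open>x3 \<in> carrier R\<close> \<open>x4 \<in> carrier R\<close>)
  also have "\<dots> = \<ominus> x3 \<oplus> x4"
    by (simp add: l_neg r_neg)
  also have "\<dots> = (\<ominus> p) \<otimes> ((\<ominus> s) \<otimes> B \<oplus> C)"
    by (simp add: x m_assoc l_minus r_minus minus_eq r_distr minus_add a_ac)
  finally show ?thesis .
qed

lemma rows_local:
  assumes "i < j" "k < k'"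
  shows "l (inv_weight q i j) \<otimes> (t i k' \<otimes> t j k) \<oplus> l (inv_weight q j i) \<otimes> (t j k' \<otimes> t i k) =
    r (inv_weight q k' k) \<otimes> (l (inv_weight q i j) \<otimes> (t i k \<otimes> t j k') \<oplus> l (inv_weight q j i) \<otimes> (t j k \<otimes> t i k'))"
  using assms
    scalar_rows[OF _ _ _ _ _ _ _ _ h_add_swap l_r[symmetric] cross_rel exch_rel[unfolded dyn_g_def l_mult],
      of i j k k'] 
  by (auto simp: inv_weight_def l_one l_uminus r_uminus dest: less_asym)

lemma cols_local:
  assumes "i < j" "k < k'"
  shows "r (asc_weight q k k') \<otimes> (t i k \<otimes> t j k') \<oplus> r (asc_weight q k' k) \<otimes> (t i k' \<otimes> t j k) =
    l (asc_weight q i j) \<otimes> (r (asc_weight q k k') \<otimes> (t j k \<otimes> t i k') \<oplus> r (asc_weight q k' k) \<otimes> (t j k' \<otimes> t i k))"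
  using assms scalar_cols[OF _ _ _ _ _ _ _ cross_rel exch_rel[unfolded dyn_g_def l_mult], of i j k k']
  by (auto simp: asc_weight_def r_one l_uminus r_uminus dest: less_asym)

lemma cols_local_same:
  assumes "k < k'"
  shows "r (asc_weight q k k') \<otimes> (t i k \<otimes> t i k') \<oplus> r (asc_weight q k' k) \<otimes> (t i k' \<otimes> t i k) = \<zero>"
  using assms same_row[OF assms, of i]
  by (auto simp: asc_weight_def r_one r_uminus l_minus l_neg dest: less_asym)

lemma mero_shift_weight:
  assumes "p \<noteq> a" "p \<noteq> b"
  shows "mero_shift p (inv_weight q a b) = inv_weight q a b" "mero_shift p (asc_weight q a b) = asc_weight q a b"
  using assms mero_shift_const[of p 1]
  by (simp_all add: inv_weight_def asc_weight_def mero_shift_uminus mero_shift_dyn_h mero_const_1)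

sublocale rows: antisymmetrizer R l "inv_weight q" t
  by unfold_locales (simp_all add: l_mult l_one l_t mero_shift_weight)

text \<open>The arguments of t are exchanged, so that the permuted index is again the first
  one.\<close>

sublocale cols: antisymmetrizer R r "asc_weight q" "\<lambda>p x. t x p"
  by unfold_locales (simp_all add: r_mult r_one r_t mero_shift_weight)

lemma cols_W: "cols.W ps xs = rows.W xs ps"
  unfolding rows.W_def cols.W_def by (subst zip_commute) (simp add: case_prod_unfold comp_def)

lemma r_rows_W:
  assumes "a \<notin> set xs" "b \<notin> set xs"
  shows "rows.W ps xs \<otimes> r (inv_weight q a b) = r (inv_weight q a b) \<otimes> rows.W ps xs"
  unfolding rows.W_def
proof (rule ordered_prod_commute[symmetric])
  fix z assume "z \<in> set (map2 t ps xs)"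
  then obtain p x where z: "z = t p x" and "x \<in> set xs" by (auto dest: set_zip_rightD)
  then have "x \<noteq> a" "x \<noteq> b" using assms by auto
  then show "r (inv_weight q a b) \<otimes> z = z \<otimes> r (inv_weight q a b)" unfolding z by (simp add: r_t mero_shift_weight)
qed auto

lemma l_rows_W:
  assumes "a \<notin> set ps" "b \<notin> set ps"
  shows "rows.W ps xs \<otimes> l (asc_weight q a b) = l (asc_weight q a b) \<otimes> rows.W ps xs"
  unfolding rows.W_def
proof (rule ordered_prod_commute[symmetric])
  fix z assume "z \<in> set (map2 t ps xs)"
  then obtain p x where z: "z = t p x" and "p \<in> set ps" by (auto dest: set_zip_leftD)
  then have "p \<noteq> a" "p \<noteq> b" using assms by auto
  then show "l (asc_weight q a b) \<otimes> z = z \<otimes> l (asc_weight q a b)" unfolding z by (simp add: l_t mero_shift_weight)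
qed auto

text \<open>Each generator shifts the function according to its row index. The resulting g depends
  on the rows ps and not on the columns xs, so one and the same factor can be taken out of all terms
  of a column sum.\<close>

lemma l_rows_W_ex: "\<exists>g. \<forall>xs. length xs = length ps \<longrightarrow> rows.W ps xs \<otimes> l f = l g \<otimes> rows.W ps xs"
proof (induction ps)
  case Nil
  then show ?case by (auto simp: rows.W_def)
next
  case (Cons p ps)
  then obtain g where g: "\<forall>xs. length xs = length ps \<longrightarrow> rows.W ps xs \<otimes> l f = l g \<otimes> rows.W ps xs" by blast
  obtain g' where g': "mero_shift p g' = g" using mero_shift_surj by blast
  have "rows.W (p # ps) (x # xs) \<otimes> l f = l g' \<otimes> rows.W (p # ps) (x # xs)" if "length xs = length ps" for x xs
  proof -
    have "rows.W (p # ps) (x # xs) \<otimes> l f = (t p x \<otimes> l g) \<otimes> rows.W ps xs"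
      unfolding rows.W_Cons using g that by (simp add: m_assoc)
    also have "t p x \<otimes> l g = l g' \<otimes> t p x" using l_t[of g' p x] g' by simp
    finally show ?thesis unfolding rows.W_Cons by (simp add: m_assoc)
  qed
  then show ?case by (intro exI[of _ g']) (auto simp: length_Suc_conv)
qed

lemma rows_swap:
  assumes "y < x" "length us + 2 + length vs = card I" "distinct (us @ x # y # vs)"
  shows "rows.altsum I (us @ x # y # vs) = r (inv_weight q x y) \<otimes> rows.altsum I (us @ y # x # vs)"
proof (rule rows.altsum_swap[OF _ assms(2), of "r (inv_weight q x y)"])
  show "rows.W ps us \<otimes> r (inv_weight q x y) = r (inv_weight q x y) \<otimes> rows.W ps us" for ps
    using assms(3) by (intro r_rows_W) auto
qed (simp_all add: rows_local[OF _ assms(1)] l_r)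

text \<open>The local relation produces its \<lambda>-weight behind the generators with rows us. For
  distinct rows the weight passes them unchanged; otherwise \<open>l_rows_W_ex\<close> replaces it
  by some other function. Decreasing order of the rows is the normal form, hence y before x on the
  left although y < x.\<close>

lemma cols_swap_ex:
  assumes "y < x" "length us + 2 + length vs = card J"
  shows "\<exists>f\<in>carrier R. cols.altsum J (us @ y # x # vs) = f \<otimes> cols.altsum J (us @ x # y # vs) \<and>
    (distinct (us @ x # y # vs) \<longrightarrow> f = l (asc_weight q y x))"
proof -
  have *: "\<exists>g. \<forall>ps. length ps = length us \<longrightarrow> rows.W us ps \<otimes> l (asc_weight q y x) = l g \<otimes> rows.W us ps"
    by (rule l_rows_W_ex)
  obtain g where g: "\<And>ps. length ps = length us \<Longrightarrow> rows.W us ps \<otimes> l (asc_weight q y x) = l g \<otimes> rows.W us ps"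
    and d: "distinct (us @ x # y # vs) \<Longrightarrow> g = asc_weight q y x"
  proof (cases "distinct (us @ x # y # vs)")
    case True
    then have "rows.W us ps \<otimes> l (asc_weight q y x) = l (asc_weight q y x) \<otimes> rows.W us ps" for ps
      by (intro l_rows_W) auto
    then show ?thesis using that by blast
  qed (use * that in blast)
  have "cols.altsum J (us @ y # x # vs) = l g \<otimes> cols.altsum J (us @ x # y # vs)"
    by (rule cols.altsum_swap[OF _ assms(2), of "l (asc_weight q y x)"])
      (simp_all add: cols_local[OF assms(1)] cols_W g l_r)
  then show ?thesis using d by auto
qed

lemma rows_sort:
  assumes "distinct ys" "length ys = card I"
  shows "rows.altsum I ys = r (invprod (inv_weight q) ys) \<otimes> rows.altsum I (sort ys)"
proof (rule sort_coefficient_distinct[OF _ _ _ _ _ _ assms(1)])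
  show "inv_weight q x y = 1" if "x < y" for x y using that by (auto simp: inv_weight_def dest: less_asym)
qed (use assms(2) rows_swap in \<open>simp_all add: r_mult r_one\<close>)

text \<open>Sorting into decreasing order is increasing sorting of the reversed list, with the two
  arguments of the weight exchanged.\<close>

lemma cols_sort_ex:
  assumes "length xs = card J"
  shows "\<exists>f\<in>carrier R. cols.altsum J xs = f \<otimes> cols.altsum J (rev (sort xs)) \<and>
    (distinct xs \<longrightarrow> f = l (invprod (asc_weight q) xs))"
proof -
  let ?E = "\<lambda>xs. cols.altsum J (rev xs)" and ?d = "\<lambda>a b. asc_weight q b a"
  have "\<exists>f\<in>carrier R. ?E ([] @ rev xs @ []) = f \<otimes> ?E ([] @ sort (rev xs) @ []) \<and>
      (distinct ([] @ rev xs @ []) \<longrightarrow> f = l (invprod ?d (rev xs)))"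
  proof (rule sort_coefficient[where N = "card J"])
    fix us vs :: "'N list" and x y :: 'N
    assume *: "y < x" "length us + 2 + length vs = card J"
    then have len: "length (rev vs) + 2 + length (rev us) = card J" by simp
    have "distinct (rev vs @ x # y # rev us) = distinct (us @ x # y # vs)" by auto
    then show "\<exists>f\<in>carrier R. ?E (us @ x # y # vs) = f \<otimes> ?E (us @ y # x # vs) \<and>
        (distinct (us @ x # y # vs) \<longrightarrow> f = l (?d x y))"
      using cols_swap_ex[OF *(1) len] by simp
  next
    show "?d x y = 1" if "x < y" for x y :: 'N
      using that by (auto simp: asc_weight_def dest: less_asym)
  qed (use assms in \<open>simp_all add: l_mult l_one\<close>)
  moreover have "sort (rev xs) = sort xs" by (rule properties_for_sort) auto
  ultimately show ?thesis using invprod_rev[of ?d xs] by simp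
qed

lemma cols_sort:
  assumes "distinct xs" "length xs = card J"
  shows "cols.altsum J xs = l (invprod (asc_weight q) xs) \<otimes> cols.altsum J (rev (sort xs))"
  using cols_sort_ex[OF assms(2)] assms(1) by auto

lemma cols_same:
  assumes "length us + 2 + length vs = card J"
  shows "cols.altsum J (us @ x # x # vs) = \<zero>"
proof -
  have "cols.altsum J (us @ x # x # vs) = \<zero> \<otimes> cols.altsum J (us @ x # x # vs)"
    by (rule cols.altsum_swap[OF _ assms, of "\<zero>"]) (simp_all add: cols_local_same)
  then show ?thesis by simp
qed

text \<open>Sorting brings two equal rows next to each other, where \<open>cols_same\<close> gives
  zero; the original sum is a left multiple of this.\<close>

lemma cols_nondistinct:
  assumes "\<not> distinct xs" "length xs = card J"
  shows "cols.altsum J xs = \<zero>"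
proof -
  have "\<not> distinct (sort xs)" using assms(1) by simp
  then obtain as bs cs y where s: "sort xs = as @ [y] @ bs @ [y] @ cs"
    by (metis not_distinct_decomp)
  have "sorted (as @ [y] @ bs @ [y] @ cs)" using sorted_sort[of xs] s by simp
  then have "z = y" if "z \<in> set bs" for z
    using that by (auto simp: sorted_append intro: order.antisym)
  then obtain bs' where bs': "bs @ [y] = y # bs'"
    by (cases bs) auto
  have len: "length (rev (bs' @ cs)) + 2 + length (rev as) = card J"
    using assms(2) arg_cong[OF s, of length] arg_cong[OF bs', of length] by simp
  have "rev (sort xs) = rev (bs' @ cs) @ y # y # rev as"
    unfolding s using arg_cong[OF bs', of rev] by simp
  then have "cols.altsum J (rev (sort xs)) = \<zero>"
    using cols_same[OF len] by simp
  then show ?thesis using cols_sort_ex[OF assms(2)] by auto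
qed

theorem rows_eq_cols:
  assumes "card I = card J"
  shows "rows.altsum I (asc_list J) = cols.altsum J (desc_list I)"
proof -
  let ?A = "rows.altsum I (asc_list J)" and ?D = "cols.altsum J (desc_list I)"
  let ?PI = "permutations_of_set I" and ?PJ = "permutations_of_set J"
  let ?h = "\<lambda>a b. - dyn_h q a b"
  \<comment> \<open>For two different indices exactly one of the two weights is -h and the other is
    1. Together they cover every pair, which is what makes the sum over all orderings
    computable.\<close>
  have inv: "invprod (inv_weight q) w * invprod (asc_weight q) w = invprod ?h w" if "w \<in> permutations_of_set K" for w K
  proof -
    have "invprod (\<lambda>a b. inv_weight q a b * asc_weight q a b) w = invprod ?h w"
      using that by (intro invprod_cong) (auto simp: inv_weight_def asc_weight_def permutations_of_set_def)
    then show ?thesis by (simp add: invprod_mult)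
  qed
  have len: "length w = card K" if "w \<in> permutations_of_set K" for w :: "'N list" and K
    using that by (auto simp: permutations_of_set_def distinct_card)
  have dis: "distinct w" if "w \<in> permutations_of_set K" for w :: "'N list" and K
    using that by (auto simp: permutations_of_set_def)
  \<comment> \<open>The summand of the double sum, with a coefficient for the order of the columns
    and one for the order of the rows. As these commute, either of them can be taken out of the
    inner sum.\<close>
  define X where "X w p = r (invprod (asc_weight q) w) \<otimes> (l (invprod (inv_weight q) p) \<otimes> rows.W p w)" for w p
  have Xc [simp]: "X w p \<in> carrier R" for w p by (simp add: X_def)
  have 1: "(\<Oplus>p\<in>?PI. X w p) = r (invprod ?h w) \<otimes> ?A" if "w \<in> ?PJ" for w
  proof -
    have "(\<Oplus>p\<in>?PI. X w p) = r (invprod (asc_weight q) w) \<otimes> rows.altsum I w"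
      unfolding X_def rows.altsum_def by (intro finsum_rdistr[symmetric]) auto
    also have "rows.altsum I w = r (invprod (inv_weight q) w) \<otimes> ?A"
      using rows_sort[OF dis[OF that]] len[OF that] assms sort_permutation[OF that] by simp
    finally show ?thesis
      using inv[OF that] by (simp add: r_mult[symmetric] mult.commute flip: m_assoc)
  qed
  have 2: "(\<Oplus>w\<in>?PJ. X w p) = l (invprod ?h p) \<otimes> ?D" if "p \<in> ?PI" for p
  proof -
    have "X w p = l (invprod (inv_weight q) p) \<otimes> (r (invprod (asc_weight q) w) \<otimes> cols.W w p)" for w
      unfolding X_def cols_W by (simp add: l_r flip: m_assoc)
    then have "(\<Oplus>w\<in>?PJ. X w p) = l (invprod (inv_weight q) p) \<otimes> cols.altsum J p"
      unfolding cols.altsum_def by (simp add: finsum_rdistr)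
    also have "cols.altsum J p = l (invprod (asc_weight q) p) \<otimes> ?D"
      using cols_sort[OF dis[OF that]] len[OF that] assms sort_permutation[OF that] by simp
    finally show ?thesis
      using inv[OF that] by (simp add: l_mult[symmetric] flip: m_assoc)
  qed
  have "r (mero_const (h_perm_const q (card J))) \<otimes> ?A = (\<Oplus>w\<in>?PJ. r (invprod ?h w)) \<otimes> ?A"
    using sum_permutations_dyn_h[OF q_generic, of J] by (simp flip: r_sum)
  also have "\<dots> = (\<Oplus>w\<in>?PJ. r (invprod ?h w) \<otimes> ?A)"
    by (intro finsum_ldistr) auto
  also have "\<dots> = (\<Oplus>w\<in>?PJ. \<Oplus>p\<in>?PI. X w p)"
    using 1 by (intro finsum_cong') auto
  also have "\<dots> = (\<Oplus>p\<in>?PI. \<Oplus>w\<in>?PJ. X w p)"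
    by (intro finsum_swap) auto
  also have "\<dots> = (\<Oplus>p\<in>?PI. l (invprod ?h p) \<otimes> ?D)"
    using 2 by (intro finsum_cong') auto
  also have "\<dots> = (\<Oplus>p\<in>?PI. l (invprod ?h p)) \<otimes> ?D"
    by (intro finsum_ldistr[symmetric]) auto
  also have "\<dots> = l (mero_const (h_perm_const q (card I))) \<otimes> ?D"
    using sum_permutations_dyn_h[OF q_generic, of I] by (simp flip: l_sum)
  finally have eq: "r (mero_const (h_perm_const q (card J))) \<otimes> ?A = r (mero_const (h_perm_const q (card J))) \<otimes> ?D"
    using const assms by simp
  \<comment> \<open>Division by the scalar is multiplication by the image of its inverse in the
    field of complex numbers.\<close>
  let ?i = "r (mero_const (inverse (h_perm_const q (card J))))"
  have "?i \<otimes> r (mero_const (h_perm_const q (card J))) = \<one>"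
    using h_perm_const_nonzero[OF q_generic] by (simp add: r_mult[symmetric] mero_const_mult mero_const_1 r_one)
  then have "z = ?i \<otimes> (r (mero_const (h_perm_const q (card J))) \<otimes> z)" if "z \<in> carrier R" for z
    using that by (simp flip: m_assoc)
  with eq show ?thesis by (metis rows.altsum_closed cols.altsum_closed)
qed

end

section \<open>Laplace expansion\<close>

text \<open>The blocks stand in the order in which the Pfaffian multiplies them. With each block
  listed decreasingly, the concatenation is the one-line form of a block permutation read backwards.
  Its distinctness expresses that the blocks are disjoint; that they exhaust the index set follows
  by counting.\<close>

definition ordered_partitions :: "nat \<Rightarrow> nat \<Rightarrow> 'N::{finite,linorder} set list set" where
  "ordered_partitions m n =
     {Is. length Is = n \<and> (\<forall>I\<in>set Is. card I = m) \<and> distinct (concat (map desc_list Is))}"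

lemma finite_ordered_partitions: "finite (ordered_partitions m n :: 'N::{finite,linorder} set list set)"
  by (rule finite_subset[OF _ finite_lists_length_eq[of "UNIV :: 'N set set" n]])
    (auto simp: ordered_partitions_def)

lemma length_concat_const: "(\<And>x. x \<in> set xs \<Longrightarrow> length x = m) \<Longrightarrow> length (concat xs) = m * length xs"
  by (induction xs) auto

lemma ordered_partitions_perm:
  fixes Is :: "'N::{finite,linorder} set list"
  assumes "CARD('N) = m * n" "Is \<in> ordered_partitions m n"
  shows "concat (map desc_list Is) \<in> permutations_of_set UNIV"
proof -
  have d: "distinct (concat (map desc_list Is))" using assms(2) by (simp add: ordered_partitions_def)
  have "length (concat (map desc_list Is)) = m * length (map desc_list Is)"
    using assms(2) by (intro length_concat_const) (auto simp: ordered_partitions_def)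
  then have "card (set (concat (map desc_list Is))) = CARD('N)"
    using assms d by (simp only: distinct_card) (simp add: ordered_partitions_def)
  then have "set (concat (map desc_list Is)) = UNIV" by (intro card_eq_UNIV_imp_eq_UNIV) auto
  with d show ?thesis by (simp only: permutations_of_set_def mem_Collect_eq)
qed

lemma mset_concat_parts:
  assumes "list_all2 (\<lambda>p I. p \<in> permutations_of_set I) ps Is"
  shows "mset (concat ps) = mset (concat (map desc_list Is))"
  using assms
proof (induction rule: list_all2_induct)
  case (Cons p ps I Is)
  have "mset p = mset (desc_list I)"
    using Cons(1) by (metis mset_rev mset_sort sort_permutation)
  with Cons show ?case by simp
qed simp

text \<open>Weights between different blocks depend only on the blocks as sets, and decreasing lists
  have weight 1. So the weight of the decreasingly listed blocks is exactly the part coming from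
  pairs in different blocks.\<close>

lemma invprod_concat_parts:
  assumes "list_all2 (\<lambda>p I. p \<in> permutations_of_set I) ps Is"
  shows "invprod (asc_weight q) (concat ps) = invprod (asc_weight q) (concat (map desc_list Is)) * (\<Prod>p\<leftarrow>ps. invprod (asc_weight q) p)"
  using assms
proof (induction rule: list_all2_induct)
  case (Cons p ps I Is)
  have "mset p = mset (desc_list I)"
    using Cons(1) by (metis mset_rev mset_sort sort_permutation)
  then have "cross (asc_weight q) p (concat ps) = cross (asc_weight q) (desc_list I) (concat (map desc_list Is))"
    using mset_concat_parts[OF Cons(2)] by (rule cross_mset)
  moreover have "invprod (asc_weight q) (desc_list I) = 1"
    unfolding invprod_rev by (rule invprod_sorted) (auto simp: asc_weight_def dest: less_asym)
  ultimately show ?case using Cons(3) by (simp add: invprod_append mult_ac)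
qed simp

lemma concat_chunks:
  "length w = m * n \<Longrightarrow> concat (map (\<lambda>k. take m (drop (k * m) w)) [0..<n]) = w"
proof (induction n arbitrary: w)
  case (Suc n)
  have "concat (map (\<lambda>k. take m (drop (k * m) w)) [0..<Suc n]) =
      take m w @ concat (map (\<lambda>k. take m (drop (k * m) (drop m w))) [0..<n])"
    by (subst upt_conv_Cons) (simp_all add: map_Suc_upt[symmetric] comp_def add.commute del: upt_Suc)
  also have "\<dots> = take m w @ drop m w" using Suc.IH[of "drop m w"] Suc.prems by simp
  finally show ?case by simp
qed simp

context dyn_matrix_algebra
begin

definition xi :: "'N set \<Rightarrow> 'N set \<Rightarrow> 'a" where
  "xi I J = rows.altsum I (asc_list J)"

lemma xi_closed [simp]: "xi I J \<in> carrier R"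
  by (simp add: xi_def)

text \<open>The coefficient of a block involves its own columns only, and these do not occur in the
  blocks before it. It therefore passes their generators, and all coefficients collect on the
  left.\<close>

lemma prod_blocks:
  assumes "length Js = length ps" "\<forall>(J, p)\<in>set (zip Js ps). length p = card J" "distinct (concat ps)"
  shows "ordered_prod R (map2 (\<lambda>J p. r (invprod (asc_weight q) p) \<otimes> cols.W p (desc_list J)) Js ps) =
    r (\<Prod>p\<leftarrow>ps. invprod (asc_weight q) p) \<otimes> cols.W (concat ps) (concat (map desc_list Js))"
  using assms
proof (induction Js ps rule: list_induct2)
  case Nil
  then show ?case by (simp add: cols.W_def r_one)
next
  case (Cons J Js p ps)
  let ?P = "r (\<Prod>p\<leftarrow>ps. invprod (asc_weight q) p)" and ?w = "cols.W p (desc_list J)"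
  have len: "length p = length (desc_list J)" using Cons.prems by simp
  have "r (invprod (asc_weight q) q') \<otimes> ?w = ?w \<otimes> r (invprod (asc_weight q) q')" if "q' \<in> set ps" for q'
    using that Cons.prems(2) by (intro cols.phi_invprod_W) auto
  then have c: "?P \<otimes> ?w = ?w \<otimes> ?P"
    by (intro cols.phi_prod_commute) auto
  have IH: "ordered_prod R (map2 (\<lambda>J p. r (invprod (asc_weight q) p) \<otimes> cols.W p (desc_list J)) Js ps) =
    ?P \<otimes> cols.W (concat ps) (concat (map desc_list Js))"
    using Cons by auto
  have "ordered_prod R (map2 (\<lambda>J p. r (invprod (asc_weight q) p) \<otimes> cols.W p (desc_list J)) (J # Js) (p # ps)) =
      r (invprod (asc_weight q) p) \<otimes> ((?w \<otimes> ?P) \<otimes> cols.W (concat ps) (concat (map desc_list Js)))"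
    using IH by (simp add: m_assoc)
  also have "\<dots> = (r (invprod (asc_weight q) p) \<otimes> ?P) \<otimes> (?w \<otimes> cols.W (concat ps) (concat (map desc_list Js)))"
    unfolding c[symmetric] by (simp add: m_assoc)
  also have "\<dots> = r (\<Prod>p\<leftarrow>p # ps. invprod (asc_weight q) p) \<otimes> cols.W (concat (p # ps)) (concat (map desc_list (J # Js)))"
    using cols.W_append[OF len, of "concat ps" "concat (map desc_list Js)"] by (simp add: r_mult)
  finally show ?case .
qed

text \<open>The coefficient of a partition supplies the weights between blocks, the column forms of
  the minors those inside the blocks. A partition together with an order of each block is the same
  as an order of all columns.\<close>

theorem laplace_expansion:
  assumes card: "CARD('N) = m * n" and Js: "length Js = n" "\<forall>J\<in>set Js. card J = m"
  shows "(\<Oplus>Is\<in>ordered_partitions m n. r (invprod (asc_weight q) (concat (map desc_list Is))) \<otimes> ordered_prod R (map2 xi Js Is)) =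
    cols.altsum UNIV (concat (map desc_list Js))"
proof -
  let ?OP = "ordered_partitions m n :: 'N set list set"
  define T where "T w = r (invprod (asc_weight q) w) \<otimes> cols.W w (concat (map desc_list Js))" for w
  have T [simp]: "T w \<in> carrier R" for w by (simp add: T_def)
  let ?L = "\<lambda>Is :: 'N set list. listset (map permutations_of_set Is)"
  have L: "ps \<in> ?L Is \<longleftrightarrow> list_all2 (\<lambda>p I. p \<in> permutations_of_set I) ps Is" for ps Is
    by (simp add: in_listset list_all2_map2)
  have finL: "finite (?L Is)" for Is by (intro finite_listset) auto
  have len: "\<forall>p\<in>set ps. length p = m" if Is: "Is \<in> ?OP" and ps: "ps \<in> ?L Is" for Is ps
  proof
    fix p assume "p \<in> set ps"
    then obtain i where "i < length Is" "p \<in> permutations_of_set (Is ! i)"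
      using ps unfolding L by (auto simp: list_all2_conv_all_nth in_set_conv_nth)
    moreover have "card (Is ! i) = m"
      using Is \<open>i < length Is\<close> by (simp add: ordered_partitions_def)
    ultimately show "length p = m" by (metis distinct_card permutations_of_setD)
  qed
  have dis: "distinct (concat ps)" if "Is \<in> ?OP" "ps \<in> ?L Is" for Is ps
    using mset_concat_parts[of ps Is] that unfolding L
    by (metis (mono_tags, lifting) mem_Collect_eq mset_eq_imp_distinct_iff ordered_partitions_def)
  have 1: "r (invprod (asc_weight q) (concat (map desc_list Is))) \<otimes> ordered_prod R (map2 xi Js Is) =
      (\<Oplus>ps\<in>?L Is. T (concat ps))" if Is: "Is \<in> ?OP" for Is
  proof -
    let ?z = "zip Js Is"
    have lI: "length Is = n" and cI: "\<forall>I\<in>set Is. card I = m" using Is by (auto simp: ordered_partitions_def)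
    \<comment> \<open>Here every minor passes to its column form; its rows then appear decreasingly,
      in agreement with the list of rows on the right-hand side of the claim.\<close>
    have "map2 xi Js Is = map (\<lambda>z. \<Oplus>p\<in>permutations_of_set (snd z). r (invprod (asc_weight q) p) \<otimes> cols.W p (desc_list (fst z))) ?z"
    proof (rule map_cong[OF refl])
      fix z assume "z \<in> set ?z"
      then obtain J I where z: "z = (J, I)" "J \<in> set Js" "I \<in> set Is"
        by (metis prod.exhaust set_zip_leftD set_zip_rightD)
      then show "(case z of (J, I) \<Rightarrow> xi J I) =
          (\<Oplus>p\<in>permutations_of_set (snd z). r (invprod (asc_weight q) p) \<otimes> cols.W p (desc_list (fst z)))"
        using rows_eq_cols[of J I] Js cI by (simp add: xi_def cols.altsum_def)
    qed
    then have "ordered_prod R (map2 xi Js Is) =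
        (\<Oplus>ps\<in>listset (map (\<lambda>z. permutations_of_set (snd z)) ?z).
          ordered_prod R (map2 (\<lambda>z p. r (invprod (asc_weight q) p) \<otimes> cols.W p (desc_list (fst z))) ?z ps))"
      by (simp only:) (rule ordered_prod_finsum; simp)
    also have "map (\<lambda>z. permutations_of_set (snd z)) ?z = map permutations_of_set Is"
      using Js lI by (simp add: map_snd_zip flip: map_map[of permutations_of_set snd, unfolded comp_def])
    also have "(\<Oplus>ps\<in>?L Is. ordered_prod R (map2 (\<lambda>z p. r (invprod (asc_weight q) p) \<otimes> cols.W p (desc_list (fst z))) ?z ps)) =
        (\<Oplus>ps\<in>?L Is. r (\<Prod>p\<leftarrow>ps. invprod (asc_weight q) p) \<otimes> cols.W (concat ps) (concat (map desc_list Js)))"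
    proof (rule finsum_cong'[OF refl])
      fix ps assume ps: "ps \<in> ?L Is"
      have lp: "length ps = n" using ps lI unfolding L by (simp add: list_all2_lengthD)
      have "map2 (\<lambda>z p. r (invprod (asc_weight q) p) \<otimes> cols.W p (desc_list (fst z))) ?z ps =
          map2 (\<lambda>J p. r (invprod (asc_weight q) p) \<otimes> cols.W p (desc_list J)) Js ps"
        using Js lI lp by (intro nth_equalityI) auto
      moreover have "\<forall>(J, p)\<in>set (zip Js ps). length p = card J"
        using len[OF Is ps] Js(2) by (metis (mono_tags, lifting) case_prodI2 set_zip_leftD set_zip_rightD)
      ultimately show "ordered_prod R (map2 (\<lambda>z p. r (invprod (asc_weight q) p) \<otimes> cols.W p (desc_list (fst z))) ?z ps) =
          r (\<Prod>p\<leftarrow>ps. invprod (asc_weight q) p) \<otimes> cols.W (concat ps) (concat (map desc_list Js))"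
        using prod_blocks[of Js ps] dis[OF Is ps] Js(1) lp by simp
    qed auto
    finally have "r (invprod (asc_weight q) (concat (map desc_list Is))) \<otimes> ordered_prod R (map2 xi Js Is) =
        (\<Oplus>ps\<in>?L Is. r (invprod (asc_weight q) (concat (map desc_list Is))) \<otimes>
          (r (\<Prod>p\<leftarrow>ps. invprod (asc_weight q) p) \<otimes> cols.W (concat ps) (concat (map desc_list Js))))"
      using finL by (simp add: finsum_rdistr Pi_def)
    also have "\<dots> = (\<Oplus>ps\<in>?L Is. T (concat ps))"
      by (intro finsum_cong') (auto simp: T_def L invprod_concat_parts r_mult m_assoc)
    finally show ?thesis .
  qed
  have "(\<Oplus>Is\<in>?OP. r (invprod (asc_weight q) (concat (map desc_list Is))) \<otimes> ordered_prod R (map2 xi Js Is)) =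
      (\<Oplus>Is\<in>?OP. \<Oplus>ps\<in>?L Is. T (concat ps))"
    using 1 by (intro finsum_cong') (auto intro!: finsum_closed)
  also have "\<dots> = finsum R (\<lambda>(Is, ps). T (concat ps)) (Sigma ?OP ?L)"
    using finite_ordered_partitions finL by (intro finsum_Sigma) auto
  also have "\<dots> = (\<Oplus>z\<in>Sigma ?OP ?L. T (concat (snd z)))"
    by (simp add: case_prod_unfold)
  also have "\<dots> = (\<Oplus>w\<in>permutations_of_set UNIV. T w)"
  proof (rule finsum_reindex_bij[symmetric])
    show "bij_betw (\<lambda>z. concat (snd z)) (Sigma ?OP ?L) (permutations_of_set UNIV)"
    proof (rule bij_betw_imageI)
      show "inj_on (\<lambda>z. concat (snd z)) (Sigma ?OP ?L)"
      proof (rule inj_onI, clarify)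
        fix Is ps Is' ps' assume *: "Is \<in> ?OP" "ps \<in> ?L Is" "Is' \<in> ?OP" "ps' \<in> ?L Is'"
          "concat (snd (Is, ps)) = concat (snd (Is', ps'))"
        have l: "length ps = n" "length ps' = n"
          using * unfolding L by (auto simp: ordered_partitions_def list_all2_lengthD)
        \<comment> \<open>All pieces have length m, so the concatenation determines them, and the
          blocks are their underlying sets.\<close>
        have "ps = ps'"
        proof (rule concat_injective)
          show "\<forall>(x, y)\<in>set (zip ps ps'). length x = length y"
            using len[OF *(1,2)] len[OF *(3,4)]
            by (metis (mono_tags, lifting) case_prodI2 set_zip_leftD set_zip_rightD)
        qed (use *(5) l in simp_all)
        moreover have "Is = map set ps" if "ps \<in> ?L Is" for Is ps
          using that unfolding L
          by (intro nth_equalityI) (auto simp: list_all2_conv_all_nth permutations_of_set_def)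
        ultimately show "Is = Is' \<and> ps = ps'" using * by metis
      qed
      show "(\<lambda>z. concat (snd z)) ` Sigma ?OP ?L = permutations_of_set UNIV"
      proof
        show "(\<lambda>z. concat (snd z)) ` Sigma ?OP ?L \<subseteq> permutations_of_set UNIV"
        proof clarify
          fix Is ps assume *: "Is \<in> ?OP" "ps \<in> ?L Is"
          have "mset (concat ps) = mset (concat (map desc_list Is))"
            using * unfolding L by (intro mset_concat_parts)
          moreover have "concat (map desc_list Is) \<in> permutations_of_set UNIV"
            using ordered_partitions_perm[OF card *(1)] .
          ultimately show "concat (snd (Is, ps)) \<in> permutations_of_set UNIV"
            unfolding permutations_of_set_def snd_conv
            by (metis (mono_tags, lifting) mem_Collect_eq mset_eq_imp_distinct_iff mset_eq_setD)
        qed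
        show "permutations_of_set UNIV \<subseteq> (\<lambda>z. concat (snd z)) ` Sigma ?OP ?L"
        proof
          fix w :: "'N list" assume w: "w \<in> permutations_of_set UNIV"
          then have dw: "distinct w" and lw: "length w = m * n"
            using card distinct_card[of w] by (auto simp: permutations_of_set_def)
          \<comment> \<open>Cutting w into pieces of length m; the partition consists of the sets of
            their entries.\<close>
          define ps where "ps = map (\<lambda>k. take m (drop (k * m) w)) [0..<n]"
          have cw: "concat ps = w" unfolding ps_def using lw by (rule concat_chunks)
          have dp: "distinct p" if "p \<in> set ps" for p using that dw by (auto simp: ps_def)
          have lp: "length p = m" if p: "p \<in> set ps" for p
          proof -
            obtain k where k: "k < n" "p = take m (drop (k * m) w)" using p by (auto simp: ps_def)
            have "m * Suc k \<le> m * n" using k by (intro mult_le_mono2) simp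
            then show ?thesis using lw k by (simp add: algebra_simps)
          qed
          have all2: "list_all2 (\<lambda>p I. p \<in> permutations_of_set I) ps (map set ps)"
            using dp by (simp add: list_all2_conv_all_nth permutations_of_set_def)
          then have "mset w = mset (concat (map desc_list (map set ps)))"
            using mset_concat_parts[OF all2] cw by simp
          then have "distinct (concat (map desc_list (map set ps)))"
            using dw mset_eq_imp_distinct_iff by blast
          moreover have "length (map set ps) = n" by (simp add: ps_def)
          moreover have "\<forall>I\<in>set (map set ps). card I = m" using lp dp by (simp add: distinct_card)
          ultimately have "map set ps \<in> ?OP"
            unfolding ordered_partitions_def by blast
          moreover have "ps \<in> ?L (map set ps)" using all2 unfolding L .
          ultimately show "w \<in> (\<lambda>z. concat (snd z)) ` Sigma ?OP ?L"
            by (intro image_eqI[of _ _ "(map set ps, ps)"]) (simp_all add: cw)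
        qed
      qed
    qed
  qed auto
  finally show ?thesis by (simp add: T_def cols.altsum_def)
qed

text \<open>The rows listed along Js are either an ordering of all indices, whose sorting costs a
  \<lambda>-weight and leaves the determinant in column form, or they contain a repetition.\<close>

corollary laplace_evaluation:
  assumes card: "CARD('N) = m * n" and Js: "length Js = n" "\<forall>J\<in>set Js. card J = m"
  shows "(\<Oplus>Is\<in>ordered_partitions m n. r (invprod (asc_weight q) (concat (map desc_list Is))) \<otimes> ordered_prod R (map2 xi Js Is)) =
    (if Js \<in> ordered_partitions m n then l (invprod (asc_weight q) (concat (map desc_list Js))) \<otimes> xi UNIV UNIV else \<zero>)"
proof -
  have len: "length (concat (map desc_list Js)) = CARD('N)"
    using Js card by (subst length_concat_const[of _ m]) auto
  show ?thesis
  proof (cases "Js \<in> ordered_partitions m n")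
    case True
    then have "concat (map desc_list Js) \<in> permutations_of_set UNIV"
      using ordered_partitions_perm[OF card] by blast
    then have "sort (concat (map desc_list Js)) = asc_list UNIV" "distinct (concat (map desc_list Js))"
      using sort_permutation permutations_of_setD by auto
    then show ?thesis
      using True laplace_expansion[OF assms] cols_sort[OF _ len] rows_eq_cols[of UNIV UNIV] by (simp add: xi_def)
  next
    case False
    then have "\<not> distinct (concat (map desc_list Js))" using Js by (simp only: ordered_partitions_def) simp
    then show ?thesis
      using False laplace_expansion[OF assms] cols_nondistinct[OF _ len] by simp
  qed
qed

end

section \<open>Permutations as lists of indices\<close>

lemma nth_elt_less:
  assumes "k \<in> {1..card I}" "k' \<in> {1..card I}"
  shows "nth_elt I k < nth_elt I k' \<longleftrightarrow> k < k'"
proof -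
  have *: "nth_elt I i < nth_elt I j" if "i < j" "i \<in> {1..card I}" "j \<in> {1..card I}" for i j
    unfolding nth_elt_def using that
    by (intro sorted_wrt_nth_less[OF strict_sorted_list_of_set]) auto
  show ?thesis using *[of k k'] *[of k' k] assms by (metis linorder_neqE_nat order.asym order.irrefl)
qed

lemma nth_elt_inj: "inj_on (nth_elt I) {1..card I}"
proof (rule inj_onI)
  fix k k' assume *: "k \<in> {1..card I}" "k' \<in> {1..card I}" "nth_elt I k = nth_elt I k'"
  then have "\<not> k < k'" "\<not> k' < k"
    using nth_elt_less[OF *(1,2)] nth_elt_less[OF *(2,1)] by simp_all
  then show "k = k'" by simp
qed

lemma map_nth_elt: "map (nth_elt I) [1..<Suc (card I)] = asc_list I"
  by (rule nth_equalityI) (auto simp: nth_elt_def simp del: upt_Suc)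

lemma image_nth_elt: "finite I \<Longrightarrow> nth_elt I ` {1..card I} = I"
  using arg_cong[OF map_nth_elt[of I], of set] by (simp add: atLeastLessThanSuc_atLeastAtMost del: upt_Suc)

definition perm_list :: "'N::linorder set \<Rightarrow> (nat \<Rightarrow> nat) \<Rightarrow> 'N list" where
  "perm_list I \<sigma> = map (\<lambda>k. nth_elt I (\<sigma> k)) [1..<Suc (card I)]"

lemma perm_list_bij:
  assumes "finite I"
  shows "bij_betw (perm_list I) {\<sigma>. \<sigma> permutes {1..card I}} (permutations_of_set I)"
proof -
  let ?S = "{1..card I}"
  have inj: "inj_on (perm_list I) {\<sigma>. \<sigma> permutes ?S}"
  proof (rule inj_onI, clarify)
    fix \<sigma> \<tau> assume *: "\<sigma> permutes ?S" "\<tau> permutes ?S" "perm_list I \<sigma> = perm_list I \<tau>"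
    show "\<sigma> = \<tau>"
    proof
      fix k
      show "\<sigma> k = \<tau> k"
      proof (cases "k \<in> ?S")
        case True
        then have "nth_elt I (\<sigma> k) = nth_elt I (\<tau> k)"
          using *(3) by (auto simp: perm_list_def simp del: upt_Suc)
        then show ?thesis
          using nth_elt_inj[of I] permutes_in_image[OF *(1)] permutes_in_image[OF *(2)] True
          by (meson inj_onD)
      next
        case False
        then show ?thesis using * by (simp add: permutes_not_in)
      qed
    qed
  qed
  have "perm_list I ` {\<sigma>. \<sigma> permutes ?S} \<subseteq> permutations_of_set I"
  proof clarify
    fix \<sigma> assume \<sigma>: "\<sigma> permutes ?S"
    have "set (perm_list I \<sigma>) = nth_elt I ` (\<sigma> ` ?S)"
      by (simp add: perm_list_def image_image atLeastLessThanSuc_atLeastAtMost del: upt_Suc)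
    then have "set (perm_list I \<sigma>) = I"
      using image_nth_elt[OF assms] permutes_image[OF \<sigma>] by simp
    moreover from this have "distinct (perm_list I \<sigma>)"
      by (intro card_distinct) (simp add: perm_list_def)
    ultimately show "perm_list I \<sigma> \<in> permutations_of_set I" by (simp add: permutations_of_set_def)
  qed
  \<comment> \<open>Surjectivity by counting: there are (card I)! permutations on either
    side.\<close>
  moreover have "card (perm_list I ` {\<sigma>. \<sigma> permutes ?S}) = card (permutations_of_set I)"
    using card_image[OF inj] card_permutations[of ?S "card I"] assms by simp
  ultimately have "perm_list I ` {\<sigma>. \<sigma> permutes ?S} = permutations_of_set I"
    by (intro card_subset_eq) auto
  with inj show ?thesis by (rule bij_betw_imageI)
qed

text \<open>\<open>nth_elt I\<close> is increasing, so the inversions of \<sigma> are the decreasing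
  pairs of the list, and all other pairs may be given weight 1.\<close>

lemma prod_inversions:
  assumes \<sigma>: "\<sigma> permutes {1..card I}"
  shows "(\<Prod>(k, l)\<in>inversions (card I) \<sigma>. g (nth_elt I (\<sigma> k)) (nth_elt I (\<sigma> l))) =
    invprod (\<lambda>a b. if b < a then g a b else 1) (perm_list I \<sigma>)"
proof -
  let ?r = "card I"
  let ?A = "{(k, l). k < l \<and> l < ?r}" and ?B = "{(k, l). 1 \<le> k \<and> k < l \<and> l \<le> ?r}"
  let ?g = "\<lambda>a b. if b < a then g a b else 1"
  \<comment> \<open>List positions start at 0, the arguments of \<sigma> at 1.\<close>
  have bij: "bij_betw (\<lambda>(k, l). (Suc k, Suc l)) ?A ?B"
    by (rule bij_betwI[of _ _ _ "\<lambda>(k, l). (k - 1, l - 1)"]) auto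
  have fin: "finite ?B" by (rule finite_subset[of _ "{..?r} \<times> {..?r}"]) auto
  have "invprod ?g (perm_list I \<sigma>) = (\<Prod>(k, l)\<in>?A. ?g (nth_elt I (\<sigma> (Suc k))) (nth_elt I (\<sigma> (Suc l))))"
    unfolding invprod_nth by (rule prod.cong) (auto simp: perm_list_def simp del: upt_Suc)
  also have "\<dots> = (\<Prod>(k, l)\<in>?B. ?g (nth_elt I (\<sigma> k)) (nth_elt I (\<sigma> l)))"
    by (subst prod.reindex_bij_betw[OF bij, symmetric]) (auto intro!: prod.cong)
  also have "\<dots> = (\<Prod>(k, l)\<in>?B. if \<sigma> l < \<sigma> k then g (nth_elt I (\<sigma> k)) (nth_elt I (\<sigma> l)) else 1)"
  proof (rule prod.cong[OF refl], clarify)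
    fix k l assume "1 \<le> k" "k < l" "l \<le> ?r"
    then have "\<sigma> k \<in> {1..?r}" "\<sigma> l \<in> {1..?r}" using permutes_in_image[OF \<sigma>] by auto
    then show "?g (nth_elt I (\<sigma> k)) (nth_elt I (\<sigma> l)) =
        (if \<sigma> l < \<sigma> k then g (nth_elt I (\<sigma> k)) (nth_elt I (\<sigma> l)) else 1)"
      using nth_elt_less by metis
  qed
  also have "\<dots> = (\<Prod>(k, l)\<in>inversions ?r \<sigma>. g (nth_elt I (\<sigma> k)) (nth_elt I (\<sigma> l)))"
    by (rule prod.mono_neutral_cong_right[OF fin]) (auto simp: inversions_def split: if_splits)
  finally show ?thesis ..
qed

lemma S_coeff_list:
  assumes "\<sigma> permutes {1..card I}"
  shows "S_coeff q \<sigma> I = invprod (inv_weight q) (perm_list I \<sigma>)"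
proof -
  have c: "inv_weight q = (\<lambda>a b. if b < a then - dyn_h q a b else 1)" by (intro ext) (simp add: inv_weight_def)
  show ?thesis
    unfolding S_coeff_def c by (rule prod_inversions[OF assms, of "\<lambda>a b. - dyn_h q a b"])
qed

text \<open>Reading the list backwards puts the smaller entry of each inversion first. The pairs
  that count are then the increasing ones, and h takes its arguments in the order of the
  list.\<close>

lemma S_tilde_list:
  assumes "\<sigma> permutes {1..card I}"
  shows "S_tilde q \<sigma> I = invprod (asc_weight q) (rev (perm_list I \<sigma>))"
proof -
  have c: "(\<lambda>a b. asc_weight q b a) = (\<lambda>a b. if b < a then - dyn_h q b a else 1)" by (intro ext) (simp add: asc_weight_def)
  show ?thesis
    unfolding S_tilde_def invprod_rev c by (rule prod_inversions[OF assms, of "\<lambda>a b. - dyn_h q b a"])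
qed

lemma concat_upt_blocks: "concat (map (\<lambda>k. [(k - 1) * m + 1..<k * m + 1]) [1..<Suc n]) = [1..<Suc (m * n)]"
proof (induction n)
  case (Suc n)
  have "[1..<Suc (m * Suc n)] = [1..<Suc (m * n)] @ [m * n + 1..<m * n + m + 1]"
    using upt_add_eq_append[of 1 "Suc (m * n)" m] by (simp add: algebra_simps del: upt_Suc)
  then show ?case using Suc by (simp add: mult.commute add.commute)
qed simp

lemma block_list:
  fixes \<sigma> :: "nat \<Rightarrow> nat"
  assumes card: "CARD('N::{finite,linorder}) = m * n" and \<sigma>: "\<sigma> permutes {1..m * n}"
    and k: "k \<in> {1..n}" and mono: "strict_mono_on {(k - 1) * m + 1..k * m} \<sigma>"
  shows "asc_list (block_set m \<sigma> k :: 'N set) = map (\<lambda>p. nth_elt UNIV (\<sigma> p)) [(k - 1) * m + 1..<k * m + 1]"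
proof -
  let ?B = "[(k - 1) * m + 1..<k * m + 1]" and ?f = "\<lambda>p. nth_elt (UNIV :: 'N set) (\<sigma> p)"
  have B: "set ?B = {(k - 1) * m + 1..k * m}" by auto
  have kn: "k * m \<le> m * n" using k by (simp add: mult.commute)
  have "\<sigma> p \<in> {1..m * n}" if p: "p \<in> set ?B" for p
  proof -
    have "1 \<le> p" "p \<le> k * m" using p unfolding B by auto
    then show ?thesis using permutes_in_image[OF \<sigma>, of p] order.trans[OF _ kn] by auto
  qed
  then have "?f p < ?f p'" if "p \<in> set ?B" "p' \<in> set ?B" "p < p'" for p p'
    using that nth_elt_less[of "\<sigma> p" "UNIV :: 'N set" "\<sigma> p'"] card strict_mono_onD[OF mono] unfolding B by metis
  then have "sorted_wrt (<) (map ?f ?B)"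
    unfolding sorted_wrt_map by (rule sorted_wrt_mono_rel[OF _ sorted_wrt_upt]) auto
  then have "asc_list (set (map ?f ?B)) = map ?f ?B"
    by (intro sorted_list_of_set.idem_if_sorted_distinct) (simp_all add: strict_sorted_iff)
  moreover have "set (map ?f ?B) = block_set m \<sigma> k" unfolding block_set_def set_map B ..
  ultimately show ?thesis by simp
qed

section \<open>Block permutations and ordered partitions\<close>

definition blocks :: "nat \<Rightarrow> nat \<Rightarrow> (nat \<Rightarrow> nat) \<Rightarrow> 'N::{finite,linorder} set list" where
  "blocks m n \<sigma> = map (block_set m \<sigma>) (rev [1..<Suc n])"

lemma concat_desc_lists: "concat (map desc_list Is) = rev (concat (map asc_list (rev Is)))"
  by (simp add: rev_concat rev_map comp_def)

text \<open>The order of the blocks and the order inside each block are both reversed, which amounts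
  to reversing the whole list.\<close>

lemma concat_blocks:
  assumes card: "CARD('N::{finite,linorder}) = m * n" and \<sigma>: "\<sigma> \<in> block_perms m n"
  shows "concat (map desc_list (blocks m n \<sigma> :: 'N set list)) = rev (perm_list UNIV \<sigma>)"
proof -
  let ?f = "\<lambda>p. nth_elt (UNIV :: 'N set) (\<sigma> p)"
  have "map asc_list (rev (blocks m n \<sigma> :: 'N set list)) = map (map ?f) (map (\<lambda>k. [(k - 1) * m + 1..<k * m + 1]) [1..<Suc n])"
    unfolding blocks_def rev_map rev_rev_ident map_map
  proof (rule map_cong[OF refl])
    fix k assume "k \<in> set [1..<Suc n]"
    then have "k \<in> {1..n}" by auto
    then show "(asc_list \<circ> block_set m \<sigma>) k = (map ?f \<circ> (\<lambda>k. [(k - 1) * m + 1..<k * m + 1])) k"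
      using block_list[OF card, of \<sigma> k] \<sigma> by (simp add: block_perms_def del: upt_Suc)
  qed
  then have "concat (map asc_list (rev (blocks m n \<sigma> :: 'N set list))) = map ?f [1..<Suc (m * n)]"
    using concat_upt_blocks[of m n] by (simp only: map_concat[symmetric])
  then show ?thesis unfolding concat_desc_lists perm_list_def using card by simp
qed

text \<open>By \<open>concat_blocks\<close> the blocks determine \<sigma>. Conversely, a partition
  read backwards is the one-line form of some \<sigma>, and \<sigma> increases on every block
  because the blocks were listed decreasingly.\<close>

lemma blocks_bij:
  assumes card: "CARD('N::{finite,linorder}) = m * n"
  shows "bij_betw (blocks m n) (block_perms m n) (ordered_partitions m n :: 'N set list set)"
proof (rule bij_betw_imageI)
  let ?U = "UNIV :: 'N set"
  have perm: "\<sigma> permutes {1..card ?U}" if "\<sigma> \<in> block_perms m n" for \<sigma>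
    using that card by (simp add: block_perms_def)
  note inj = bij_betw_imp_inj_on[OF perm_list_bij[OF finite, of ?U]]
  show "inj_on (blocks m n :: _ \<Rightarrow> 'N set list) (block_perms m n)"
  proof (rule inj_onI)
    fix \<sigma> \<tau> assume *: "\<sigma> \<in> block_perms m n" "\<tau> \<in> block_perms m n"
      "(blocks m n \<sigma> :: 'N set list) = blocks m n \<tau>"
    then have "perm_list ?U \<sigma> = perm_list ?U \<tau>"
      using concat_blocks[OF card *(1)] concat_blocks[OF card *(2)] by simp
    then show "\<sigma> = \<tau>" using inj_onD[OF inj] perm *(1,2) by blast
  qed
  show "blocks m n ` block_perms m n = (ordered_partitions m n :: 'N set list set)"
  proof
    show "blocks m n ` block_perms m n \<subseteq> (ordered_partitions m n :: 'N set list set)"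
    proof clarify
      fix \<sigma> assume \<sigma>: "\<sigma> \<in> block_perms m n"
      have "rev (perm_list ?U \<sigma>) \<in> permutations_of_set UNIV"
        using bij_betwE[OF perm_list_bij[OF finite, of ?U]] perm[OF \<sigma>] by (simp add: permutations_of_set_def)
      then have "distinct (concat (map desc_list (blocks m n \<sigma> :: 'N set list)))"
        unfolding concat_blocks[OF card \<sigma>] by (simp add: permutations_of_set_def)
      moreover have "card I = m" if I: "I \<in> set (blocks m n \<sigma> :: 'N set list)" for I
      proof -
        have "set [1..<Suc n] = {1..n}" by auto
        then obtain k where k: "k \<in> {1..n}" "I = block_set m \<sigma> k"
          using I unfolding blocks_def set_map set_rev by auto
        then have "asc_list I = map (\<lambda>p. nth_elt UNIV (\<sigma> p)) [(k - 1) * m + 1..<k * m + 1]"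
          using block_list[OF card _ k(1), of \<sigma>] \<sigma> by (simp add: block_perms_def)
        from arg_cong[OF this, of length] have "card I = k * m - (k - 1) * m"
          by (simp del: upt_Suc)
        also have "\<dots> = m" using k(1) by (cases k) auto
        finally show ?thesis .
      qed
      moreover have "length (blocks m n \<sigma> :: 'N set list) = n" by (simp add: blocks_def)
      ultimately show "blocks m n \<sigma> \<in> (ordered_partitions m n :: 'N set list set)"
        unfolding ordered_partitions_def by blast
    qed
    show "(ordered_partitions m n :: 'N set list set) \<subseteq> blocks m n ` block_perms m n"
    proof
      fix Is :: "'N set list" assume Is: "Is \<in> ordered_partitions m n"
      then have len: "length Is = n" and cI: "\<And>I. I \<in> set Is \<Longrightarrow> card I = m"
        by (auto simp: ordered_partitions_def)
      have "rev (concat (map desc_list Is)) \<in> permutations_of_set UNIV"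
        using ordered_partitions_perm[OF card Is] by (simp add: permutations_of_set_def)
      then have "rev (concat (map desc_list Is)) \<in> perm_list ?U ` {\<sigma>. \<sigma> permutes {1..card ?U}}"
        unfolding bij_betw_imp_surj_on[OF perm_list_bij[OF finite, of ?U]] .
      then obtain \<sigma> where \<sigma>': "rev (concat (map desc_list Is)) = perm_list ?U \<sigma>"
          "\<sigma> \<in> {\<sigma>. \<sigma> permutes {1..card ?U}}"
        by (rule imageE)
      then have \<sigma>: "\<sigma> permutes {1..card ?U}" "perm_list ?U \<sigma> = rev (concat (map desc_list Is))"
        by simp_all
      let ?f = "\<lambda>p. nth_elt ?U (\<sigma> p)" and ?B = "\<lambda>k. [(k - 1) * m + 1..<k * m + 1]"
      have lenB: "length (?B k) = m" if "k \<in> {1..n}" for k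
        using that by (cases k) auto
      have "concat (map (\<lambda>k. map ?f (?B k)) [1..<Suc n]) = map ?f (concat (map ?B [1..<Suc n]))"
        by (simp add: map_concat comp_def del: upt_Suc)
      also have "\<dots> = concat (map asc_list (rev Is))"
        using \<sigma>(2) card unfolding concat_upt_blocks concat_desc_lists perm_list_def by simp
      \<comment> \<open>Both concatenations consist of pieces of length m, so their equality
        descends to the pieces.\<close>
      finally have meq: "map (\<lambda>k. map ?f (?B k)) [1..<Suc n] = map asc_list (rev Is)"
      proof (rule concat_injective)
        show "\<forall>(x, y)\<in>set (zip (map (\<lambda>k. map ?f (?B k)) [1..<Suc n]) (map asc_list (rev Is))). length x = length y"
        proof clarify
          fix x y assume z: "(x, y) \<in> set (zip (map (\<lambda>k. map ?f (?B k)) [1..<Suc n]) (map asc_list (rev Is)))"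
          have "length x = m"
            using set_zip_leftD[OF z] lenB by (auto simp del: upt_Suc)
          moreover have "length y = m"
            using set_zip_rightD[OF z] cI by auto
          ultimately show "length x = length y" by simp
        qed
      qed (simp add: len)
      have eq: "map ?f (?B k) = asc_list (rev Is ! (k - 1))" if k: "k \<in> {1..n}" for k
      proof -
        obtain j where "k = Suc j" "j < n" using k by (cases k) auto
        then show ?thesis
          using arg_cong[OF meq, of "\<lambda>xs. xs ! j"] len by (simp del: upt_Suc)
      qed
      have "\<sigma> \<in> block_perms m n"
        unfolding block_perms_def
      proof (intro CollectI conjI ballI)
        show "\<sigma> permutes {1..m * n}" using \<sigma>(1) card by simp
        fix k assume k: "k \<in> {1..n}"
        have "sorted_wrt (<) (map ?f (?B k))"
          unfolding eq[OF k] by (rule strict_sorted_list_of_set)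
        have kn: "k * m \<le> m * n" using k by (simp add: mult.commute)
        show "strict_mono_on {(k - 1) * m + 1..k * m} \<sigma>"
        proof (rule strict_mono_onI)
          fix p p' assume p: "p \<in> {(k - 1) * m + 1..k * m}" "p' \<in> {(k - 1) * m + 1..k * m}" "p < p'"
          \<comment> \<open>The first position of the k-th block, which has index 0 in
            \<open>?B k\<close>; hence the differences used as list indices.\<close>
          let ?b = "(k - 1) * m + 1"
          have "map ?f (?B k) ! (p - ?b) < map ?f (?B k) ! (p' - ?b)"
          proof (rule sorted_wrt_nth_less[OF \<open>sorted_wrt (<) (map ?f (?B k))\<close>])
            show "p - ?b < p' - ?b" "p' - ?b < length (map ?f (?B k))"
              using p by (auto simp del: upt_Suc)
          qed
          moreover have "?B k ! (x - ?b) = x" if "?b \<le> x" "x \<le> k * m" for x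
            using that by (subst nth_upt) auto
          ultimately have "?f p < ?f p'" using p by (simp del: upt_Suc)
          moreover have "p \<in> {1..card ?U}" "p' \<in> {1..card ?U}"
            using p(1,2) order.trans[OF _ kn] card by auto
          then have "\<sigma> p \<in> {1..card ?U}" "\<sigma> p' \<in> {1..card ?U}"
            using permutes_in_image[OF \<sigma>(1)] by simp_all
          ultimately show "\<sigma> p < \<sigma> p'" using nth_elt_less by metis
        qed
      qed
      moreover have "blocks m n \<sigma> = Is"
      proof -
        have "block_set m \<sigma> k = rev Is ! (k - 1)" if k: "k \<in> {1..n}" for k
        proof -
          have "set (?B k) = {(k - 1) * m + 1..k * m}" by auto
          then have "block_set m \<sigma> k = set (map ?f (?B k))" unfolding block_set_def set_map by simp
          then show ?thesis unfolding eq[OF k] by simp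
        qed
        then have "map (block_set m \<sigma>) [1..<Suc n] = rev Is"
          using len by (intro nth_equalityI) (auto simp del: upt_Suc)
        then show ?thesis unfolding blocks_def by (metis rev_map rev_rev_ident)
      qed
      ultimately show "Is \<in> blocks m n ` block_perms m n" by blast
    qed
  qed
qed

text \<open>A common normal form for the two Pfaffians, one in the algebra of the b_I and one in the
  tensor product: a sum over lists of blocks instead of permutations.\<close>

lemma hyper_Pf_partitions:
  fixes A :: "(complex, 'a) module" and X :: "'N::{finite,linorder} set \<Rightarrow> 'a"
  assumes "Ring.ring A" and card: "CARD('N) = m * n"
    and cl: "\<And>f x. x \<in> carrier A \<Longrightarrow> act f x \<in> carrier A" "\<And>I. card I = m \<Longrightarrow> X I \<in> carrier A"
  shows "hyper_Pf A act q m n X =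
    (\<Oplus>\<^bsub>A\<^esub>Is\<in>ordered_partitions m n. act (invprod (asc_weight q) (concat (map desc_list Is))) (ordered_prod A (map X Is)))"
proof -
  interpret Ring.ring A by fact
  let ?T = "\<lambda>Is. act (invprod (asc_weight q) (concat (map desc_list Is))) (ordered_prod A (map X Is))"
  have T: "?T Is \<in> carrier A" if "Is \<in> ordered_partitions m n" for Is
    using that by (intro cl ordered_prod_closed) (auto simp: ordered_partitions_def cl)
  have "hyper_Pf A act q m n X = (\<Oplus>\<^bsub>A\<^esub>\<sigma>\<in>block_perms m n. ?T (blocks m n \<sigma>))"
    unfolding hyper_Pf_def
  proof (rule finsum_cong'[OF refl])
    show "(\<lambda>\<sigma>. ?T (blocks m n \<sigma>)) \<in> block_perms m n \<rightarrow> carrier A"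
      using T bij_betwE[OF blocks_bij[OF card]] by blast
    fix \<sigma> assume \<sigma>: "\<sigma> \<in> block_perms m n"
    then have "\<sigma> permutes {1..CARD('N)}" using card by (simp add: block_perms_def)
    then have "S_tilde q \<sigma> (UNIV :: 'N set) = invprod (asc_weight q) (concat (map desc_list (blocks m n \<sigma> :: 'N set list)))"
      unfolding concat_blocks[OF card \<sigma>] by (rule S_tilde_list)
    then show "act (S_tilde q \<sigma> UNIV) (ordered_prod A (map (\<lambda>k. X (block_set m \<sigma> k)) (rev [1..<Suc n]))) =
        ?T (blocks m n \<sigma>)"
      by (simp add: blocks_def comp_def del: upt_Suc)
  qed
  also have "\<dots> = (\<Oplus>\<^bsub>A\<^esub>Is\<in>ordered_partitions m n. ?T Is)"
    using T blocks_bij[OF card] by (intro finsum_reindex_bij[symmetric])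
  finally show ?thesis .
qed

section \<open>Presented algebras\<close>

text \<open>Calculation in a presented algebra: classes of monomials multiply as in the monoid, and
  classes of relations vanish. The three instances are the algebra of the b_I, the matrix algebra
  and their tensor product.\<close>

locale presentation =
  fixes G :: "('g, 'x) monoid_scheme" and Rel :: "('g \<Rightarrow>\<^sub>0 complex) set"
  assumes monoid_G: "Group.monoid G" and rels: "Rel \<subseteq> carrier (monoid_algebra G)"
begin

abbreviation "MA \<equiv> monoid_algebra G"
abbreviation "P \<equiv> presented_algebra G Rel"

definition cls :: "('g \<Rightarrow>\<^sub>0 complex) \<Rightarrow> ('g \<Rightarrow>\<^sub>0 complex) set" where
  "cls z = (Idl\<^bsub>MA\<^esub> Rel) +>\<^bsub>MA\<^esub> z"

interpretation MA: Ring.ring MA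
  using monoid_G by (rule ring_monoid_algebra)

interpretation P: Ring.ring P
  using monoid_G rels by (rule ring_presented_algebra)

interpretation I: ideal "Idl\<^bsub>MA\<^esub> Rel" MA
  using rels by (rule MA.genideal_ideal)

lemma basis_class_cls: "basis_class G Rel x = cls (Poly_Mapping.single x 1)"
  by (simp add: basis_class_def cls_def)

lemma MA_simps:
  "x \<oplus>\<^bsub>MA\<^esub> y = x + y" "\<zero>\<^bsub>MA\<^esub> = 0" "z \<in> carrier MA \<longleftrightarrow> Poly_Mapping.keys z \<subseteq> carrier G"
  by (simp_all add: monoid_algebra_def)

lemma single_closed [simp]: "a \<in> carrier G \<Longrightarrow> Poly_Mapping.single a c \<in> carrier MA"
  by (simp add: MA_simps)

lemma diff_closed: "x \<in> carrier MA \<Longrightarrow> y \<in> carrier MA \<Longrightarrow> x - y \<in> carrier MA"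
  using Poly_Mapping.keys_add[of x "- y"] by (auto simp: MA_simps)

lemma sum_closed: "x \<in> carrier MA \<Longrightarrow> y \<in> carrier MA \<Longrightarrow> x + y \<in> carrier MA"
  using Poly_Mapping.keys_add[of x y] by (auto simp: MA_simps)

lemma P_simps:
  "carrier P = carrier (MA Quot Idl\<^bsub>MA\<^esub> Rel)" "mult P = mult (MA Quot Idl\<^bsub>MA\<^esub> Rel)"
  "one P = one (MA Quot Idl\<^bsub>MA\<^esub> Rel)" "add P = add (MA Quot Idl\<^bsub>MA\<^esub> Rel)"
  "zero P = zero (MA Quot Idl\<^bsub>MA\<^esub> Rel)"
  by (simp_all add: presented_algebra_def Let_def)

lemma cls_closed [simp]: "z \<in> carrier MA \<Longrightarrow> cls z \<in> carrier P"
  using ring_hom_closed[OF I.rcos_ring_hom] by (simp add: cls_def P_simps)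

lemma cls_add: "x \<in> carrier MA \<Longrightarrow> y \<in> carrier MA \<Longrightarrow> cls (x + y) = cls x \<oplus>\<^bsub>P\<^esub> cls y"
  using ring_hom_add[OF I.rcos_ring_hom] by (simp add: cls_def P_simps MA_simps(1))

lemma cls_mult: "x \<in> carrier MA \<Longrightarrow> y \<in> carrier MA \<Longrightarrow> cls (x \<otimes>\<^bsub>MA\<^esub> y) = cls x \<otimes>\<^bsub>P\<^esub> cls y"
  using ring_hom_mult[OF I.rcos_ring_hom] by (simp add: cls_def P_simps)

lemma cls_single_mult:
  "a \<in> carrier G \<Longrightarrow> b \<in> carrier G \<Longrightarrow> cls (Poly_Mapping.single a 1) \<otimes>\<^bsub>P\<^esub> cls (Poly_Mapping.single b 1) = cls (Poly_Mapping.single (a \<otimes>\<^bsub>G\<^esub> b) 1)"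
  by (simp add: cls_mult[symmetric] monoid_algebra_single)

lemma cls_one: "cls (Poly_Mapping.single \<one>\<^bsub>G\<^esub> 1) = \<one>\<^bsub>P\<^esub>"
  using ring_hom_one[OF I.rcos_ring_hom] by (simp add: cls_def P_simps) (simp add: monoid_algebra_def)

lemma cls_diff: "x \<in> carrier MA \<Longrightarrow> y \<in> carrier MA \<Longrightarrow> cls (x - y) = cls x \<ominus>\<^bsub>P\<^esub> cls y"
  using cls_add[of "x - y" y] diff_closed[of x y]
  by (simp add: P.minus_eq P.a_assoc P.r_neg)

lemma cls_rel: "z \<in> Rel \<Longrightarrow> cls z = \<zero>\<^bsub>P\<^esub>"
  using MA.genideal_self[OF rels] I.a_rcos_const by (auto simp: cls_def P_simps FactRing_def)

lemma cls_eqI: "x - y \<in> Rel \<Longrightarrow> x \<in> carrier MA \<Longrightarrow> y \<in> carrier MA \<Longrightarrow> cls x = cls y"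
  using cls_rel[of "x - y"] cls_add[of "x - y" y] diff_closed[of x y] by simp

end

section \<open>The dynamical matrix algebra as an instance of the abstract relations\<close>

interpretation F: presentation "free_monoid UNIV" "F_rels q" for q :: complex
  by (rule presentation.intro[OF monoid_free_monoid F_rels_carrier])

lemma F_words:
  "F.cls q (word u) \<otimes>\<^bsub>F_alg q\<^esub> F.cls q (word v) = F.cls q (word (u @ v))"
  using F.cls_single_mult[of u v q] by (simp add: F_alg_def free_monoid_def)

lemma F_MA: "z \<in> carrier (monoid_algebra (free_monoid UNIV))"
  by (simp add: monoid_algebra_def free_monoid_def)

lemma F_elts:
  "t_elt q i j = F.cls q (word [Tgen i j])" "mu_l q f = F.cls q (word [Lgen f])"
  "mu_r q f = F.cls q (word [Rgen f])"
  by (simp_all add: t_elt_def mu_l_def mu_r_def F.basis_class_cls)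

lemma dyn_matrix_algebra_F_alg:
  assumes "q \<noteq> 0" "\<And>k. k \<ge> 1 \<Longrightarrow> q ^ k \<noteq> 1"
  shows "dyn_matrix_algebra (F_alg q) q (mu_l q :: 'N::{finite,linorder} mero \<Rightarrow> _) (mu_r q) (t_elt q)"
proof -
  interpret R: Ring.ring "F_alg q :: (complex, 'N F_elt) module" by (rule ring_F_alg)
  have eqI: "F.cls q x = F.cls q y" if "x - y \<in> F_rels q" for x y :: "'N F_gen list \<Rightarrow>\<^sub>0 complex"
    using that by (rule F.cls_eqI) (rule F_MA)+
  have cl: "F.cls q x \<in> carrier (F_alg q)" for x :: "'N F_gen list \<Rightarrow>\<^sub>0 complex"
    using F.cls_closed[OF F_MA, of q x] by (simp add: F_alg_def)
  have add: "F.cls q (x + y) = F.cls q x \<oplus>\<^bsub>F_alg q\<^esub> F.cls q y" for x y :: "'N F_gen list \<Rightarrow>\<^sub>0 complex"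
    using F.cls_add[OF F_MA F_MA, of q x y] by (simp add: F_alg_def)
  have diff: "F.cls q (x - y) = F.cls q x \<ominus>\<^bsub>F_alg q\<^esub> F.cls q y" for x y :: "'N F_gen list \<Rightarrow>\<^sub>0 complex"
    using F.cls_diff[OF F_MA F_MA, of q x y] by (simp add: F_alg_def)
  have one: "F.cls q (word []) = \<one>\<^bsub>F_alg q\<^esub>"
    using F.cls_one[of q] by (simp add: F_alg_def free_monoid_def)
  \<comment> \<open>The presentation brackets these relations as \<open>y + z - w\<close>, the
    locale as y plus a difference.\<close>
  have sum3: "F.cls q x = F.cls q y \<oplus>\<^bsub>F_alg q\<^esub> (F.cls q z \<ominus>\<^bsub>F_alg q\<^esub> F.cls q w)"
    if "x - (y + z - w) \<in> F_rels q" for x y z w :: "'N F_gen list \<Rightarrow>\<^sub>0 complex"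
    using eqI[OF that] cl by (simp add: add diff R.minus_eq R.a_assoc)
  have hom: "F.cls q (word [\<phi> (f + g)]) = F.cls q (word [\<phi> f]) \<oplus>\<^bsub>F_alg q\<^esub> F.cls q (word [\<phi> g])"
      "F.cls q (word [\<phi> (f * g)]) = F.cls q (word [\<phi> f]) \<otimes>\<^bsub>F_alg q\<^esub> F.cls q (word [\<phi> g])"
      "F.cls q (word [\<phi> (mero_const c)]) = F.cls q (Poly_Mapping.single [] c)"
    if "mero_hom_rels \<phi> \<subseteq> F_rels q" for \<phi> :: "'N mero \<Rightarrow> 'N F_gen" and f g c
  proof -
    have "word [\<phi> (f + g)] - (word [\<phi> f] + word [\<phi> g]) \<in> mero_hom_rels \<phi>"
      unfolding mero_hom_rels_def by (auto simp: diff_diff_eq)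
    then have "word [\<phi> (f + g)] - (word [\<phi> f] + word [\<phi> g]) \<in> F_rels q" using that by blast
    from eqI[OF this] show "F.cls q (word [\<phi> (f + g)]) = F.cls q (word [\<phi> f]) \<oplus>\<^bsub>F_alg q\<^esub> F.cls q (word [\<phi> g])"
      by (simp add: add)
    have "word [\<phi> (f * g)] - word [\<phi> f, \<phi> g] \<in> F_rels q"
      using that unfolding mero_hom_rels_def by blast
    from eqI[OF this] show "F.cls q (word [\<phi> (f * g)]) = F.cls q (word [\<phi> f]) \<otimes>\<^bsub>F_alg q\<^esub> F.cls q (word [\<phi> g])"
      by (simp add: F_words)
    show "F.cls q (word [\<phi> (mero_const c)]) = F.cls q (Poly_Mapping.single [] c)"
      by (rule eqI) (use that in \<open>unfold mero_hom_rels_def, blast\<close>)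
  qed
  have L: "mero_hom_rels Lgen \<subseteq> (F_rels q :: ('N F_gen list \<Rightarrow>\<^sub>0 complex) set)"
    and R: "mero_hom_rels Rgen \<subseteq> (F_rels q :: ('N F_gen list \<Rightarrow>\<^sub>0 complex) set)"
    unfolding F_rels_def by blast+
  show ?thesis
  proof (unfold_locales)
    fix i j k k' :: 'N and f g :: "'N mero" and z :: complex
    show "mu_l q (f + g) = mu_l q f \<oplus>\<^bsub>F_alg q\<^esub> mu_l q g" "mu_r q (f + g) = mu_r q f \<oplus>\<^bsub>F_alg q\<^esub> mu_r q g"
      "mu_l q (f * g) = mu_l q f \<otimes>\<^bsub>F_alg q\<^esub> mu_l q g" "mu_r q (f * g) = mu_r q f \<otimes>\<^bsub>F_alg q\<^esub> mu_r q g"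
      unfolding F_elts by (simp_all only: hom(1,2)[OF L] hom(1,2)[OF R])
    show "mu_l q (mero_const z :: 'N mero) = mu_r q (mero_const z)"
      unfolding F_elts using hom(3)[OF L, of z] hom(3)[OF R, of z] by simp
    show "mu_l q (1 :: 'N mero) = \<one>\<^bsub>F_alg q\<^esub>"
      using hom(3)[OF L, of 1] one by (simp add: F_elts mero_const_1)
    \<comment> \<open>\<open>F_rels\<close> is a union nested to the left; the chain of union rules,
      here and in the following claims, descends to the family in question.\<close>
    show "mu_l q f \<otimes>\<^bsub>F_alg q\<^esub> mu_r q g = mu_r q g \<otimes>\<^bsub>F_alg q\<^esub> mu_l q f"
      unfolding F_elts F_words append.simps by (rule eqI) (unfold F_rels_def, rule UnI1, rule UnI1, rule UnI1, rule UnI1, rule UnI1, rule UnI1, rule UnI1, rule UnI2, blast)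
    show "mu_l q f \<otimes>\<^bsub>F_alg q\<^esub> t_elt q i j = t_elt q i j \<otimes>\<^bsub>F_alg q\<^esub> mu_l q (mero_shift i f)"
      unfolding F_elts F_words append.simps by (rule eqI) (unfold F_rels_def, rule UnI1, rule UnI1, rule UnI1, rule UnI1, rule UnI1, rule UnI1, rule UnI2, blast)
    show "mu_r q f \<otimes>\<^bsub>F_alg q\<^esub> t_elt q i j = t_elt q i j \<otimes>\<^bsub>F_alg q\<^esub> mu_r q (mero_shift j f)"
      unfolding F_elts F_words append.simps by (rule eqI) (unfold F_rels_def, rule UnI1, rule UnI1, rule UnI1, rule UnI1, rule UnI1, rule UnI2, blast)
    show "mu_r q (dyn_h q k k') \<otimes>\<^bsub>F_alg q\<^esub> (t_elt q i k \<otimes>\<^bsub>F_alg q\<^esub> t_elt q i k') =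
        t_elt q i k' \<otimes>\<^bsub>F_alg q\<^esub> t_elt q i k" if "k < k'"
      unfolding F_elts F_words append.simps by (rule eqI) (unfold F_rels_def, rule UnI1, rule UnI1, rule UnI1, rule UnI1, rule UnI2, use that in blast)
    show "t_elt q i k \<otimes>\<^bsub>F_alg q\<^esub> t_elt q j k' = t_elt q j k' \<otimes>\<^bsub>F_alg q\<^esub> t_elt q i k \<oplus>\<^bsub>F_alg q\<^esub>
        (mu_l q (dyn_h q j i) \<otimes>\<^bsub>F_alg q\<^esub> (t_elt q j k \<otimes>\<^bsub>F_alg q\<^esub> t_elt q i k') \<ominus>\<^bsub>F_alg q\<^esub>
         mu_r q (dyn_h q k k') \<otimes>\<^bsub>F_alg q\<^esub> (t_elt q j k \<otimes>\<^bsub>F_alg q\<^esub> t_elt q i k'))"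
      if "i < j" "k < k'"
      unfolding F_elts F_words append.simps by (rule sum3) (unfold F_rels_def, rule UnI1, rule UnI1, rule UnI2, use that in blast)
    show "t_elt q i k' \<otimes>\<^bsub>F_alg q\<^esub> t_elt q j k =
        mu_l q (dyn_g q i j) \<otimes>\<^bsub>F_alg q\<^esub> (t_elt q j k \<otimes>\<^bsub>F_alg q\<^esub> t_elt q i k') \<oplus>\<^bsub>F_alg q\<^esub>
        (mu_r q (dyn_h q k k') \<otimes>\<^bsub>F_alg q\<^esub> (t_elt q i k \<otimes>\<^bsub>F_alg q\<^esub> t_elt q j k') \<ominus>\<^bsub>F_alg q\<^esub>
         mu_l q (dyn_h q i j) \<otimes>\<^bsub>F_alg q\<^esub> (t_elt q i k \<otimes>\<^bsub>F_alg q\<^esub> t_elt q j k'))"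
      if "i < j" "k < k'"
      unfolding F_elts F_words append.simps by (rule sum3) (unfold F_rels_def, rule UnI2, use that in blast)
  qed (simp_all add: assms F_elts cl)
qed

section \<open>The tensor product\<close>

text \<open>The definition sums over permutations of positions; through \<open>perm_list\<close>
  this becomes the sum over orderings of the row set I.\<close>

lemma dyn_minor_xi:
  fixes I J :: "'N::{finite,linorder} set"
  assumes "q \<noteq> 0" "\<And>k. k \<ge> 1 \<Longrightarrow> q ^ k \<noteq> 1" and card: "card I = card J"
  shows "dyn_minor q I J = dyn_matrix_algebra.xi (F_alg q) q (mu_l q) (t_elt q) I J"
proof -
  interpret F: dyn_matrix_algebra "F_alg q" q "mu_l q :: 'N mero \<Rightarrow> _" "mu_r q" "t_elt q"
    using assms(1,2) by (rule dyn_matrix_algebra_F_alg)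
  let ?T = "\<lambda>p. mu_l q (invprod (inv_weight q) p) \<otimes>\<^bsub>F_alg q\<^esub> F.rows.W p (asc_list J)"
  have "dyn_minor q I J = (\<Oplus>\<^bsub>F_alg q\<^esub>\<sigma>\<in>{\<sigma>. \<sigma> permutes {1..card I}}. ?T (perm_list I \<sigma>))"
    unfolding dyn_minor_def
  proof (rule F.finsum_cong'[OF refl])
    fix \<sigma> assume "\<sigma> \<in> {\<sigma>. \<sigma> permutes {1..card I}}"
    moreover have "map (\<lambda>k. t_elt q (nth_elt I (\<sigma> k)) (nth_elt J k)) [1..<Suc (card I)] =
        map2 (t_elt q) (perm_list I \<sigma>) (asc_list J)"
      unfolding perm_list_def map_nth_elt[of J, symmetric] card zip_map_map
      by (simp add: zip_same_conv_map comp_def del: upt_Suc)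
    ultimately show "mu_l q (S_coeff q \<sigma> I) \<otimes>\<^bsub>F_alg q\<^esub>
        ordered_prod (F_alg q) (map (\<lambda>k. t_elt q (nth_elt I (\<sigma> k)) (nth_elt J k)) [1..<Suc (card I)]) =
        ?T (perm_list I \<sigma>)"
      by (simp add: S_coeff_list F.rows.W_def)
  qed auto
  also have "\<dots> = (\<Oplus>\<^bsub>F_alg q\<^esub>p\<in>permutations_of_set I. ?T p)"
    by (rule F.finsum_reindex_bij[OF perm_list_bij, symmetric]) auto
  finally show ?thesis by (simp add: F.xi_def F.rows.altsum_def)
qed

section \<open>Generators of the algebra of the b_I and pure tensors\<close>

interpretation B: presentation "B_monoid m" "mero_hom_rels Fgen" for m :: nat
  by (rule presentation.intro[OF _ B_rels_carrier]) (simp add: B_monoid_def monoid_free_monoid)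

lemma b_elt_closed: "card J = m \<Longrightarrow> b_elt m J \<in> carrier (B_alg m)"
  unfolding b_elt_def B.basis_class_cls B_alg_def
  by (intro B.cls_closed B.single_closed) (simp add: B_monoid_def free_monoid_def)

lemma B_fun_closed: "B_fun m f \<in> carrier (B_alg m)"
  unfolding B_fun_def B.basis_class_cls B_alg_def
  by (intro B.cls_closed B.single_closed) (simp add: B_monoid_def free_monoid_def)

lemma presentation_BF:
  "presentation ((B_alg m :: (complex, 'N B_elt) module) \<times>\<times> (F_alg q :: (complex, 'N::{finite,linorder} F_elt) module)) (bilinear_rels (B_alg m) (F_alg q))"
proof (rule presentation.intro)
  interpret B: Ring.ring "B_alg m :: (complex, 'N B_elt) module" by (rule ring_B_alg)
  interpret F: Ring.ring "F_alg q :: (complex, 'N F_elt) module" by (rule ring_F_alg)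
  let ?G = "(B_alg m :: (complex, 'N B_elt) module) \<times>\<times> (F_alg q :: (complex, 'N F_elt) module)"
  show "Group.monoid ?G"
    by (rule DirProd_monoid[OF B.monoid_axioms F.monoid_axioms])
  have B: "c \<odot>\<^bsub>B_alg m\<^esub> x \<in> carrier (B_alg m)" if "x \<in> carrier (B_alg m)" for c and x :: "'N B_elt"
    using that smult_presented_algebra_closed[OF _ B_rels_carrier]
    unfolding B_alg_def by (simp add: B_monoid_def monoid_free_monoid)
  have F: "c \<odot>\<^bsub>F_alg q\<^esub> y \<in> carrier (F_alg q)" if "y \<in> carrier (F_alg q)" for c and y :: "'N F_elt"
    using that smult_presented_algebra_closed[OF monoid_free_monoid F_rels_carrier]
    unfolding F_alg_def by blast
  have diff: "x - y \<in> carrier (monoid_algebra ?G)"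
    if "x \<in> carrier (monoid_algebra ?G)" "y \<in> carrier (monoid_algebra ?G)" for x y
    using that Poly_Mapping.keys_add[of x "- y"] by (auto simp: monoid_algebra_def)
  have single: "Poly_Mapping.single (x, y) c \<in> carrier (monoid_algebra ?G)"
    if "x \<in> carrier (B_alg m)" "y \<in> carrier (F_alg q)" for x y c
    using that by (simp add: monoid_algebra_def)
  show "bilinear_rels (B_alg m) (F_alg q) \<subseteq> carrier (monoid_algebra ?G)"
    unfolding bilinear_rels_def using B F by (auto intro!: diff single)
qed

lemma tens:
  fixes x x' :: "'N::{finite,linorder} B_elt" and y y' :: "'N F_elt"
  shows tens_closed: "x \<in> carrier (B_alg m) \<Longrightarrow> y \<in> carrier (F_alg q) \<Longrightarrow> tens q m x y \<in> carrier (BF q m)"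
    and tens_mult: "x \<in> carrier (B_alg m) \<Longrightarrow> y \<in> carrier (F_alg q) \<Longrightarrow> x' \<in> carrier (B_alg m) \<Longrightarrow>
      y' \<in> carrier (F_alg q) \<Longrightarrow> tens q m x y \<otimes>\<^bsub>BF q m\<^esub> tens q m x' y' =
        tens q m (x \<otimes>\<^bsub>B_alg m\<^esub> x') (y \<otimes>\<^bsub>F_alg q\<^esub> y')"
    and tens_one: "tens q m \<one>\<^bsub>B_alg m\<^esub> \<one>\<^bsub>F_alg q\<^esub> = (\<one>\<^bsub>BF q m\<^esub> :: 'N BF_elt)"
    and tens_add_left: "x \<in> carrier (B_alg m) \<Longrightarrow> x' \<in> carrier (B_alg m) \<Longrightarrow> y \<in> carrier (F_alg q) \<Longrightarrow>
      tens q m (x \<oplus>\<^bsub>B_alg m\<^esub> x') y = tens q m x y \<oplus>\<^bsub>BF q m\<^esub> tens q m x' y"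
    and tens_add_right: "x \<in> carrier (B_alg m) \<Longrightarrow> y \<in> carrier (F_alg q) \<Longrightarrow> y' \<in> carrier (F_alg q) \<Longrightarrow>
      tens q m x (y \<oplus>\<^bsub>F_alg q\<^esub> y') = tens q m x y \<oplus>\<^bsub>BF q m\<^esub> tens q m x y'"
proof -
  interpret BF: presentation "(B_alg m :: (complex, 'N B_elt) module) \<times>\<times> (F_alg q :: (complex, 'N F_elt) module)" "bilinear_rels (B_alg m) (F_alg q)"
    by (rule presentation_BF)
  interpret B: Ring.ring "B_alg m :: (complex, 'N B_elt) module" by (rule ring_B_alg)
  interpret F: Ring.ring "F_alg q :: (complex, 'N F_elt) module" by (rule ring_F_alg)
  have t: "tens q m x y = BF.cls (Poly_Mapping.single (x, y) 1)" for x y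
    by (simp add: tens_def pure_tensor_def BF.basis_class_cls)
  have BF: "BF q m = BF.P" by (simp add: BF_def tensor_def)
  show "tens q m x y \<in> carrier (BF q m)" if "x \<in> carrier (B_alg m)" "y \<in> carrier (F_alg q)"
    unfolding t BF using that by simp
  show "tens q m x y \<otimes>\<^bsub>BF q m\<^esub> tens q m x' y' = tens q m (x \<otimes>\<^bsub>B_alg m\<^esub> x') (y \<otimes>\<^bsub>F_alg q\<^esub> y')"
    if "x \<in> carrier (B_alg m)" "y \<in> carrier (F_alg q)" "x' \<in> carrier (B_alg m)" "y' \<in> carrier (F_alg q)"
    unfolding t BF using that BF.cls_single_mult[of "(x, y)" "(x', y')"] by simp
  show "tens q m \<one>\<^bsub>B_alg m\<^esub> \<one>\<^bsub>F_alg q\<^esub> = (\<one>\<^bsub>BF q m\<^esub> :: 'N BF_elt)"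
    unfolding t BF using BF.cls_one by simp
  have add: "BF.cls u = BF.cls v \<oplus>\<^bsub>BF.P\<^esub> BF.cls w" if "u - v - w \<in> bilinear_rels (B_alg m) (F_alg q)"
    "u \<in> carrier BF.MA" "v \<in> carrier BF.MA" "w \<in> carrier BF.MA" for u v w
    using BF.cls_eqI[of u "v + w"] that by (simp add: BF.sum_closed BF.cls_add diff_diff_eq)
  show "tens q m (x \<oplus>\<^bsub>B_alg m\<^esub> x') y = tens q m x y \<oplus>\<^bsub>BF q m\<^esub> tens q m x' y"
    if "x \<in> carrier (B_alg m)" "x' \<in> carrier (B_alg m)" "y \<in> carrier (F_alg q)"
    unfolding t BF
  proof (rule add)
    show "Poly_Mapping.single (x \<oplus>\<^bsub>B_alg m\<^esub> x', y) 1 - Poly_Mapping.single (x, y) 1 - Poly_Mapping.single (x', y) 1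
        \<in> bilinear_rels (B_alg m) (F_alg q)"
      unfolding bilinear_rels_def by (rule UnI1, rule UnI1, rule UnI1) (use that in blast)
  qed (use that in simp_all)
  show "tens q m x (y \<oplus>\<^bsub>F_alg q\<^esub> y') = tens q m x y \<oplus>\<^bsub>BF q m\<^esub> tens q m x y'"
    if "x \<in> carrier (B_alg m)" "y \<in> carrier (F_alg q)" "y' \<in> carrier (F_alg q)"
    unfolding t BF
  proof (rule add)
    show "Poly_Mapping.single (x, y \<oplus>\<^bsub>F_alg q\<^esub> y') 1 - Poly_Mapping.single (x, y) 1 - Poly_Mapping.single (x, y') 1
        \<in> bilinear_rels (B_alg m) (F_alg q)"
      unfolding bilinear_rels_def by (rule UnI1, rule UnI1, rule UnI2) (use that in blast)
  qed (use that in simp_all)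
qed

section \<open>Additivity and passage to the dynamical tensor product\<close>

lemma additive_finsum:
  assumes A: "abelian_group A" and B: "abelian_group B"
    and cl: "\<And>x. x \<in> carrier A \<Longrightarrow> h x \<in> carrier B"
    and add: "\<And>x y. x \<in> carrier A \<Longrightarrow> y \<in> carrier A \<Longrightarrow> h (x \<oplus>\<^bsub>A\<^esub> y) = h x \<oplus>\<^bsub>B\<^esub> h y"
    and f: "finite S" "\<And>s. s \<in> S \<Longrightarrow> f s \<in> carrier A"
  shows "h (\<Oplus>\<^bsub>A\<^esub>s\<in>S. f s) = (\<Oplus>\<^bsub>B\<^esub>s\<in>S. h (f s))"
proof -
  interpret A: abelian_group A by fact
  interpret B: abelian_group B by fact
  have 0: "h \<zero>\<^bsub>A\<^esub> = \<zero>\<^bsub>B\<^esub>"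
    using add[of "\<zero>\<^bsub>A\<^esub>" "\<zero>\<^bsub>A\<^esub>"] cl[of "\<zero>\<^bsub>A\<^esub>"] by simp
  show ?thesis using f
  proof (induction S rule: finite_induct)
    case (insert s S)
    then have "h (\<Oplus>\<^bsub>A\<^esub>s\<in>insert s S. f s) = h (f s \<oplus>\<^bsub>A\<^esub> (\<Oplus>\<^bsub>A\<^esub>s\<in>S. f s))"
      by (subst A.finsum_insert) auto
    also have "\<dots> = h (f s) \<oplus>\<^bsub>B\<^esub> (\<Oplus>\<^bsub>B\<^esub>s\<in>S. h (f s))"
      using insert by (subst add) (auto intro!: A.finsum_closed)
    also have "\<dots> = (\<Oplus>\<^bsub>B\<^esub>s\<in>insert s S. h (f s))"
      using insert cl by (subst B.finsum_insert) auto
    finally show ?case .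
  qed (simp add: 0)
qed

lemma moment_rels_subgroup:
  "subgroup (moment_rels q m) (add_monoid (BF q m :: (complex, 'N::{finite,linorder} BF_elt) module))"
proof -
  interpret T: Ring.ring "BF q m :: (complex, 'N BF_elt) module" by (rule ring_BF)
  interpret B: Ring.ring "B_alg m :: (complex, 'N B_elt) module" by (rule ring_B_alg)
  interpret F: Ring.ring "F_alg q :: (complex, 'N F_elt) module" by (rule ring_F_alg)
  have "mu_l q f \<in> carrier (F_alg q)" for f :: "'N mero"
    using F.cls_closed[OF F_MA, of q "word [Lgen f]"] by (simp add: F_elts F_alg_def)
  then show ?thesis
    unfolding moment_rels_def
    by (intro T.add.generate_is_subgroup) (auto intro!: T.minus_closed tens_closed B_fun_closed)
qed

text \<open>Classes are cosets of a mere additive subgroup. Two of them are shown to agree by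
  exhibiting the difference of representatives as an element of \<open>moment_rels\<close>.\<close>

lemma dyn_class_absorb:
  assumes "d \<in> moment_rels q m" "z \<in> carrier (BF q m)"
  shows "dyn_class q m (d \<oplus>\<^bsub>BF q m\<^esub> z) = dyn_class q m z"
proof -
  interpret T: Ring.ring "BF q m" by (rule ring_BF)
  have H: "moment_rels q m \<subseteq> carrier (BF q m)"
    using subgroup.subset[OF moment_rels_subgroup] by simp
  then have "moment_rels q m +>\<^bsub>BF q m\<^esub> (d \<oplus>\<^bsub>BF q m\<^esub> z) =
      moment_rels q m +>\<^bsub>BF q m\<^esub> d +>\<^bsub>BF q m\<^esub> z"
    using assms by (intro T.a_coset_add_assoc[symmetric]) auto
  also have "moment_rels q m +>\<^bsub>BF q m\<^esub> d = moment_rels q m"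
    using assms(1) H moment_rels_subgroup by (intro T.a_coset_join2) auto
  finally show ?thesis by (simp add: dyn_class_def)
qed

lemma (in abelian_group) finsum_in_subgroup:
  assumes "subgroup H (add_monoid G)" "finite S" "\<And>s. s \<in> S \<Longrightarrow> f s \<in> H"
  shows "(\<Oplus>s\<in>S. f s) \<in> H"
  using assms(2,3)
proof (induction S rule: finite_induct)
  case empty
  then show ?case using subgroup.one_closed[OF assms(1)] by simp
next
  case (insert s S)
  have "H \<subseteq> carrier G" using subgroup.subset[OF assms(1)] by simp
  then have "(\<Oplus>s\<in>insert s S. f s) = f s \<oplus> (\<Oplus>s\<in>S. f s)"
    using insert by (intro finsum_insert) auto
  then show ?case using subgroup.m_closed[OF assms(1)] insert by simp
qed

theorem theorem4p8:
  fixes q :: complex and m n :: nat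
  assumes "m \<ge> 1" "n \<ge> 1" "CARD('N::{finite,linorder}) = m * n"
    and q_generic: "q \<noteq> 0" "\<And>k. k \<ge> 1 \<Longrightarrow> q ^ k \<noteq> 1"
  shows "dyn_class q m (hyper_Pf (BF q m) (BF_act q m) q m n (c_elt q m :: 'N set \<Rightarrow> 'N BF_elt))
       = dyn_class q m (tens q m (hyper_Pf (B_alg m) (B_act m) q m n (b_elt m)) (dyn_det q))"
proof -
  let ?B = "B_alg m :: (complex, 'N B_elt) module"
  let ?F = "F_alg q :: (complex, 'N F_elt) module"
  let ?T = "BF q m :: (complex, 'N BF_elt) module"
  interpret B: Ring.ring ?B by (rule ring_B_alg)
  interpret T: Ring.ring ?T by (rule ring_BF)
  interpret F: dyn_matrix_algebra ?F q "mu_l q :: 'N mero \<Rightarrow> _" "mu_r q" "t_elt q"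
    using q_generic by (rule dyn_matrix_algebra_F_alg)
  note card = assms(3)
  let ?OP = "ordered_partitions m n :: 'N set list set"
  let ?C = "\<lambda>Is :: 'N set list. invprod (asc_weight q) (concat (map desc_list Is))"
  define Sm where "Sm = {J :: 'N set. card J = m}"
  \<comment> \<open>All lists of n index sets of size m, overlaps included. A product of n elements
    c_I expands over the same set LS whatever the sets I are, which makes the two summations
    interchangeable.\<close>
  define LS where "LS = {Js :: 'N set list. length Js = n \<and> set Js \<subseteq> Sm}"
  define bp where "bp Js = ordered_prod ?B (map (b_elt m) Js)" for Js :: "'N set list"
  have finLS: "finite LS"
    unfolding LS_def by (rule finite_subset[OF _ finite_lists_length_eq[of "UNIV :: 'N set set" n]]) auto
  have OP_LS: "?OP \<subseteq> LS" by (auto simp: LS_def Sm_def ordered_partitions_def)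
  have xi: "dyn_minor q J I = F.xi J I" if "card J = card I" for I J :: "'N set"
    using q_generic that by (rule dyn_minor_xi)
  have bp [simp]: "bp Js \<in> carrier ?B" if "Js \<in> LS" for Js
    unfolding bp_def using that by (intro B.ordered_prod_closed) (auto simp: LS_def Sm_def b_elt_closed)
  note [simp] = tens_closed B_fun_closed
  have xip [simp]: "ordered_prod ?F (map2 F.xi Js Is) \<in> carrier ?F" for Js Is
    by (intro F.ordered_prod_closed) auto
  have c_elt: "c_elt q m I = (\<Oplus>\<^bsub>?T\<^esub>J\<in>Sm. tens q m (b_elt m J) (F.xi J I))" if "card I = m" for I
    unfolding c_elt_def Sm_def using that xi by (intro T.finsum_cong') (auto simp: b_elt_closed)
  have c_closed: "c_elt q m I \<in> carrier ?T" if "card I = m" for I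
    unfolding c_elt[OF that] by (intro T.finsum_closed) (auto simp: Sm_def b_elt_closed)
  have prod_tens: "ordered_prod ?T (map2 (\<lambda>I J. tens q m (b_elt m J) (F.xi J I)) Is Js) =
      tens q m (bp Js) (ordered_prod ?F (map2 F.xi Js Is))"
    if "length Is = length Js" "set Js \<subseteq> Sm" for Is Js
    using that
  proof (induction Is Js rule: list_induct2)
    case Nil
    then show ?case by (simp add: bp_def tens_one)
  next
    case (Cons I Is J Js)
    have "ordered_prod ?B (map (b_elt m) Js) \<in> carrier ?B" "b_elt m J \<in> carrier ?B"
      using Cons.prems by (auto intro!: B.ordered_prod_closed b_elt_closed simp: Sm_def subset_iff)
    then show ?case using Cons by (simp add: bp_def tens_mult)
  qed
  have L: "(\<Oplus>\<^bsub>?F\<^esub>Is\<in>?OP. mu_r q (?C Is) \<otimes>\<^bsub>?F\<^esub> ordered_prod ?F (map2 F.xi Js Is)) =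
      (if Js \<in> ?OP then mu_l q (?C Js) \<otimes>\<^bsub>?F\<^esub> dyn_det q else \<zero>\<^bsub>?F\<^esub>)" if "Js \<in> LS" for Js
  proof -
    have "length Js = n" "\<forall>J\<in>set Js. card J = m" using that by (auto simp: LS_def Sm_def)
    from F.laplace_evaluation[OF card this] show ?thesis using xi[of UNIV UNIV] by (simp add: dyn_det_def)
  qed
  have det [simp]: "dyn_det q \<in> carrier ?F" using xi[of UNIV UNIV] by (simp add: dyn_det_def)
  have tens_sum_right: "tens q m x (\<Oplus>\<^bsub>?F\<^esub>s\<in>S. f s) = (\<Oplus>\<^bsub>?T\<^esub>s\<in>S. tens q m x (f s))"
    if "x \<in> carrier ?B" "finite S" "\<And>s. s \<in> S \<Longrightarrow> f s \<in> carrier ?F" for x S and f :: "'N set list \<Rightarrow> _"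
    using that by (intro additive_finsum F.abelian_group_axioms T.abelian_group_axioms) (auto simp: tens_add_right)
  have tens_sum_left: "tens q m (\<Oplus>\<^bsub>?B\<^esub>s\<in>S. f s) y = (\<Oplus>\<^bsub>?T\<^esub>s\<in>S. tens q m (f s) y)"
    if "y \<in> carrier ?F" "finite S" "\<And>s. s \<in> S \<Longrightarrow> f s \<in> carrier ?B" for y S and f :: "'N set list \<Rightarrow> _"
    using that by (intro additive_finsum[where h = "\<lambda>x. tens q m x y"] B.abelian_group_axioms T.abelian_group_axioms)
      (auto simp: tens_add_left)
  have tens_zero: "tens q m x \<zero>\<^bsub>?F\<^esub> = \<zero>\<^bsub>?T\<^esub>" if "x \<in> carrier ?B" for x
    using tens_sum_right[OF that, of "{}"] by simp
  have act: "BF_act q m f z \<in> carrier ?T" if "z \<in> carrier ?T" for f z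
    using that by (simp add: BF_act_def)
  have summand: "BF_act q m (?C Is) (ordered_prod ?T (map (c_elt q m) Is)) =
      (\<Oplus>\<^bsub>?T\<^esub>Js\<in>LS. tens q m (bp Js) (mu_r q (?C Is) \<otimes>\<^bsub>?F\<^esub> ordered_prod ?F (map2 F.xi Js Is)))"
    if Is: "Is \<in> ?OP" for Is
  proof -
    have cI: "\<And>I. I \<in> set Is \<Longrightarrow> card I = m" and lI: "length Is = n"
      using Is by (auto simp: ordered_partitions_def)
    have "listset (map (\<lambda>_. Sm) Is) = LS"
      using lI by (auto simp: in_listset LS_def list_all2_conv_all_nth subset_code(1) all_set_conv_all_nth)
    moreover have "map (c_elt q m) Is = map (\<lambda>I. \<Oplus>\<^bsub>?T\<^esub>J\<in>Sm. tens q m (b_elt m J) (F.xi J I)) Is"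
      using cI c_elt by simp
    moreover have "ordered_prod ?T (map (\<lambda>I. \<Oplus>\<^bsub>?T\<^esub>J\<in>Sm. tens q m (b_elt m J) (F.xi J I)) Is) =
        (\<Oplus>\<^bsub>?T\<^esub>Js\<in>listset (map (\<lambda>_. Sm) Is). ordered_prod ?T (map2 (\<lambda>I J. tens q m (b_elt m J) (F.xi J I)) Is Js))"
      by (rule T.ordered_prod_finsum) (auto simp: Sm_def b_elt_closed)
    ultimately have "ordered_prod ?T (map (c_elt q m) Is) =
        (\<Oplus>\<^bsub>?T\<^esub>Js\<in>LS. ordered_prod ?T (map2 (\<lambda>I J. tens q m (b_elt m J) (F.xi J I)) Is Js))"
      by (simp only:)
    also have "\<dots> = (\<Oplus>\<^bsub>?T\<^esub>Js\<in>LS. tens q m (bp Js) (ordered_prod ?F (map2 F.xi Js Is)))"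
    proof (rule T.finsum_cong'[OF refl])
      fix Js assume "Js \<in> LS"
      then show "ordered_prod ?T (map2 (\<lambda>I J. tens q m (b_elt m J) (F.xi J I)) Is Js) =
          tens q m (bp Js) (ordered_prod ?F (map2 F.xi Js Is))"
        using lI by (intro prod_tens) (auto simp: LS_def)
    qed auto
    finally have "BF_act q m (?C Is) (ordered_prod ?T (map (c_elt q m) Is)) =
        (\<Oplus>\<^bsub>?T\<^esub>Js\<in>LS. tens q m \<one>\<^bsub>?B\<^esub> (mu_r q (?C Is)) \<otimes>\<^bsub>?T\<^esub> tens q m (bp Js) (ordered_prod ?F (map2 F.xi Js Is)))"
      unfolding BF_act_def using finLS by (simp add: T.finsum_rdistr Pi_def)
    also have "\<dots> = (\<Oplus>\<^bsub>?T\<^esub>Js\<in>LS. tens q m (bp Js) (mu_r q (?C Is) \<otimes>\<^bsub>?F\<^esub> ordered_prod ?F (map2 F.xi Js Is)))"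
      by (intro T.finsum_cong') (auto simp: tens_mult)
    finally show ?thesis .
  qed
  have "hyper_Pf ?T (BF_act q m) q m n (c_elt q m) =
      (\<Oplus>\<^bsub>?T\<^esub>Is\<in>?OP. BF_act q m (?C Is) (ordered_prod ?T (map (c_elt q m) Is)))"
    by (rule hyper_Pf_partitions[OF ring_BF card act c_closed])
  also have "\<dots> = (\<Oplus>\<^bsub>?T\<^esub>Is\<in>?OP. \<Oplus>\<^bsub>?T\<^esub>Js\<in>LS.
      tens q m (bp Js) (mu_r q (?C Is) \<otimes>\<^bsub>?F\<^esub> ordered_prod ?F (map2 F.xi Js Is)))"
    by (intro T.finsum_cong') (auto intro!: T.finsum_closed simp: summand)
  \<comment> \<open>With the row blocks Js fixed outside, the inner sum over the column blocks is
    the one computed in \<open>laplace_evaluation\<close>.\<close>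
  also have "\<dots> = (\<Oplus>\<^bsub>?T\<^esub>Js\<in>LS. \<Oplus>\<^bsub>?T\<^esub>Is\<in>?OP.
      tens q m (bp Js) (mu_r q (?C Is) \<otimes>\<^bsub>?F\<^esub> ordered_prod ?F (map2 F.xi Js Is)))"
    using finite_ordered_partitions finLS by (intro T.finsum_swap) auto
  also have "\<dots> = (\<Oplus>\<^bsub>?T\<^esub>Js\<in>LS. tens q m (bp Js)
      (if Js \<in> ?OP then mu_l q (?C Js) \<otimes>\<^bsub>?F\<^esub> dyn_det q else \<zero>\<^bsub>?F\<^esub>))"
  proof (rule T.finsum_cong'[OF refl])
    fix Js assume Js: "Js \<in> LS"
    show "(\<Oplus>\<^bsub>?T\<^esub>Is\<in>?OP. tens q m (bp Js) (mu_r q (?C Is) \<otimes>\<^bsub>?F\<^esub> ordered_prod ?F (map2 F.xi Js Is))) =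
        tens q m (bp Js) (if Js \<in> ?OP then mu_l q (?C Js) \<otimes>\<^bsub>?F\<^esub> dyn_det q else \<zero>\<^bsub>?F\<^esub>)"
      unfolding L[OF Js, symmetric]
      by (rule tens_sum_right[symmetric]) (use Js in \<open>simp_all add: finite_ordered_partitions\<close>)
  qed auto
  also have "\<dots> = (\<Oplus>\<^bsub>?T\<^esub>Js\<in>?OP. tens q m (bp Js) (mu_l q (?C Js) \<otimes>\<^bsub>?F\<^esub> dyn_det q))"
    using finLS OP_LS by (intro T.add.finprod_mono_neutral_cong_right) (auto simp: tens_zero)
  finally have lhs: "hyper_Pf ?T (BF_act q m) q m n (c_elt q m) =
      (\<Oplus>\<^bsub>?T\<^esub>Js\<in>?OP. tens q m (bp Js) (mu_l q (?C Js) \<otimes>\<^bsub>?F\<^esub> dyn_det q))" .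
  have OPc: "bp Js \<in> carrier ?B" if "Js \<in> ?OP" for Js using that OP_LS by auto
  have "hyper_Pf ?B (B_act m) q m n (b_elt m) = (\<Oplus>\<^bsub>?B\<^esub>Js\<in>?OP. B_act m (?C Js) (bp Js))"
    unfolding bp_def
    by (rule hyper_Pf_partitions[OF ring_B_alg card _ b_elt_closed]) (simp_all add: B_act_def)
  then have pf: "hyper_Pf ?B (B_act m) q m n (b_elt m) = (\<Oplus>\<^bsub>?B\<^esub>Js\<in>?OP. B_fun m (?C Js) \<otimes>\<^bsub>?B\<^esub> bp Js)"
    by (simp add: B_act_def)
  have rhs: "tens q m (hyper_Pf ?B (B_act m) q m n (b_elt m)) (dyn_det q) =
      (\<Oplus>\<^bsub>?T\<^esub>Js\<in>?OP. tens q m (B_fun m (?C Js) \<otimes>\<^bsub>?B\<^esub> bp Js) (dyn_det q))"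
    unfolding pf by (rule tens_sum_left[OF det finite_ordered_partitions]) (simp add: OPc)
  \<comment> \<open>Corresponding summands of the two sides: the same function stands on the left of
    the determinant in ?u and acts on the product of the b_J in ?v. Their difference is a generator
    of \<open>moment_rels\<close>, so the sums agree modulo that subgroup.\<close>
  let ?u = "\<lambda>Js. tens q m (bp Js) (mu_l q (?C Js) \<otimes>\<^bsub>?F\<^esub> dyn_det q)"
    and ?v = "\<lambda>Js. tens q m (B_fun m (?C Js) \<otimes>\<^bsub>?B\<^esub> bp Js) (dyn_det q)"
  have uv: "?u Js \<in> carrier ?T" "?v Js \<in> carrier ?T" if "Js \<in> ?OP" for Js
    using OPc[OF that] by simp_all
  have "(\<Oplus>\<^bsub>?T\<^esub>Js\<in>?OP. ?u Js) = (\<Oplus>\<^bsub>?T\<^esub>Js\<in>?OP. (?u Js \<ominus>\<^bsub>?T\<^esub> ?v Js) \<oplus>\<^bsub>?T\<^esub> ?v Js)"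
    using uv by (intro T.finsum_cong') (auto simp: T.minus_eq T.a_assoc T.l_neg)
  also have "\<dots> = (\<Oplus>\<^bsub>?T\<^esub>Js\<in>?OP. ?u Js \<ominus>\<^bsub>?T\<^esub> ?v Js) \<oplus>\<^bsub>?T\<^esub> (\<Oplus>\<^bsub>?T\<^esub>Js\<in>?OP. ?v Js)"
    using uv by (intro T.finsum_addf) auto
  finally have sum: "(\<Oplus>\<^bsub>?T\<^esub>Js\<in>?OP. ?u Js) =
      (\<Oplus>\<^bsub>?T\<^esub>Js\<in>?OP. ?u Js \<ominus>\<^bsub>?T\<^esub> ?v Js) \<oplus>\<^bsub>?T\<^esub> (\<Oplus>\<^bsub>?T\<^esub>Js\<in>?OP. ?v Js)" .
  have "?u Js \<ominus>\<^bsub>?T\<^esub> ?v Js \<in> moment_rels q m" if "Js \<in> ?OP" for Js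
    unfolding moment_rels_def using OPc[OF that] det by (intro generate.incl) blast
  then have "(\<Oplus>\<^bsub>?T\<^esub>Js\<in>?OP. ?u Js \<ominus>\<^bsub>?T\<^esub> ?v Js) \<in> moment_rels q m"
    by (intro T.finsum_in_subgroup moment_rels_subgroup finite_ordered_partitions)
  then show ?thesis
    unfolding lhs rhs sum using uv by (intro dyn_class_absorb T.finsum_closed) auto
qed

end
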